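(* Let $A$ be a bialgebra over a field $k$ and let $M,N$ be left-right Yetter-Drinfel'd modules over $A$. For $n,p\ge 0$ let $Y^{n,p}(M,N)=\mathrm{Hom}_k(A^{\otimes n}\otimes M,\,N\otimes A^{\otimes p})$, and let $d_m^{n,p}:Y^{n,p}(M,N)\to Y^{n+1,p}(M,N)$ and $d_c^{n,p}:Y^{n,p}(M,N)\to Y^{n,p+1}(M,N)$ be the maps defined in the context. Then $(Y^{n,p}(M,N),d_m^{n,p},d_c^{n,p})$ is a double complex, i.e. for all $n,p\ge 0$ $$d_m^{n+1,p}\circ d_m^{n,p}=0,\qquad d_c^{n,p+1}\circ d_c^{n,p}=0,\qquad d_c^{n+1,p}\circ d_m^{n,p}=d_m^{n,p+1}\circ d_c^{n,p}.$$
   Context: $k$ is a field, all linear spaces, tensor products and Homs are over $k$; $A^n$ denotes $A^{\otimes n}$ with $A^0=k$. Sweedler notation: $\Delta(a)=\sum a_1\otimes a_2$, iterated $\sum a_1\otimes\cdots\otimes a_{r}$. A left-right Yetter-Drinfel'd module over a bialgebra $A$ is a $k$-space $M$ that is a left $A$-module ($a\otimes m\mapsto a\cdot m$) and a right $A$-comodule ($\rho_M(m)=\sum m_0\otimes m_1\in M\otimes A$) with $$\sum (a_2\cdot m)_0\otimes (a_2\cdot m)_1a_1=\sum a_1\cdot m_0\otimes a_2m_1\quad\text{for all } a\in A,\ m\in M.$$ For $f\in Y^{n,p}(M,N)$ write $f(x)=\sum f(x)^0\otimes f(x)^1\otimes\cdots\otimes f(x)^p$ with $f(x)^0\in N$ and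 $f(x)^j\in A$ for $j\ge1$. Superscripts on $a^1,\dots,a^n\in A$ are indices. Maps $b_i^{n,p}:Y^{n,p}\to Y^{n+1,p}$, $0\le i\le n+1$: - $b_0^{n,p}(f)(a^1\otimes\cdots\otimes a^{n+1}\otimes m)=\sum (a^1)_1\cdot f(x)^0\otimes (a^1)_2f(x)^1\otimes\cdots\otimes(a^1)_{p+1}f(x)^p$, with $x=a^2\otimes\cdots\otimes a^{n+1}\otimes m$; - $b_i^{n,p}(f)(a^1\otimes\cdots\otimes a^{n+1}\otimes m)=f(a^1\otimes\cdots\otimes a^ia^{i+1}\otimes\cdots\otimes a^{n+1}\otimes m)$ for $1\le i\le n$; - $b_{n+1}^{n,p}(f)(a^1\otimes\cdots\otimes a^{n+1}\otimes m)=\sum f(y)^0\otimes f(y)^1(a^{n+1})_1\otimes\cdots\otimes f(y)^p(a^{n+1})_p$, with $y=a^1\otimes\cdots\otimes a^n\otimes (a^{n+1})_{p+1}\cdot m$. Maps $c_i^{n,p}:Y^{n,p}\to Y^{n,p+1}$, $0\le i\le p+1$: - $c_0^{n,p}(f)(a^1\otimes\cdots\otimes a^n\otimes m)=\sum (f(z)^0)_0\otimes (f(z)^0)_1(a^1)_1\cdots(a^n)_1\otimes f(z)^1\otimes\cdots\otimes f(z)^p$, with $z=(a^1)_2\otimes\cdots\otimes(a^n)_2\otimes m$; - for $1\le i\le p$, $c_i^{n,p}(f)(x)=\sum f(x)^0\otimes\cdots\otimes (f(x)^i)_1\otimes(f(x)^i)_2\otimes\cdots\otimes f(x)^p$ ($\Delta$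 applied to the $i$-th $A$-factor); - $c_{p+1}^{n,p}(f)(a^1\otimes\cdots\otimes a^n\otimes m)=\sum f((a^1)_1\otimes\cdots\otimes(a^n)_1\otimes m_0)\otimes (a^1)_2\cdots(a^n)_2m_1$. (Empty products, when $n=0$, equal $1$.) Finally $d_m^{n,p}=\sum_{i=0}^{n+1}(-1)^ib_i^{n,p}$ and $d_c^{n,p}=\sum_{i=0}^{p+1}(-1)^ic_i^{n,p}$. *)

theory Defs
  imports Complex_Main "HOL-Library.Poly_Mapping" "HOL-Library.FuncSet"
begin

section \<open>Vector spaces with an explicit carrier\<close>

text \<open>
  Tensor products depend on the scalar actions of their factors, so they cannot be turned into
  types; they and the Hom spaces between them are vector spaces on explicit carriers.
\<close>

record ('k, 'v) vspace =
  carr :: "'v set"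
  vzero :: 'v
  vadd :: "'v \<Rightarrow> 'v \<Rightarrow> 'v"
  vscale :: "'k \<Rightarrow> 'v \<Rightarrow> 'v"

definition type_space :: "('k \<Rightarrow> 'v \<Rightarrow> 'v) \<Rightarrow> ('k, 'v :: ab_group_add) vspace" where
  "type_space s = \<lparr>carr = UNIV, vzero = 0, vadd = (+), vscale = s\<rparr>"

definition linear_map :: "('k, 'v) vspace \<Rightarrow> ('k, 'w) vspace \<Rightarrow> ('v \<Rightarrow> 'w) \<Rightarrow> bool" where
  "linear_map V W f \<longleftrightarrow>
     f \<in> carr V \<rightarrow> carr W \<and>
     (\<forall>x \<in> carr V. \<forall>y \<in> carr V. f (vadd V x y) = vadd W (f x) (f y)) \<and>
     (\<forall>c. \<forall>x \<in> carr V. f (vscale V c x) = vscale W c (f x))"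

text \<open>Elements of a Hom space are extensional, so that equality of maps on the carrier is equality.\<close>

definition Hom_space :: "('k, 'v) vspace \<Rightarrow> ('k, 'w) vspace \<Rightarrow> ('k, 'v \<Rightarrow> 'w) vspace" where
  "Hom_space V W =
     \<lparr>carr = {f \<in> extensional (carr V). linear_map V W f},
      vzero = (\<lambda>x\<in>carr V. vzero W),
      vadd = (\<lambda>f g. \<lambda>x\<in>carr V. vadd W (f x) (g x)),
      vscale = (\<lambda>c f. \<lambda>x\<in>carr V. vscale W c (f x))\<rparr>"

text \<open>\<open>alt_sum V F r\<close> is the sum of \<open>(-1)^i F i\<close> over \<open>i < r\<close>, taken in \<open>V\<close>.\<close>

primrec alt_sum :: "('k :: comm_ring_1, 'v) vspace \<Rightarrow> (nat \<Rightarrow> 'v) \<Rightarrow> nat \<Rightarrow> 'v" where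
  "alt_sum V F 0 = vzero V"
| "alt_sum V F (Suc r) = vadd V (alt_sum V F r) (vscale V ((- 1) ^ r) (F r))"


section \<open>Tensor products\<close>

text \<open>Finitely supported functions \<open>'g \<Rightarrow>\<^sub>0 'k\<close> form the free \<open>'k\<close>-space on \<open>'g\<close>.\<close>

definition fscale :: "'k :: field \<Rightarrow> ('g \<Rightarrow>\<^sub>0 'k) \<Rightarrow> ('g \<Rightarrow>\<^sub>0 'k)" where
  "fscale c x = Poly_Mapping.map (\<lambda>d. c * d) x"

abbreviation gen :: "'g \<Rightarrow> ('g \<Rightarrow>\<^sub>0 'k :: field)" where
  "gen g \<equiv> Poly_Mapping.single g 1"

text \<open>
  \<open>tensor sA sV n\<close> is the tensor product of one copy of the space \<open>'v\<close> (scalar action \<open>sV\<close>) and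
  \<open>n\<close> copies of the space \<open>'a\<close> (scalar action \<open>sA\<close>): the free space on the pairs
  \<open>(v, [a\<^sub>1, \<dots>, a\<^sub>n])\<close> modulo the span of the multilinearity relations. The same pair encodes the
  pure tensor of \<open>V \<otimes> A\<^sup>n\<close> that lists \<open>v\<close> first and the pure tensor of \<open>A\<^sup>n \<otimes> V\<close> that lists \<open>v\<close> last.
\<close>

definition free_part :: "nat \<Rightarrow> ('v \<times> 'a list \<Rightarrow>\<^sub>0 'k :: field) set" where
  "free_part n = {x. \<forall>g \<in> Poly_Mapping.keys x. length (snd g) = n}"

definition multilinear_rels ::
  "('k \<Rightarrow> 'a \<Rightarrow> 'a) \<Rightarrow> ('k \<Rightarrow> 'v \<Rightarrow> 'v) \<Rightarrow> nat
     \<Rightarrow> ('v :: ab_group_add \<times> 'a :: ab_group_add list \<Rightarrow>\<^sub>0 'k :: field) set" where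
  "multilinear_rels sA sV n =
     {gen (v + w, as) - gen (v, as) - gen (w, as) | v w as. length as = n} \<union>
     {gen (sV c v, as) - fscale c (gen (v, as)) | c v as. length as = n} \<union>
     {gen (v, as[i := a + b]) - gen (v, as[i := a]) - gen (v, as[i := b])
       | v as i a b. length as = n \<and> i < n} \<union>
     {gen (v, as[i := sA c a]) - fscale c (gen (v, as[i := a]))
       | c v as i a. length as = n \<and> i < n}"

definition tensor_rel ::
  "('k \<Rightarrow> 'a \<Rightarrow> 'a) \<Rightarrow> ('k \<Rightarrow> 'v \<Rightarrow> 'v) \<Rightarrow> nat
     \<Rightarrow> ('v :: ab_group_add \<times> 'a :: ab_group_add list \<Rightarrow>\<^sub>0 'k :: field) rel" where
  "tensor_rel sA sV n =
     {(x, y). x \<in> free_part n \<and> y \<in> free_part n \<and>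
              x - y \<in> module.span fscale (multilinear_rels sA sV n)}"

type_synonym ('k, 'v, 'a) tens = "('v \<times> 'a list \<Rightarrow>\<^sub>0 'k) set"

definition tclass ::
  "('k \<Rightarrow> 'a \<Rightarrow> 'a) \<Rightarrow> ('k \<Rightarrow> 'v \<Rightarrow> 'v) \<Rightarrow> nat \<Rightarrow> ('v \<times> 'a list \<Rightarrow>\<^sub>0 'k)
     \<Rightarrow> ('k :: field, 'v :: ab_group_add, 'a :: ab_group_add) tens" where
  "tclass sA sV n x = tensor_rel sA sV n `` {x}"

definition rep :: "'x set \<Rightarrow> 'x" where
  "rep t = (SOME x. x \<in> t)"

definition tensor ::
  "('k \<Rightarrow> 'a \<Rightarrow> 'a) \<Rightarrow> ('k \<Rightarrow> 'v \<Rightarrow> 'v) \<Rightarrow> nat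
     \<Rightarrow> ('k :: field, ('k, 'v :: ab_group_add, 'a :: ab_group_add) tens) vspace" where
  "tensor sA sV n =
     \<lparr>carr = free_part n // tensor_rel sA sV n,
      vzero = tclass sA sV n 0,
      vadd = (\<lambda>t u. tclass sA sV n (rep t + rep u)),
      vscale = (\<lambda>c t. tclass sA sV n (fscale c (rep t)))\<rparr>"

text \<open>
  Sweedler notation. If the class \<open>t\<close> is represented by the formal sum of \<open>c\<^sub>g g\<close>, then
  \<open>sweedler s t \<phi>\<close> is the sum of the \<open>s c\<^sub>g (\<phi> g)\<close>. The representative is an arbitrary choice,
  as in the informal notation; the result (after passing to classes, where \<open>\<phi>\<close> has values in a
  free space) does not depend on it whenever \<open>\<phi>\<close> is multilinear.
\<close>

definition lin_ext :: "('k \<Rightarrow> 'w \<Rightarrow> 'w) \<Rightarrow> ('g \<Rightarrow>\<^sub>0 'k :: field) \<Rightarrow> ('g \<Rightarrow> 'w) \<Rightarrow> 'w :: ab_group_add" where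
  "lin_ext s x \<phi> = (\<Sum>g \<in> Poly_Mapping.keys x. s (Poly_Mapping.lookup x g) (\<phi> g))"

definition sweedler ::
  "('k \<Rightarrow> 'w \<Rightarrow> 'w) \<Rightarrow> ('g \<Rightarrow>\<^sub>0 'k :: field) set \<Rightarrow> ('g \<Rightarrow> 'w) \<Rightarrow> 'w :: ab_group_add" where
  "sweedler s t \<phi> = lin_ext s (rep t) \<phi>"

abbreviation sw ::
  "('g \<Rightarrow>\<^sub>0 'k :: field) set \<Rightarrow> ('g \<Rightarrow> ('h \<Rightarrow>\<^sub>0 'k)) \<Rightarrow> ('h \<Rightarrow>\<^sub>0 'k)" where
  "sw \<equiv> sweedler fscale"


section \<open>Bialgebras\<close>

text \<open>
  The underlying ring of the bialgebra is the ring structure of the type \<open>'a\<close>. The space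
  \<open>A \<otimes> A\<close> is \<open>tensor _ _ 1\<close>, with pure tensors \<open>(a, [b])\<close>; a variable bound to such a
  one-element list is read off with \<open>hd\<close>.
\<close>

record (overloaded) ('k, 'a) bialgebra_data =
  ascale :: "'k \<Rightarrow> 'a \<Rightarrow> 'a"
  comult :: "'a \<Rightarrow> ('k, 'a, 'a) tens"
  counit :: "'a \<Rightarrow> 'k"

definition is_algebra :: "('k :: field \<Rightarrow> 'a :: ring_1 \<Rightarrow> 'a) \<Rightarrow> bool" where
  "is_algebra s \<longleftrightarrow> vector_space s \<and>
     (\<forall>c a b. s c a * b = s c (a * b) \<and> a * s c b = s c (a * b))"

definition is_coalgebra :: "('k :: field, 'a :: ring_1) bialgebra_data \<Rightarrow> bool" where
  "is_coalgebra A \<longleftrightarrow>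
     vector_space (ascale A) \<and>
     linear_map (type_space (ascale A)) (tensor (ascale A) (ascale A) 1) (comult A) \<and>
     linear_map (type_space (ascale A)) (type_space (*)) (counit A) \<and>
     (\<forall>a. tclass (ascale A) (ascale A) 2
            (sw (comult A a) (\<lambda>(x, y). sw (comult A x) (\<lambda>(u, v). gen (u, v @ y)))) =
          tclass (ascale A) (ascale A) 2
            (sw (comult A a) (\<lambda>(x, y). sw (comult A (hd y)) (\<lambda>(u, v). gen (x, u # v))))) \<and>
     (\<forall>a. sweedler (ascale A) (comult A a) (\<lambda>(x, y). ascale A (counit A x) (hd y)) = a) \<and>
     (\<forall>a. sweedler (ascale A) (comult A a) (\<lambda>(x, y). ascale A (counit A (hd y)) x) = a)"

definition is_bialgebra :: "('k :: field, 'a :: ring_1) bialgebra_data \<Rightarrow> bool" where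
  "is_bialgebra A \<longleftrightarrow>
     is_algebra (ascale A) \<and> is_coalgebra A \<and>
     comult A 1 = tclass (ascale A) (ascale A) 1 (gen (1, [1])) \<and>
     (\<forall>a b. comult A (a * b) = tclass (ascale A) (ascale A) 1
        (sw (comult A a) (\<lambda>(a1, a2). sw (comult A b) (\<lambda>(b1, b2).
           gen (a1 * b1, [hd a2 * hd b2]))))) \<and>
     counit A 1 = 1 \<and>
     (\<forall>a b. counit A (a * b) = counit A a * counit A b)"


section \<open>Yetter-Drinfel'd modules\<close>

record (overloaded) ('k, 'a, 'm) yd_data =
  mscale :: "'k \<Rightarrow> 'm \<Rightarrow> 'm"
  act :: "'a \<Rightarrow> 'm \<Rightarrow> 'm"
  coact :: "'m \<Rightarrow> ('k, 'm, 'a) tens"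

definition is_left_module ::
  "('k :: field, 'a :: ring_1) bialgebra_data \<Rightarrow> ('k, 'a, 'm :: ab_group_add) yd_data \<Rightarrow> bool" where
  "is_left_module A M \<longleftrightarrow>
     vector_space (mscale M) \<and>
     (\<forall>a b m. act M (a + b) m = act M a m + act M b m) \<and>
     (\<forall>a m m'. act M a (m + m') = act M a m + act M a m') \<and>
     (\<forall>c a m. act M (ascale A c a) m = mscale M c (act M a m)) \<and>
     (\<forall>c a m. act M a (mscale M c m) = mscale M c (act M a m)) \<and>
     (\<forall>m. act M 1 m = m) \<and>
     (\<forall>a b m. act M (a * b) m = act M a (act M b m))"

definition is_right_comodule ::
  "('k :: field, 'a :: ring_1) bialgebra_data \<Rightarrow> ('k, 'a, 'm :: ab_group_add) yd_data \<Rightarrow> bool" where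
  "is_right_comodule A M \<longleftrightarrow>
     vector_space (mscale M) \<and>
     linear_map (type_space (mscale M)) (tensor (ascale A) (mscale M) 1) (coact M) \<and>
     (\<forall>m. tclass (ascale A) (mscale M) 2
            (sw (coact M m) (\<lambda>(x, y). sw (coact M x) (\<lambda>(u, v). gen (u, v @ y)))) =
          tclass (ascale A) (mscale M) 2
            (sw (coact M m) (\<lambda>(x, y). sw (comult A (hd y)) (\<lambda>(u, v). gen (x, u # v))))) \<and>
     (\<forall>m. sweedler (mscale M) (coact M m) (\<lambda>(x, y). mscale M (counit A (hd y)) x) = m)"

definition is_yetter_drinfeld ::
  "('k :: field, 'a :: ring_1) bialgebra_data \<Rightarrow> ('k, 'a, 'm :: ab_group_add) yd_data \<Rightarrow> bool" where
  "is_yetter_drinfeld A M \<longleftrightarrow>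
     is_left_module A M \<and> is_right_comodule A M \<and>
     (\<forall>a m.
        tclass (ascale A) (mscale M) 1
          (sw (comult A a) (\<lambda>(a1, a2). sw (coact M (act M (hd a2) m)) (\<lambda>(x0, x1).
             gen (x0, [hd x1 * a1])))) =
        tclass (ascale A) (mscale M) 1
          (sw (comult A a) (\<lambda>(a1, a2). sw (coact M m) (\<lambda>(m0, m1).
             gen (act M a1 m0, [hd a2 * hd m1])))))"


section \<open>The spaces and maps of the double complex\<close>

text \<open>\<open>iter_comult A r a\<close> is \<open>a\<^sub>1 \<otimes> \<dots> \<otimes> a\<^sub>r\<^sub>+\<^sub>1\<close>, encoded as pairs \<open>(a\<^sub>1, [a\<^sub>2, \<dots>, a\<^sub>r\<^sub>+\<^sub>1])\<close>.\<close>

primrec iter_comult ::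
  "('k :: field, 'a :: ring_1) bialgebra_data \<Rightarrow> nat \<Rightarrow> 'a \<Rightarrow> ('k, 'a, 'a) tens" where
  "iter_comult A 0 a = tclass (ascale A) (ascale A) 0 (gen (a, []))"
| "iter_comult A (Suc r) a = tclass (ascale A) (ascale A) (Suc r)
     (sw (iter_comult A r a) (\<lambda>(x, y). sw (comult A x) (\<lambda>(u, v). gen (u, v @ y))))"

text \<open>
  Simultaneous comultiplication of \<open>a\<^sup>1, \<dots>, a\<^sup>n\<close>: a formal sum of the pairs of lists
  \<open>([(a\<^sup>1)\<^sub>1, \<dots>, (a\<^sup>n)\<^sub>1], [(a\<^sup>1)\<^sub>2, \<dots>, (a\<^sup>n)\<^sub>2])\<close>.
\<close>

primrec list_comult ::
  "('k :: field, 'a :: ring_1) bialgebra_data \<Rightarrow> 'a list \<Rightarrow> ('a list \<times> 'a list \<Rightarrow>\<^sub>0 'k)" where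
  "list_comult A [] = gen ([], [])"
| "list_comult A (a # as) =
     sw (comult A a) (\<lambda>(x, y). lin_ext fscale (list_comult A as) (\<lambda>(us, vs). gen (x # us, hd y # vs)))"

text \<open>\<open>TA A M n\<close> is \<open>A\<^sup>n \<otimes> M\<close> as a domain and \<open>M \<otimes> A\<^sup>n\<close> as a codomain.\<close>

abbreviation TA ::
  "('k, 'a) bialgebra_data \<Rightarrow> ('k, 'a, 'm) yd_data \<Rightarrow> nat
     \<Rightarrow> ('k :: field, ('k, 'm :: ab_group_add, 'a :: ring_1) tens) vspace" where
  "TA A M n \<equiv> tensor (ascale A) (mscale M) n"

abbreviation cls ::
  "('k, 'a) bialgebra_data \<Rightarrow> ('k, 'a, 'm) yd_data \<Rightarrow> nat \<Rightarrow> ('m \<times> 'a list \<Rightarrow>\<^sub>0 'k)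
     \<Rightarrow> ('k :: field, 'm :: ab_group_add, 'a :: ring_1) tens" where
  "cls A M n \<equiv> tclass (ascale A) (mscale M) n"

definition Y ::
  "('k, 'a) bialgebra_data \<Rightarrow> ('k, 'a, 'm) yd_data \<Rightarrow> ('k, 'a, 'n) yd_data \<Rightarrow> nat \<Rightarrow> nat
     \<Rightarrow> ('k :: field, ('k, 'm :: ab_group_add, 'a :: ring_1) tens
                      \<Rightarrow> ('k, 'n :: ab_group_add, 'a) tens) vspace" where
  "Y A M N n p = Hom_space (TA A M n) (TA A N p)"

text \<open>
  The value of \<open>b\<^sub>i(f)\<close> and \<open>c\<^sub>i(f)\<close> on a generator, as a formal sum; \<open>as ! j\<close> is \<open>a\<^sup>j\<^sup>+\<^sup>1\<close>.
\<close>

definition b_gen ::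
  "('k, 'a) bialgebra_data \<Rightarrow> ('k, 'a, 'm) yd_data \<Rightarrow> ('k, 'a, 'n) yd_data \<Rightarrow> nat \<Rightarrow> nat \<Rightarrow> nat
     \<Rightarrow> (('k :: field, 'm :: ab_group_add, 'a :: ring_1) tens \<Rightarrow> ('k, 'n :: ab_group_add, 'a) tens)
     \<Rightarrow> 'm \<times> 'a list \<Rightarrow> ('n \<times> 'a list \<Rightarrow>\<^sub>0 'k)" where
  "b_gen A M N n p i f = (\<lambda>(m, as).
     if i = 0 then
       sw (iter_comult A p (hd as)) (\<lambda>(x, xs).
         sw (f (cls A M n (gen (m, tl as)))) (\<lambda>(v, vs).
           gen (act N x v, map2 (*) xs vs)))
     else if i \<le> n then
       rep (f (cls A M n (gen (m, take (i - 1) as @ (as ! (i - 1) * as ! i) # drop (i + 1) as))))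
     else
       sw (iter_comult A p (last as)) (\<lambda>(x, xs).
         sw (f (cls A M n (gen (act M (last (x # xs)) m, butlast as)))) (\<lambda>(v, vs).
           gen (v, map2 (*) vs (butlast (x # xs))))))"

definition c_gen ::
  "('k, 'a) bialgebra_data \<Rightarrow> ('k, 'a, 'm) yd_data \<Rightarrow> ('k, 'a, 'n) yd_data \<Rightarrow> nat \<Rightarrow> nat \<Rightarrow> nat
     \<Rightarrow> (('k :: field, 'm :: ab_group_add, 'a :: ring_1) tens \<Rightarrow> ('k, 'n :: ab_group_add, 'a) tens)
     \<Rightarrow> 'm \<times> 'a list \<Rightarrow> ('n \<times> 'a list \<Rightarrow>\<^sub>0 'k)" where
  "c_gen A M N n p i f = (\<lambda>(m, as).
     if i = 0 then
       lin_ext fscale (list_comult A as) (\<lambda>(as1, as2).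
         sw (f (cls A M n (gen (m, as2)))) (\<lambda>(v, vs).
           sw (coact N v) (\<lambda>(v0, v1). gen (v0, (hd v1 * prod_list as1) # vs))))
     else if i \<le> p then
       sw (f (cls A M n (gen (m, as)))) (\<lambda>(v, vs).
         sw (comult A (vs ! (i - 1))) (\<lambda>(x, y). gen (v, take (i - 1) vs @ x # y @ drop i vs)))
     else
       lin_ext fscale (list_comult A as) (\<lambda>(as1, as2).
         sw (coact M m) (\<lambda>(m0, m1).
           sw (f (cls A M n (gen (m0, as1)))) (\<lambda>(v, vs).
             gen (v, vs @ [prod_list as2 * hd m1])))))"

definition b_map ::
  "('k, 'a) bialgebra_data \<Rightarrow> ('k, 'a, 'm) yd_data \<Rightarrow> ('k, 'a, 'n) yd_data \<Rightarrow> nat \<Rightarrow> nat \<Rightarrow> nat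
     \<Rightarrow> (('k :: field, 'm :: ab_group_add, 'a :: ring_1) tens \<Rightarrow> ('k, 'n :: ab_group_add, 'a) tens)
     \<Rightarrow> (('k, 'm, 'a) tens \<Rightarrow> ('k, 'n, 'a) tens)" where
  "b_map A M N n p i f =
     (\<lambda>t \<in> carr (TA A M (n + 1)). cls A N p (sw t (b_gen A M N n p i f)))"

definition c_map ::
  "('k, 'a) bialgebra_data \<Rightarrow> ('k, 'a, 'm) yd_data \<Rightarrow> ('k, 'a, 'n) yd_data \<Rightarrow> nat \<Rightarrow> nat \<Rightarrow> nat
     \<Rightarrow> (('k :: field, 'm :: ab_group_add, 'a :: ring_1) tens \<Rightarrow> ('k, 'n :: ab_group_add, 'a) tens)
     \<Rightarrow> (('k, 'm, 'a) tens \<Rightarrow> ('k, 'n, 'a) tens)" where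
  "c_map A M N n p i f =
     (\<lambda>t \<in> carr (TA A M n). cls A N (p + 1) (sw t (c_gen A M N n p i f)))"

definition d_m ::
  "('k, 'a) bialgebra_data \<Rightarrow> ('k, 'a, 'm) yd_data \<Rightarrow> ('k, 'a, 'n) yd_data \<Rightarrow> nat \<Rightarrow> nat
     \<Rightarrow> (('k :: field, 'm :: ab_group_add, 'a :: ring_1) tens \<Rightarrow> ('k, 'n :: ab_group_add, 'a) tens)
     \<Rightarrow> (('k, 'm, 'a) tens \<Rightarrow> ('k, 'n, 'a) tens)" where
  "d_m A M N n p f = alt_sum (Y A M N (n + 1) p) (\<lambda>i. b_map A M N n p i f) (n + 2)"

definition d_c ::
  "('k, 'a) bialgebra_data \<Rightarrow> ('k, 'a, 'm) yd_data \<Rightarrow> ('k, 'a, 'n) yd_data \<Rightarrow> nat \<Rightarrow> nat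
     \<Rightarrow> (('k :: field, 'm :: ab_group_add, 'a :: ring_1) tens \<Rightarrow> ('k, 'n :: ab_group_add, 'a) tens)
     \<Rightarrow> (('k, 'm, 'a) tens \<Rightarrow> ('k, 'n, 'a) tens)" where
  "d_c A M N n p f = alt_sum (Y A M N n (p + 1)) (\<lambda>i. c_map A M N n p i f) (p + 2)"

end

theory Submission
  imports Defs
begin

text \<open>
  A vector of a tensor product is determined by the values of the multilinear functionals on it, so a
  map \<open>f\<close> in \<open>Y\<^sup>n\<^sup>,\<^sup>p\<close> is determined by its transpose, which turns a multilinear functional \<open>\<phi>\<close> on
  \<open>N \<times> A\<^sup>p\<close> into one on \<open>A\<^sup>n \<times> M\<close>. On the transposes every Sweedler sum becomes a finite sum of scalars,
  so that sums may be interchanged freely, and coassociativity, multiplicativity of \<open>\<Delta>\<close> and the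
  Yetter-Drinfel'd condition become identities between scalar sums with an arbitrary multilinear
  integrand. They give the cosimplicial identities \<open>b\<^sub>j b\<^sub>i = b\<^sub>i b\<^sub>j\<^sub>-\<^sub>1\<close> and \<open>c\<^sub>j c\<^sub>i = c\<^sub>i c\<^sub>j\<^sub>-\<^sub>1\<close> for
  \<open>i < j\<close>, and \<open>c\<^sub>j b\<^sub>i = b\<^sub>i c\<^sub>j\<close>. The Yetter-Drinfel'd condition enters only in \<open>c\<^sub>0 b\<^sub>0 = b\<^sub>0 c\<^sub>0\<close> (for \<open>N\<close>)
  and \<open>c\<^sub>p\<^sub>+\<^sub>1 b\<^sub>n\<^sub>+\<^sub>1 = b\<^sub>n\<^sub>+\<^sub>1 c\<^sub>p\<^sub>+\<^sub>1\<close> (for \<open>M\<close>).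
\<close>

section \<open>Formal sums and multilinear functionals\<close>

text \<open>\<open>sweedler\<close> evaluates at a representative chosen by \<open>rep\<close>, so
  formal sums that denote the same Sweedler expression need not be equal, and nested sums cannot be
  compared term by term. A multilinear functional vanishes on the relations, so its value no longer
  depends on these choices and lies in the type of scalars. Conversely, functionals detect every
  class because k is a field: one that kills the relations and is 1 at a given non-relation is
  obtained by extending a basis. The price is that every use of coassociativity, of multiplicativity
  or of the Yetter-Drinfel'd condition must prove its integrand linear in each variable. The
  predicates \<open>klinear\<close> and \<open>llinear\<close> are shaped so that introduction rules
  do this. The Sweedler components of a single a are consumed from both ends: \<open>b_0\<close>
  lets the first one act on N, the last map b lets the last one act on M. Iterated comultiplication
  must therefore open at its head, at its end and at any entry between; \<open>D_comult_at\<close>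
  is the form of coassociativity that covers all of these.\<close>

definition klinear :: "('k \<Rightarrow> 'v \<Rightarrow> 'v) \<Rightarrow> ('k \<Rightarrow> 'w \<Rightarrow> 'w) \<Rightarrow> ('v :: ab_group_add \<Rightarrow> 'w :: ab_group_add) \<Rightarrow> bool" where
  "klinear s t g \<longleftrightarrow> (\<forall>x y. g (x + y) = g x + g y) \<and> (\<forall>c x. g (s c x) = t c (g x))"

text \<open>
  Multilinearity is imposed on lists of every length: a functional that matters only on lists of
  length \<open>n\<close> can be cut off to \<open>0\<close> elsewhere, and this removes all length side conditions.
\<close>

definition list_multilinear :: "('k \<Rightarrow> 'a \<Rightarrow> 'a) \<Rightarrow> ('a :: ab_group_add list \<Rightarrow> 'k :: field) \<Rightarrow> bool" where
  "list_multilinear sA \<psi> \<longleftrightarrow> (\<forall>l r. klinear sA (*) (\<lambda>a. \<psi> (l @ a # r)))"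

definition multilinear ::
  "('k \<Rightarrow> 'a \<Rightarrow> 'a) \<Rightarrow> ('k \<Rightarrow> 'v \<Rightarrow> 'v)
     \<Rightarrow> ('v :: ab_group_add \<Rightarrow> 'a :: ab_group_add list \<Rightarrow> 'k :: field) \<Rightarrow> bool" where
  "multilinear sA sV \<phi> \<longleftrightarrow> (\<forall>l. klinear sV (*) (\<lambda>v. \<phi> v l)) \<and> (\<forall>v. list_multilinear sA (\<phi> v))"

text \<open>The integrand is curried, so that nested Sweedler sums become nested integrals without
  case distinctions on pairs.\<close>

definition integ :: "('g \<times> 'h \<Rightarrow>\<^sub>0 'k :: field) \<Rightarrow> ('g \<Rightarrow> 'h \<Rightarrow> 'k) \<Rightarrow> 'k" where
  "integ x \<phi> = lin_ext (*) x (\<lambda>g. \<phi> (fst g) (snd g))"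

lemma lookup_fscale [simp]: "Poly_Mapping.lookup (fscale c x) g = c * Poly_Mapping.lookup x g"
  unfolding fscale_def by (simp add: Poly_Mapping.map.rep_eq when_def)

lemma keys_fscale: "Poly_Mapping.keys (fscale c x) \<subseteq> Poly_Mapping.keys x"
  by (auto simp: in_keys_iff)

lemma vector_space_fscale: "vector_space (fscale :: 'k :: field \<Rightarrow> ('g \<Rightarrow>\<^sub>0 'k) \<Rightarrow> _)"
  by unfold_locales (auto intro!: poly_mapping_eqI simp: lookup_add algebra_simps)

interpretation fs: vector_space "fscale :: 'k :: field \<Rightarrow> ('g \<Rightarrow>\<^sub>0 'k) \<Rightarrow> _"
  by (rule vector_space_fscale)

text \<open>The supports of x, y and x + y differ; over a common finite superset additivity is
  checked termwise.\<close>

lemma integ_superset: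
  assumes "finite S" "Poly_Mapping.keys x \<subseteq> S"
  shows "integ x \<phi> = (\<Sum>g\<in>S. Poly_Mapping.lookup x g * \<phi> (fst g) (snd g))"
  unfolding integ_def lin_ext_def
  by (rule sum.mono_neutral_left) (use assms in \<open>auto simp: in_keys_iff\<close>)

lemma integ_zero [simp]: "integ 0 \<phi> = 0"
  by (simp add: integ_def lin_ext_def)

lemma integ_add: "integ (x + y) \<phi> = integ x \<phi> + integ y \<phi>"
  by (subst (1 2 3) integ_superset[where S = "Poly_Mapping.keys x \<union> Poly_Mapping.keys y"])
     (auto simp: lookup_add algebra_simps sum.distrib dest: set_mp[OF keys_add])

lemma integ_fscale: "integ (fscale c x) \<phi> = c * integ x \<phi>"
  by (subst (1 2) integ_superset[where S = "Poly_Mapping.keys x"])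
     (auto simp: algebra_simps sum_distrib_left dest: set_mp[OF keys_fscale])

lemma integ_diff: "integ (x - y) \<phi> = integ x \<phi> - integ y \<phi>"
  using integ_add[of "x - y" y \<phi>] by (simp add: algebra_simps)

lemma integ_gen [simp]: "integ (gen g) \<phi> = \<phi> (fst g) (snd g)"
  by (simp add: integ_def lin_ext_def)

lemma integ_sum: "finite S \<Longrightarrow> integ (\<Sum>i\<in>S. f i) \<phi> = (\<Sum>i\<in>S. integ (f i) \<phi>)"
  by (induction S rule: finite_induct) (auto simp: integ_add)

lemma integ_lin_ext:
  "integ (lin_ext fscale x \<psi>) \<phi> = integ x (\<lambda>u v. integ (\<psi> (u, v)) \<phi>)"
  by (simp add: lin_ext_def integ_sum integ_fscale)
     (simp add: integ_def[of x] lin_ext_def)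

text \<open>Both sides go through the same chosen representative, so nested Sweedler sums unfold by
  rewriting alone.\<close>

lemma integ_sw: "integ (sw t \<psi>) \<phi> = integ (rep t) (\<lambda>u v. integ (\<psi> (u, v)) \<phi>)"
  by (simp add: sweedler_def integ_lin_ext)

lemma integ_fun_add: "integ x (\<lambda>u v. \<phi> u v + \<psi> u v) = integ x \<phi> + integ x \<psi>"
  by (simp add: integ_def lin_ext_def algebra_simps sum.distrib)

lemma integ_fun_scale: "integ x (\<lambda>u v. c * \<phi> u v) = c * integ x \<phi>"
  by (simp add: integ_def lin_ext_def algebra_simps sum_distrib_left)

text \<open>Fubini for finite sums. All later rules that move one Sweedler sum past another come
  from this one.\<close>

lemma integ_swap:
  "integ x (\<lambda>u v. integ y (\<lambda>u' v'. \<phi> u v u' v')) = integ y (\<lambda>u' v'. integ x (\<lambda>u v. \<phi> u v u' v'))"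
  unfolding integ_def lin_ext_def sum_distrib_left
  by (subst sum.swap) (simp add: algebra_simps)

lemma integ_cong:
  assumes "\<And>u v. (u, v) \<in> Poly_Mapping.keys x \<Longrightarrow> \<phi> u v = \<psi> u v"
  shows "integ x \<phi> = integ x \<psi>"
  unfolding integ_def lin_ext_def by (rule sum.cong) (auto simp: assms)

lemma klinear_integ:
  "(\<And>u v. klinear s (*) (\<lambda>x. \<phi> x u v)) \<Longrightarrow> klinear s (*) (\<lambda>x. integ y (\<phi> x))"
proof -
  assume lin: "\<And>u v. klinear s (*) (\<lambda>x. \<phi> x u v)"
  have "\<phi> (x + y) = (\<lambda>u v. \<phi> x u v + \<phi> y u v)" "\<phi> (s c x) = (\<lambda>u v. c * \<phi> x u v)" for x y c
    using lin unfolding klinear_def by blast+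
  then show ?thesis by (simp add: klinear_def integ_fun_add integ_fun_scale)
qed

lemma formal_sum_expand:
  "x = (\<Sum>g\<in>Poly_Mapping.keys x. fscale (Poly_Mapping.lookup x g) (gen g))"
proof (rule poly_mapping_eqI)
  fix h
  have "Poly_Mapping.lookup (\<Sum>g\<in>Poly_Mapping.keys x. fscale (Poly_Mapping.lookup x g) (gen g)) h
      = (\<Sum>g\<in>Poly_Mapping.keys x. Poly_Mapping.lookup x g * (if g = h then 1 else 0))"
    by (simp add: lookup_sum lookup_single when_def)
  also have "\<dots> = Poly_Mapping.lookup x h"
    by (simp add: sum.delta in_keys_iff if_distrib cong: if_cong)
  finally show "Poly_Mapping.lookup x h = Poly_Mapping.lookup
      (\<Sum>g\<in>Poly_Mapping.keys x. fscale (Poly_Mapping.lookup x g) (gen g)) h"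
    by (rule sym)
qed

section \<open>The tensor product and its multilinear functionals\<close>

lemma free_part_subspace: "fs.subspace (free_part n)"
  unfolding fs.subspace_def free_part_def
  by (auto dest!: set_mp[OF keys_add] set_mp[OF keys_fscale])

lemma free_part_closed:
  shows "0 \<in> free_part n"
    and "x \<in> free_part n \<Longrightarrow> y \<in> free_part n \<Longrightarrow> x + y \<in> free_part n"
    and "x \<in> free_part n \<Longrightarrow> fscale c x \<in> free_part n"
  using free_part_subspace unfolding fs.subspace_def by blast+

lemma gen_free_part: "length as = n \<Longrightarrow> gen (v, as) \<in> free_part n"
  by (simp add: free_part_def)

lemma lin_ext_free_part:
  assumes "\<And>g. g \<in> Poly_Mapping.keys x \<Longrightarrow> \<psi> g \<in> free_part n"
  shows "lin_ext fscale x \<psi> \<in> free_part n"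
  unfolding lin_ext_def
  by (intro fs.subspace_sum[OF free_part_subspace] fs.subspace_scale[OF free_part_subspace] assms)

lemma list_multilinearD:
  assumes "list_multilinear sA \<psi>"
  shows "\<psi> (l @ (a + b) # r) = \<psi> (l @ a # r) + \<psi> (l @ b # r)" "\<psi> (l @ sA c a # r) = c * \<psi> (l @ a # r)"
  using assms unfolding list_multilinear_def klinear_def by blast+

lemma multilinearD:
  assumes "multilinear sA sV \<phi>"
  shows "\<phi> (v + w) l = \<phi> v l + \<phi> w l" "\<phi> (sV c v) l = c * \<phi> v l"
  using assms unfolding multilinear_def klinear_def by blast+

lemma multilinear_listD:
  assumes "multilinear sA sV \<phi>"
  shows "\<phi> v (l @ (a + b) # r) = \<phi> v (l @ a # r) + \<phi> v (l @ b # r)"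
    "\<phi> v (l @ sA c a # r) = c * \<phi> v (l @ a # r)"
  using assms list_multilinearD[of sA "\<phi> v"] by (simp_all add: multilinear_def)

text \<open>The easy half of the duality: multilinear functionals descend to the tensor
  product.\<close>

lemma integ_span_rels:
  assumes ml: "multilinear sA sV \<phi>" and x: "x \<in> fs.span (multilinear_rels sA sV n)"
  shows "integ x \<phi> = 0"
  using x
proof (induction rule: fs.span_induct_alt)
  case base
  show ?case by simp
next
  case (step c y z)
  have "integ y \<phi> = 0"
    using step(1) unfolding multilinear_rels_def
    by (auto simp: integ_diff integ_fscale multilinearD[OF ml]
        multilinear_listD[OF ml] upd_conv_take_nth_drop)
  then show ?case using step(2) by (simp add: integ_add integ_fscale)
qed

lemma equiv_tensor_rel: "equiv (free_part n) (tensor_rel sA sV n)"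
proof (rule equivI)
  show "tensor_rel sA sV n \<subseteq> free_part n \<times> free_part n"
    by (auto simp: tensor_rel_def)
  show "refl_on (free_part n) (tensor_rel sA sV n)"
    by (auto simp: refl_on_def tensor_rel_def fs.span_zero)
  show "sym (tensor_rel sA sV n)"
    unfolding sym_def tensor_rel_def using fs.span_neg by fastforce
  show "trans (tensor_rel sA sV n)"
    unfolding trans_def tensor_rel_def using fs.span_add by fastforce
qed

section \<open>Multilinear functionals separate the classes\<close>

lemma separating_functional:
  assumes "x \<notin> fs.span S"
  obtains g :: "('g \<Rightarrow>\<^sub>0 'k :: field) \<Rightarrow> 'k" where "Vector_Spaces.linear fscale (*) g" "g x = 1" "\<forall>y\<in>S. g y = 0"
proof -
  obtain B where B: "B \<subseteq> S" "fs.independent B" "S \<subseteq> fs.span B"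
    using fs.maximal_independent_subset by blast
  have "x \<notin> fs.span B"
    using assms fs.span_mono[OF B(1)] by blast
  \<comment> \<open>Since x lies outside the span of B, it may be added to B, and the values 1 at x
    and 0 on B may be prescribed freely. Vanishing on B then spreads to S, which lies in the span of
    B.\<close>
  then have ind: "fs.independent (insert x B)" and "x \<notin> B"
    using B(2) fs.independent_insertI fs.span_base by auto
  interpret vp: vector_space_pair "fscale :: 'k \<Rightarrow> ('g \<Rightarrow>\<^sub>0 'k) \<Rightarrow> _" "(*) :: 'k \<Rightarrow> 'k \<Rightarrow> 'k"
    by unfold_locales (auto simp: algebra_simps)
  obtain g where g: "Vector_Spaces.linear fscale (*) g"
      "\<forall>y\<in>insert x B. g y = (if y = x then 1 else 0)"
    using vp.linear_independent_extend[OF ind, of "\<lambda>y. if y = x then 1 else 0"] by blast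
  have "g y = 0" if "y \<in> S" for y
  proof -
    have "y \<in> fs.span B" using that B(3) by blast
    moreover have "\<And>z. z \<in> B \<Longrightarrow> g z = 0" using g(2) \<open>x \<notin> B\<close> by auto
    ultimately show ?thesis using vp.linear_eq_0_on_span[OF g(1)] by blast
  qed
  with g show ?thesis using that by auto
qed

text \<open>The converse of \<open>integ_span_rels\<close>: if x - y were not a relation, a
  separating functional would exist, and read on generators it would be multilinear.\<close>

lemma tensor_relI:
  assumes x: "x \<in> free_part n" and y: "y \<in> free_part n"
    and eq: "\<And>\<phi>. multilinear sA sV \<phi> \<Longrightarrow> integ x \<phi> = integ y \<phi>"
  shows "(x, y) \<in> tensor_rel sA sV n"
proof (rule ccontr)
  assume "(x, y) \<notin> tensor_rel sA sV n"
  then have "x - y \<notin> fs.span (multilinear_rels sA sV n)"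
    using x y by (auto simp: tensor_rel_def)
  then obtain g where g: "Vector_Spaces.linear fscale (*) g" "g (x - y) = 1"
      and g0: "\<forall>z\<in>multilinear_rels sA sV n. g z = 0"
    by (rule separating_functional)
  interpret g: Vector_Spaces.linear fscale "(*)" g by (rule g(1))
  \<comment> \<open>g respects only the relations for lists of length n, while
    \<open>multilinear\<close> speaks of all lengths; the cut-off reconciles the two and is
    invisible on \<open>free_part n\<close>.\<close>
  define \<phi> where "\<phi> v l = (if length l = n then g (gen (v, l)) else 0)" for v l
  have integ_eq: "integ z \<phi> = g z" if "z \<in> free_part n" for z
  proof -
    have "integ z \<phi> = (\<Sum>h\<in>Poly_Mapping.keys z. Poly_Mapping.lookup z h * g (gen h))"
      unfolding integ_def lin_ext_def
      by (rule sum.cong) (use that in \<open>auto simp: \<phi>_def free_part_def\<close>)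
    also have "\<dots> = g (\<Sum>h\<in>Poly_Mapping.keys z. fscale (Poly_Mapping.lookup z h) (gen h))"
      by (simp add: g.sum g.scale)
    also have "\<dots> = g z" by (simp flip: formal_sum_expand)
    finally show ?thesis .
  qed
  have r1: "g (gen (v + w, l)) = g (gen (v, l)) + g (gen (w, l))" if "length l = n" for v w l
  proof -
    have "gen (v + w, l) - gen (v, l) - gen (w, l) \<in> multilinear_rels sA sV n"
      unfolding multilinear_rels_def using that by blast
    from bspec[OF g0 this] show ?thesis by (simp add: g.diff g.add diff_diff_eq)
  qed
  have r2: "g (gen (sV c v, l)) = c * g (gen (v, l))" if "length l = n" for c v l
  proof -
    have "gen (sV c v, l) - fscale c (gen (v, l)) \<in> multilinear_rels sA sV n"
      unfolding multilinear_rels_def using that by blast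
    from bspec[OF g0 this] show ?thesis by (simp add: g.diff g.scale)
  qed
  have r3: "g (gen (v, l @ (a + b) # r)) = g (gen (v, l @ a # r)) + g (gen (v, l @ b # r))"
    if "length (l @ a # r) = n" for v l r a b
  proof -
    \<comment> \<open>The relations are phrased with list updates; an update at index
      \<open>length l\<close> matches them with the form \<open>l @ a # r\<close> used in
      \<open>list_multilinear\<close>.\<close>
    have "gen (v, (l @ a # r)[length l := a + b]) - gen (v, (l @ a # r)[length l := a])
        - gen (v, (l @ a # r)[length l := b]) \<in> multilinear_rels sA sV n"
      unfolding multilinear_rels_def
      by (rule UnI1, rule UnI2, rule CollectI, intro exI conjI, rule refl) (use that in simp_all)
    from bspec[OF g0 this] show ?thesis by (simp add: g.diff g.add diff_diff_eq)
  qed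
  have r4: "g (gen (v, l @ sA c a # r)) = c * g (gen (v, l @ a # r))"
    if "length (l @ a # r) = n" for v l r c a
  proof -
    have "gen (v, (l @ a # r)[length l := sA c a]) - fscale c (gen (v, (l @ a # r)[length l := a]))
      \<in> multilinear_rels sA sV n"
      unfolding multilinear_rels_def
      by (rule UnI2, rule CollectI, intro exI conjI, rule refl) (use that in simp_all)
    from bspec[OF g0 this] show ?thesis by (simp add: g.diff g.scale)
  qed
  have "multilinear sA sV \<phi>"
    unfolding multilinear_def list_multilinear_def klinear_def \<phi>_def
    by (intro conjI allI) (simp_all add: r1 r2 r3 r4)
  then have "g x = g y"
    using eq integ_eq x y by metis
  then show False using g(2) by (simp add: g.diff)
qed

lemma carr_tensor [simp]: "carr (tensor sA sV n) = free_part n // tensor_rel sA sV n"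
  by (simp add: tensor_def)

lemma tclass_carr: "x \<in> free_part n \<Longrightarrow> tclass sA sV n x \<in> carr (tensor sA sV n)"
  by (simp add: tclass_def quotientI)

lemma rep_carr:
  assumes "t \<in> carr (tensor sA sV n)"
  shows "rep t \<in> free_part n" "tclass sA sV n (rep t) = t"
proof -
  obtain x where x: "x \<in> free_part n" "t = tensor_rel sA sV n `` {x}"
    using assms by (auto elim: quotientE)
  then have "x \<in> t" using equiv_class_self[OF equiv_tensor_rel] by blast
  then have "rep t \<in> t" unfolding rep_def by (rule someI)
  then have r: "(x, rep t) \<in> tensor_rel sA sV n" using x by blast
  then show "rep t \<in> free_part n" by (simp add: tensor_rel_def)
  show "tclass sA sV n (rep t) = t"
    unfolding tclass_def x(2) using equiv_class_eq[OF equiv_tensor_rel r] x(2) by simp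
qed

text \<open>The representative picked by \<open>rep\<close> may differ from x, but only by
  relations. This is the well-definedness of Sweedler sums with a multilinear integrand.\<close>

lemma integ_tclass:
  assumes "x \<in> free_part n" "multilinear sA sV \<phi>"
  shows "integ (rep (tclass sA sV n x)) \<phi> = integ x \<phi>"
proof -
  have "tclass sA sV n (rep (tclass sA sV n x)) = tclass sA sV n x"
    and "rep (tclass sA sV n x) \<in> free_part n"
    using rep_carr[OF tclass_carr[OF assms(1)]] by auto
  then have "(rep (tclass sA sV n x), x) \<in> tensor_rel sA sV n"
    unfolding tclass_def using eq_equiv_class_iff[OF equiv_tensor_rel] assms(1) by blast
  then have "integ (rep (tclass sA sV n x) - x) \<phi> = 0"
    by (intro integ_span_rels[OF assms(2)]) (auto simp: tensor_rel_def)
  then show ?thesis by (simp add: integ_diff)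
qed

lemma tensor_eqI:
  assumes "t \<in> carr (tensor sA sV n)" "u \<in> carr (tensor sA sV n)"
    and "\<And>\<phi>. multilinear sA sV \<phi> \<Longrightarrow> integ (rep t) \<phi> = integ (rep u) \<phi>"
  shows "t = u"
proof -
  have "(rep t, rep u) \<in> tensor_rel sA sV n"
    by (intro tensor_relI rep_carr[OF assms(1)] rep_carr[OF assms(2)] assms(3))
  then show ?thesis
    using equiv_class_eq[OF equiv_tensor_rel] rep_carr(2)[OF assms(1)] rep_carr(2)[OF assms(2)]
    unfolding tclass_def by metis
qed

text \<open>The axioms of bialgebras, comodules and Yetter-Drinfel'd modules are equalities of
  classes; this turns them into scalar identities.\<close>

lemma tclass_eqD:
  assumes "tclass sA sV n x = tclass sA sV n y" "x \<in> free_part n" "y \<in> free_part n"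
    "multilinear sA sV \<phi>"
  shows "integ x \<phi> = integ y \<phi>"
  using integ_tclass[OF assms(2,4)] integ_tclass[OF assms(3,4)] assms(1) by simp

text \<open>Representatives are supported on lists of length n. Partial operations such as
  \<open>hd\<close> or the truncating \<open>map2\<close> may thus be replaced by well-behaved ones
  inside an integral.\<close>

lemma integ_rep_cong:
  assumes "t \<in> carr (tensor sA sV n)" "\<And>u v. length v = n \<Longrightarrow> \<phi> u v = \<psi> u v"
  shows "integ (rep t) \<phi> = integ (rep t) \<psi>"
  using rep_carr(1)[OF assms(1)] assms(2) by (intro integ_cong) (auto simp: free_part_def)

lemma tensor_ops_carr:
  shows "vzero (tensor sA sV n) \<in> carr (tensor sA sV n)"
    and "\<lbrakk>t \<in> carr (tensor sA sV n); u \<in> carr (tensor sA sV n)\<rbrakk> \<Longrightarrow>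
      vadd (tensor sA sV n) t u \<in> carr (tensor sA sV n)"
    and "t \<in> carr (tensor sA sV n) \<Longrightarrow> vscale (tensor sA sV n) c t \<in> carr (tensor sA sV n)"
  by (simp_all add: tensor_def tclass_carr[simplified] free_part_closed rep_carr[simplified])

lemma integ_tensor_ops:
  assumes "multilinear sA sV \<phi>"
  shows "integ (rep (vzero (tensor sA sV n))) \<phi> = 0"
    and "\<lbrakk>t \<in> carr (tensor sA sV n); u \<in> carr (tensor sA sV n)\<rbrakk> \<Longrightarrow>
      integ (rep (vadd (tensor sA sV n) t u)) \<phi> = integ (rep t) \<phi> + integ (rep u) \<phi>"
    and "t \<in> carr (tensor sA sV n) \<Longrightarrow>
      integ (rep (vscale (tensor sA sV n) c t)) \<phi> = c * integ (rep t) \<phi>"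
  by (simp_all add: tensor_def integ_tclass[OF _ assms] free_part_closed rep_carr(1)[simplified]
      integ_add integ_fscale)

lemma klinear_integ_rep:
  assumes "linear_map (type_space s) (tensor sA sV n) f" "multilinear sA sV \<phi>"
  shows "klinear s (*) (\<lambda>x. integ (rep (f x)) \<phi>)"
proof -
  have c: "f x \<in> carr (tensor sA sV n)" for x
    using assms(1) by (auto simp: linear_map_def type_space_def)
  have "f (x + y) = vadd (tensor sA sV n) (f x) (f y)" "f (s c x) = vscale (tensor sA sV n) c (f x)" for x y c
    using assms(1) by (auto simp: linear_map_def type_space_def)
  then show ?thesis
    unfolding klinear_def by (simp add: integ_tensor_ops[OF assms(2)] c del: carr_tensor)
qed

section \<open>Linear maps between tensor products\<close>

text \<open>
  \<open>\<lambda>\<phi>. hom_pairing sA sV n f \<phi>\<close> is the transpose of \<open>f\<close> on multilinear functionals, cut off to \<open>0\<close> on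
  lists whose length is not \<open>n\<close>.
\<close>

definition hom_pairing ::
  "('k \<Rightarrow> 'a \<Rightarrow> 'a) \<Rightarrow> ('k \<Rightarrow> 'v \<Rightarrow> 'v) \<Rightarrow> nat
     \<Rightarrow> (('k :: field, 'v :: ab_group_add, 'a :: ab_group_add) tens \<Rightarrow> ('k, 'w, 'a) tens)
     \<Rightarrow> ('w \<Rightarrow> 'a list \<Rightarrow> 'k) \<Rightarrow> 'v \<Rightarrow> 'a list \<Rightarrow> 'k" where
  "hom_pairing sA sV n f \<phi> m as =
     integ (if length as = n then rep (f (tclass sA sV n (gen (m, as)))) else 0) \<phi>"

lemma carr_Hom_space:
  "f \<in> carr (Hom_space V W) \<longleftrightarrow> f \<in> extensional (carr V) \<and> linear_map V W f"
  by (simp add: Hom_space_def)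

lemma linear_map_tensor_iff:
  "linear_map (tensor sA sV n) W f \<longleftrightarrow>
    f \<in> carr (tensor sA sV n) \<rightarrow> carr W \<and>
    (\<forall>t\<in>carr (tensor sA sV n). \<forall>u\<in>carr (tensor sA sV n).
       f (vadd (tensor sA sV n) t u) = vadd W (f t) (f u)) \<and>
    (\<forall>c. \<forall>t\<in>carr (tensor sA sV n). f (vscale (tensor sA sV n) c t) = vscale W c (f t))"
  by (simp add: linear_map_def del: carr_tensor)

context
  fixes sA :: "'k :: field \<Rightarrow> 'a :: ab_group_add \<Rightarrow> 'a"
    and sV :: "'k \<Rightarrow> 'v :: ab_group_add \<Rightarrow> 'v"
    and sW :: "'k \<Rightarrow> 'w :: ab_group_add \<Rightarrow> 'w"
begin

lemma tclass_ops:
  assumes x: "x \<in> free_part n" and y: "y \<in> free_part n"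
  shows "tclass sA sV n (x + y) = vadd (tensor sA sV n) (tclass sA sV n x) (tclass sA sV n y)"
    and "tclass sA sV n (fscale c x) = vscale (tensor sA sV n) c (tclass sA sV n x)"
    and "tclass sA sV n 0 = vzero (tensor sA sV n)"
proof -
  have p: "x + y \<in> free_part n" "fscale c x \<in> free_part n"
    using free_part_subspace[of n] x y by (auto simp: fs.subspace_def)
  show "tclass sA sV n (x + y) = vadd (tensor sA sV n) (tclass sA sV n x) (tclass sA sV n y)"
    by (rule tensor_eqI[OF tclass_carr[OF p(1)]
          tensor_ops_carr(2)[OF tclass_carr[OF x] tclass_carr[OF y]]])
       (simp add: integ_tensor_ops(2) tclass_carr integ_tclass p x y integ_add del: carr_tensor)
  show "tclass sA sV n (fscale c x) = vscale (tensor sA sV n) c (tclass sA sV n x)"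
    by (rule tensor_eqI[OF tclass_carr[OF p(2)] tensor_ops_carr(3)[OF tclass_carr[OF x]]])
       (simp add: integ_tensor_ops(3) tclass_carr integ_tclass p x y integ_fscale del: carr_tensor)
  show "tclass sA sV n 0 = vzero (tensor sA sV n)"
    by (simp add: tensor_def)
qed

text \<open>A linear map is determined by its values on pure tensors: pulled back to formal sums,
  the composite of class, f and pairing is linear, so it can be expanded over the support of
  \<open>rep t\<close>.\<close>

lemma integ_linear_map:
  assumes f: "linear_map (tensor sA sV n) (tensor sA sW p) f" and \<phi>: "multilinear sA sW \<phi>"
    and t: "t \<in> carr (tensor sA sV n)"
  shows "integ (rep (f t)) \<phi> = integ (rep t) (hom_pairing sA sV n f \<phi>)"
proof -
  let ?V = "tensor sA sV n" and ?W = "tensor sA sW p"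
  let ?c = "tclass sA sV n"
  have fc: "f t \<in> carr ?W" if "t \<in> carr ?V" for t
    using f that by (auto simp: linear_map_def)
  define F where "F x = integ (rep (f (?c x))) \<phi>" for x
  have F_add: "F (x + y) = F x + F y" if "x \<in> free_part n" "y \<in> free_part n" for x y
  proof -
    have "f (?c (x + y)) = vadd ?W (f (?c x)) (f (?c y))"
      using f tclass_carr[OF that(1)] tclass_carr[OF that(2)]
      by (simp add: tclass_ops that linear_map_tensor_iff del: carr_tensor)
    then show ?thesis
      unfolding F_def using integ_tensor_ops(2)[OF \<phi> fc fc, OF tclass_carr[OF that(1)] tclass_carr[OF that(2)]]
      by simp
  qed
  have F_scale: "F (fscale c x) = c * F x" if "x \<in> free_part n" for x c
  proof -
    have "f (?c (fscale c x)) = vscale ?W c (f (?c x))"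
      using f tclass_carr[OF that]
      by (simp add: tclass_ops[OF that that] linear_map_tensor_iff del: carr_tensor)
    then show ?thesis
      unfolding F_def using integ_tensor_ops(3)[OF \<phi> fc, OF tclass_carr[OF that]] by simp
  qed
  \<comment> \<open>\<open>linear_map\<close> does not mention zero; the value comes from scaling by
    0.\<close>
  have F0: "F 0 = 0"
    using F_scale[OF free_part_closed(1), of 0] by simp
  have F_sum: "F (\<Sum>i\<in>S. h i) = (\<Sum>i\<in>S. F (h i))"
    if "finite S" "\<And>i. i \<in> S \<Longrightarrow> h i \<in> free_part n" for S :: "('v \<times> 'a list) set" and h
    using that
  proof (induction S rule: finite_induct)
    case (insert i S)
    have "F (h i + (\<Sum>i\<in>S. h i)) = F (h i) + F (\<Sum>i\<in>S. h i)"
      by (rule F_add) (use insert in \<open>auto intro!: fs.subspace_sum[OF free_part_subspace]\<close>)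
    then show ?case using insert by simp
  qed (simp add: F0)
  define x where "x = rep t"
  have x: "x \<in> free_part n" "?c x = t" using rep_carr[OF t] by (auto simp: x_def)
  have len: "length (snd g) = n" if "g \<in> Poly_Mapping.keys x" for g
    using that x(1) by (auto simp: free_part_def)
  then have gf: "gen g \<in> free_part n" if "g \<in> Poly_Mapping.keys x" for g
    using that gen_free_part[of "snd g" n "fst g"] by simp
  have "integ (rep (f t)) \<phi> = F x" by (simp add: F_def x)
  also have "F x = F (\<Sum>g\<in>Poly_Mapping.keys x. fscale (Poly_Mapping.lookup x g) (gen g))"
    by (simp flip: formal_sum_expand)
  also have "\<dots> = (\<Sum>g\<in>Poly_Mapping.keys x. F (fscale (Poly_Mapping.lookup x g) (gen g)))"
    by (rule F_sum) (auto intro!: fs.subspace_scale[OF free_part_subspace] gf)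
  also have "\<dots> = (\<Sum>g\<in>Poly_Mapping.keys x. Poly_Mapping.lookup x g * F (gen g))"
    by (simp add: F_scale gf)
  also have "\<dots> = integ x (hom_pairing sA sV n f \<phi>)"
    unfolding integ_def[of x] lin_ext_def
    by (rule sum.cong) (simp_all add: F_def hom_pairing_def len)
  finally show ?thesis by (simp add: x_def)
qed

text \<open>On the carrier, maps are compared through their transposes at pure tensors; off the
  carrier, extensionality decides.\<close>

lemma Hom_space_eqI:
  assumes f: "f \<in> carr (Hom_space (tensor sA sV n) (tensor sA sW p))"
    and g: "g \<in> carr (Hom_space (tensor sA sV n) (tensor sA sW p))"
    and eq: "\<And>\<phi> m as. multilinear sA sW \<phi> \<Longrightarrow> length as = n \<Longrightarrow>
      hom_pairing sA sV n f \<phi> m as = hom_pairing sA sV n g \<phi> m as"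
  shows "f = g"
proof
  fix t
  show "f t = g t"
  proof (cases "t \<in> carr (tensor sA sV n)")
    case True
    show ?thesis
    proof (rule tensor_eqI)
      show "f t \<in> carr (tensor sA sW p)" "g t \<in> carr (tensor sA sW p)"
        using f g True by (auto simp: carr_Hom_space linear_map_tensor_iff simp del: carr_tensor)
      fix \<phi> assume \<phi>: "multilinear sA sW \<phi>"
      have lf: "linear_map (tensor sA sV n) (tensor sA sW p) f"
        and lg: "linear_map (tensor sA sV n) (tensor sA sW p) g"
        using f g by (auto simp: carr_Hom_space)
      show "integ (rep (f t)) \<phi> = integ (rep (g t)) \<phi>"
        unfolding integ_linear_map[OF lf \<phi> True] integ_linear_map[OF lg \<phi> True]
        by (rule integ_rep_cong[OF True]) (rule eq[OF \<phi>])
    qed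
  next
    case False
    then show ?thesis using f g by (auto simp: carr_Hom_space extensional_def)
  qed
qed

text \<open>A linear relation among generators that every multilinear functional satisfies holds
  among their classes by \<open>tensor_relI\<close>, hence survives f. This handles the slot of the
  module and the slots of A by the same two facts \<open>ad\<close> and \<open>sc\<close>.\<close>

lemma multilinear_hom_pairing:
  assumes f: "f \<in> carr (Hom_space (tensor sA sV n) (tensor sA sW p))" and \<phi>: "multilinear sA sW \<phi>"
  shows "multilinear sA sV (hom_pairing sA sV n f \<phi>)"
proof -
  have lf: "linear_map (tensor sA sV n) (tensor sA sW p) f"
    using f by (auto simp: carr_Hom_space)
  have fc: "f t \<in> carr (tensor sA sW p)" if "t \<in> carr (tensor sA sV n)" for t
    using lf that by (auto simp: linear_map_def)
  let ?c = "tclass sA sV n"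
  have r0: "hom_pairing sA sV n f \<phi> v l = integ (rep (f (?c x))) \<phi>"
    if "length l = n" "?c (gen (v, l)) = ?c x" for v l x
    using that by (simp add: hom_pairing_def)
  have lin_add: "integ (rep (f (?c (x + y)))) \<phi> = integ (rep (f (?c x))) \<phi> + integ (rep (f (?c y))) \<phi>"
    if "x \<in> free_part n" "y \<in> free_part n" for x y
    using lf tclass_carr[OF that(1)] tclass_carr[OF that(2)] integ_tensor_ops(2)[OF \<phi> fc fc]
    by (simp add: tclass_ops that linear_map_tensor_iff del: carr_tensor)
  have lin_scale: "integ (rep (f (?c (fscale c x)))) \<phi> = c * integ (rep (f (?c x))) \<phi>"
    if "x \<in> free_part n" for x c
    using lf tclass_carr[OF that] integ_tensor_ops(3)[OF \<phi> fc]
    by (simp add: tclass_ops[OF that that] linear_map_tensor_iff del: carr_tensor)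
  have rel: "?c x = ?c y" if "x \<in> free_part n" "y \<in> free_part n"
     "\<And>\<chi>. multilinear sA sV \<chi> \<Longrightarrow> integ x \<chi> = integ y \<chi>" for x y
    unfolding tclass_def by (rule equiv_class_eq[OF equiv_tensor_rel tensor_relI[OF that]])
  have ad: "hom_pairing sA sV n f \<phi> v l = hom_pairing sA sV n f \<phi> v' l' + hom_pairing sA sV n f \<phi> v'' l''"
    if "length l' = length l" "length l'' = length l"
      "\<And>\<chi>. multilinear sA sV \<chi> \<Longrightarrow> \<chi> v l = \<chi> v' l' + \<chi> v'' l''" for v l v' l' v'' l''
  proof (cases "length l = n")
    case True
    then have fp: "gen (v, l) \<in> free_part n" "gen (v', l') \<in> free_part n" "gen (v'', l'') \<in> free_part n"
      using that by (auto intro: gen_free_part)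
    then have fp': "gen (v', l') + gen (v'', l'') \<in> free_part n"
      using free_part_subspace[of n] by (auto simp: fs.subspace_def)
    have "?c (gen (v, l)) = ?c (gen (v', l') + gen (v'', l''))"
      by (rule rel[OF fp(1) fp']) (simp add: integ_add that(3))
    then show ?thesis using True that(1,2) by (simp add: hom_pairing_def lin_add fp)
  qed (simp add: hom_pairing_def that(1,2))
  have sc: "hom_pairing sA sV n f \<phi> v l = c * hom_pairing sA sV n f \<phi> v' l'"
    if "length l' = length l"
      "\<And>\<chi>. multilinear sA sV \<chi> \<Longrightarrow> \<chi> v l = c * \<chi> v' l'" for v l v' l' c
  proof (cases "length l = n")
    case True
    then have fp: "gen (v, l) \<in> free_part n" "gen (v', l') \<in> free_part n"
      using that by (auto intro: gen_free_part)
    then have fp': "fscale c (gen (v', l')) \<in> free_part n"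
      using free_part_subspace[of n] by (auto simp: fs.subspace_def)
    have "?c (gen (v, l)) = ?c (fscale c (gen (v', l')))"
      by (rule rel[OF fp(1) fp']) (simp add: integ_fscale that(2))
    then show ?thesis using True that(1) by (simp add: hom_pairing_def lin_scale fp)
  qed (simp add: hom_pairing_def that(1))
  show ?thesis
    unfolding multilinear_def list_multilinear_def klinear_def
    by (intro conjI allI ad sc) (simp_all add: multilinearD multilinear_listD)
qed

text \<open>A map that has a transpose H on multilinear functionals is linear: both sides of a
  linearity equation have the same pairings.\<close>

lemma Hom_spaceI:
  assumes "h \<in> extensional (carr (tensor sA sV n))"
    and h: "\<And>t. t \<in> carr (tensor sA sV n) \<Longrightarrow> h t \<in> carr (tensor sA sW p)"
    and H: "\<And>\<phi>. multilinear sA sW \<phi> \<Longrightarrow> multilinear sA sV (H \<phi>)"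
    and I: "\<And>t \<phi>. t \<in> carr (tensor sA sV n) \<Longrightarrow> multilinear sA sW \<phi> \<Longrightarrow>
      integ (rep (h t)) \<phi> = integ (rep t) (H \<phi>)"
  shows "h \<in> carr (Hom_space (tensor sA sV n) (tensor sA sW p))"
  unfolding carr_Hom_space linear_map_tensor_iff
proof (intro conjI ballI allI)
  show "h \<in> carr (tensor sA sV n) \<rightarrow> carr (tensor sA sW p)" using h by blast
  show "h (vadd (tensor sA sV n) t u) = vadd (tensor sA sW p) (h t) (h u)"
    if "t \<in> carr (tensor sA sV n)" "u \<in> carr (tensor sA sV n)" for t u
    by (rule tensor_eqI[OF h[OF tensor_ops_carr(2)[OF that]] tensor_ops_carr(2)[OF h[OF that(1)] h[OF that(2)]]])
       (simp add: I that tensor_ops_carr(2) h H integ_tensor_ops(2) del: carr_tensor)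
  show "h (vscale (tensor sA sV n) c t) = vscale (tensor sA sW p) c (h t)"
    if "t \<in> carr (tensor sA sV n)" for t c
    by (rule tensor_eqI[OF h[OF tensor_ops_carr(3)[OF that]] tensor_ops_carr(3)[OF h[OF that(1)]]])
       (simp add: I that tensor_ops_carr(3) h H integ_tensor_ops(3) del: carr_tensor)
qed (fact assms(1))

lemma multilinear_add:
  "multilinear sA sV \<phi> \<Longrightarrow> multilinear sA sV \<psi> \<Longrightarrow> multilinear sA sV (\<lambda>v l. \<phi> v l + \<psi> v l)"
  by (simp add: multilinear_def list_multilinear_def klinear_def algebra_simps)

lemma multilinear_scale: "multilinear sA sV \<phi> \<Longrightarrow> multilinear sA sV (\<lambda>v l. c * \<phi> v l)"
  by (simp add: multilinear_def list_multilinear_def klinear_def algebra_simps)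

lemma Hom_space_ops:
  fixes n p
  defines "W \<equiv> tensor sA sW p" and "H \<equiv> Hom_space (tensor sA sV n) (tensor sA sW p)"
  shows "vzero H \<in> carr H"
    and "f \<in> carr H \<Longrightarrow> g \<in> carr H \<Longrightarrow> vadd H f g \<in> carr H"
    and "f \<in> carr H \<Longrightarrow> vscale H c f \<in> carr H"
    and "multilinear sA sW \<phi> \<Longrightarrow> hom_pairing sA sV n (vzero H) \<phi> m as = 0"
    and "f \<in> carr H \<Longrightarrow> g \<in> carr H \<Longrightarrow> multilinear sA sW \<phi> \<Longrightarrow>
      hom_pairing sA sV n (vadd H f g) \<phi> m as = hom_pairing sA sV n f \<phi> m as + hom_pairing sA sV n g \<phi> m as"
    and "f \<in> carr H \<Longrightarrow> multilinear sA sW \<phi> \<Longrightarrow>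
      hom_pairing sA sV n (vscale H c f) \<phi> m as = c * hom_pairing sA sV n f \<phi> m as"
proof -
  have V: "f t \<in> carr W" if "f \<in> carr H" "t \<in> carr (tensor sA sV n)" for f t
    using that unfolding H_def W_def carr_Hom_space linear_map_def by blast
  have L: "linear_map (tensor sA sV n) (tensor sA sW p) f" if "f \<in> carr H" for f
    using that unfolding H_def carr_Hom_space by blast
  note I = integ_linear_map[OF L]
  have ops: "vzero H = (\<lambda>t\<in>carr (tensor sA sV n). vzero W)"
    "vadd H f g = (\<lambda>t\<in>carr (tensor sA sV n). vadd W (f t) (g t))"
    "vscale H c f = (\<lambda>t\<in>carr (tensor sA sV n). vscale W c (f t))" for f g c
    by (simp_all add: H_def W_def Hom_space_def)
  have ml: "multilinear sA sV (hom_pairing sA sV n f \<phi>)" if "f \<in> carr H" "multilinear sA sW \<phi>" for f \<phi>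
    using that unfolding H_def by (rule multilinear_hom_pairing)
  note w = V[unfolded W_def] I tensor_ops_carr integ_tensor_ops
  have ext: "vzero H \<in> extensional (carr (tensor sA sV n))"
    "vadd H f g \<in> extensional (carr (tensor sA sV n))"
    "vscale H c f \<in> extensional (carr (tensor sA sV n))" for f g c
    unfolding ops by (rule restrict_extensional)+
  note HI = Hom_spaceI[of _ n p, folded H_def W_def]
  have m0: "multilinear sA sV (\<lambda>v l. 0 :: 'k)"
    by (simp add: multilinear_def list_multilinear_def klinear_def)
  show "vzero H \<in> carr H"
    by (rule HI[where H = "\<lambda>_ _ _. 0", OF ext(1)])
       (simp_all add: ops W_def w m0 del: carr_tensor, simp add: integ_def lin_ext_def)
  show "vadd H f g \<in> carr H" if "f \<in> carr H" "g \<in> carr H"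
    by (rule HI[where H = "\<lambda>\<phi> v l. hom_pairing sA sV n f \<phi> v l + hom_pairing sA sV n g \<phi> v l", OF ext(2)])
       (simp_all add: ops W_def w that ml multilinear_add integ_fun_add del: carr_tensor)
  show "vscale H c f \<in> carr H" if "f \<in> carr H"
    by (rule HI[where H = "\<lambda>\<phi> v l. c * hom_pairing sA sV n f \<phi> v l", OF ext(3)])
       (simp_all add: ops W_def w that ml multilinear_scale integ_fun_scale del: carr_tensor)
  have tc: "length as = n \<Longrightarrow> tclass sA sV n (gen (m, as)) \<in> carr (tensor sA sV n)"
    by (intro tclass_carr gen_free_part)
  show "hom_pairing sA sV n (vzero H) \<phi> m as = 0" if "multilinear sA sW \<phi>"
    using tc that by (simp add: hom_pairing_def ops W_def w del: carr_tensor)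
  show "hom_pairing sA sV n (vadd H f g) \<phi> m as = hom_pairing sA sV n f \<phi> m as + hom_pairing sA sV n g \<phi> m as"
    if "f \<in> carr H" "g \<in> carr H" "multilinear sA sW \<phi>"
    using tc that w(1)[OF that(1)] w(1)[OF that(2)]
    by (simp add: hom_pairing_def ops W_def integ_tensor_ops del: carr_tensor)
  show "hom_pairing sA sV n (vscale H c f) \<phi> m as = c * hom_pairing sA sV n f \<phi> m as"
    if "f \<in> carr H" "multilinear sA sW \<phi>"
    using tc that w(1)[OF that(1)]
    by (simp add: hom_pairing_def ops W_def integ_tensor_ops del: carr_tensor)
qed

text \<open>The common shape of \<open>b_map\<close> and \<open>c_map\<close>. The formal sums G
  contain arbitrary choices and need not be multilinear themselves; it suffices that each pairing of
  G with a functional is a multilinear function. That function is then the transpose, so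
  well-definedness and computation come together.\<close>

lemma induced_map:
  fixes n p :: nat and G :: "'v \<times> 'a list \<Rightarrow> ('w \<times> 'a list \<Rightarrow>\<^sub>0 'k)"
  defines "h \<equiv> \<lambda>t\<in>carr (tensor sA sV n). tclass sA sW p (sw t G)"
  assumes G: "\<And>v l. length l = n \<Longrightarrow> G (v, l) \<in> free_part p"
    and H: "\<And>\<phi>. multilinear sA sW \<phi> \<Longrightarrow> multilinear sA sV (H \<phi>)"
    and GH: "\<And>\<phi> v l. multilinear sA sW \<phi> \<Longrightarrow> length l = n \<Longrightarrow> integ (G (v, l)) \<phi> = H \<phi> v l"
  shows "h \<in> carr (Hom_space (tensor sA sV n) (tensor sA sW p))"
    and "\<And>\<phi> v l. multilinear sA sW \<phi> \<Longrightarrow> length l = n \<Longrightarrow> hom_pairing sA sV n h \<phi> v l = H \<phi> v l"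
proof -
  have fp: "sw t G \<in> free_part p" if "t \<in> carr (tensor sA sV n)" for t
    unfolding sweedler_def
  proof (rule lin_ext_free_part)
    fix g assume "g \<in> Poly_Mapping.keys (rep t)"
    then have "length (snd g) = n" using rep_carr(1)[OF that] by (simp add: free_part_def)
    then show "G g \<in> free_part p" using G[of "snd g" "fst g"] by simp
  qed
  have h: "h t \<in> carr (tensor sA sW p)" if "t \<in> carr (tensor sA sV n)" for t
    using tclass_carr[OF fp[OF that]] that by (simp add: h_def)
  have I: "integ (rep (h t)) \<phi> = integ (rep t) (H \<phi>)"
    if "t \<in> carr (tensor sA sV n)" "multilinear sA sW \<phi>" for t \<phi>
  proof -
    have "integ (rep (h t)) \<phi> = integ (sw t G) \<phi>"
      using that integ_tclass[OF fp[OF that(1)] that(2)] by (simp add: h_def)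
    also have "\<dots> = integ (rep t) (\<lambda>u v. integ (G (u, v)) \<phi>)" by (simp add: integ_sw)
    also have "\<dots> = integ (rep t) (H \<phi>)"
      by (rule integ_rep_cong[OF that(1)]) (simp add: GH that)
    finally show ?thesis .
  qed
  show "h \<in> carr (Hom_space (tensor sA sV n) (tensor sA sW p))"
  proof (rule Hom_spaceI[OF _ h H I])
    show "h \<in> extensional (carr (tensor sA sV n))"
      unfolding h_def by (rule restrict_extensional)
  qed
  show "hom_pairing sA sV n h \<phi> v l = H \<phi> v l" if "multilinear sA sW \<phi>" "length l = n" for \<phi> v l
    using I[OF tclass_carr[OF gen_free_part[OF that(2)]] that(1)]
      integ_tclass[OF gen_free_part[OF that(2)] H[OF that(1)]] that(2)
    by (simp add: hom_pairing_def)
qed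

end

section \<open>Sweedler sums as functionals\<close>

text \<open>Made for values in V tensor A, where the list has one entry; comultiplication and
  coaction share this notation.\<close>

definition integ1 :: "('g \<times> 'a list \<Rightarrow>\<^sub>0 'k :: field) set \<Rightarrow> ('g \<Rightarrow> 'a \<Rightarrow> 'k) \<Rightarrow> 'k" where
  "integ1 t \<psi> = integ (rep t) (\<lambda>x y. \<psi> x (hd y))"

text \<open>Returning \<open>0\<close> on lists of different lengths keeps \<open>mult_lists \<psi>\<close> multilinear; \<open>map2\<close> would truncate.\<close>

fun mult_lists :: "('a :: times list \<Rightarrow> 'k :: zero) \<Rightarrow> 'a list \<Rightarrow> 'a list \<Rightarrow> 'k" where
  "mult_lists \<psi> [] [] = \<psi> []"
| "mult_lists \<psi> (x # xs) (y # ys) = mult_lists (\<lambda>l. \<psi> (x * y # l)) xs ys"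
| "mult_lists \<psi> _ _ = 0"

text \<open>Exactly one entry of the list varies, linearly in x. Its position is tracked by rules
  for \<open>#\<close> and \<open>@\<close>, so linearity goals need no guess of how to split the
  list.\<close>

definition llinear :: "('k \<Rightarrow> 'a \<Rightarrow> 'a) \<Rightarrow> ('k \<Rightarrow> 'v \<Rightarrow> 'v)
    \<Rightarrow> ('v :: ab_group_add \<Rightarrow> 'a :: ab_group_add list) \<Rightarrow> bool" where
  "llinear sA s g \<longleftrightarrow> (\<exists>l r E. klinear s sA E \<and> g = (\<lambda>x. l @ E x # r))"

lemma klinear_id: "klinear s s (\<lambda>x. x)"
  by (simp add: klinear_def)

lemma klinear_zero: "klinear s ((*) :: 'k :: field \<Rightarrow> _) (\<lambda>x. 0)"
  by (simp add: klinear_def)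

lemma klinear_if:
  "(c \<Longrightarrow> klinear s t f) \<Longrightarrow> (\<not> c \<Longrightarrow> klinear s t g) \<Longrightarrow> klinear s t (\<lambda>x. if c then f x else g x)"
  by (cases c) auto

lemma klinear_comp: "klinear s t E \<Longrightarrow> klinear t u h \<Longrightarrow> klinear s u (\<lambda>x. h (E x))"
  by (simp add: klinear_def)

lemma llinear_intros:
  "klinear s sA E \<Longrightarrow> llinear sA s (\<lambda>x. E x # l)"
  "llinear sA s G \<Longrightarrow> llinear sA s (\<lambda>x. a # G x)"
  "llinear sA s G \<Longrightarrow> llinear sA s (\<lambda>x. G x @ l)"
  "llinear sA s G \<Longrightarrow> llinear sA s (\<lambda>x. l @ G x)"
proof -
  show "llinear sA s (\<lambda>x. E x # l)" if "klinear s sA E"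
    unfolding llinear_def using that by (intro exI[of _ "[]"] exI[of _ l] exI[of _ E]) simp
  assume "llinear sA s G"
  then obtain l' r E where E: "klinear s sA E" "G = (\<lambda>x. l' @ E x # r)"
    unfolding llinear_def by blast
  show "llinear sA s (\<lambda>x. a # G x)"
    unfolding llinear_def using E by (intro exI[of _ "a # l'"] exI[of _ r] exI[of _ E]) simp
  show "llinear sA s (\<lambda>x. G x @ l)"
    unfolding llinear_def using E by (intro exI[of _ l'] exI[of _ "r @ l"] exI[of _ E]) simp
  show "llinear sA s (\<lambda>x. l @ G x)"
    unfolding llinear_def using E by (intro exI[of _ "l @ l'"] exI[of _ r] exI[of _ E]) simp
qed

lemma list_multilinearI:
  "(\<And>l r. klinear sA (*) (\<lambda>a. \<psi> (l @ a # r))) \<Longrightarrow> list_multilinear sA \<psi>"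
  by (simp add: list_multilinear_def)

lemma multilinearI:
  "(\<And>l. klinear sV (*) (\<lambda>v. \<phi> v l)) \<Longrightarrow> (\<And>v. list_multilinear sA (\<phi> v)) \<Longrightarrow> multilinear sA sV \<phi>"
  by (simp add: multilinear_def)

lemma klinear_list_multilinear:
  "list_multilinear sA \<psi> \<Longrightarrow> llinear sA s G \<Longrightarrow> klinear s (*) (\<lambda>x. \<psi> (G x))"
  unfolding list_multilinear_def llinear_def
  by (auto intro: klinear_comp)

lemma klinear_multilinear:
  assumes "multilinear sA sV \<phi>"
  shows "klinear s sV E \<Longrightarrow> klinear s (*) (\<lambda>x. \<phi> (E x) l)"
    and "llinear sA s G \<Longrightarrow> klinear s (*) (\<lambda>x. \<phi> v (G x))"
  using assms klinear_list_multilinear[of sA "\<phi> v" s G] klinear_comp[of s sV E "(*)" "\<lambda>v. \<phi> v l"]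
  by (auto simp: multilinear_def)

text \<open>The varying entry of \<open>l @ a # r\<close> is the head if l is empty and lies in the
  tail otherwise; the value at the empty list never matters.\<close>

lemma list_multilinear_hd_tl:
  assumes "\<And>t. klinear sA (*) (\<lambda>x. \<chi> x t)" "\<And>x. list_multilinear sA (\<chi> x)"
  shows "list_multilinear sA (\<lambda>l. \<chi> (hd l) (tl l))"
proof (rule list_multilinearI)
  fix l r
  show "klinear sA (*) (\<lambda>a. \<chi> (hd (l @ a # r)) (tl (l @ a # r)))"
    using assms by (cases l) (auto simp: list_multilinear_def)
qed

lemma list_multilinear_butlast_last:
  assumes "\<And>t. klinear sA (*) (\<chi> t)" "\<And>x. list_multilinear sA (\<lambda>t. \<chi> t x)"
  shows "list_multilinear sA (\<lambda>l. \<chi> (butlast l) (last l))"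
proof (rule list_multilinearI)
  fix l r
  show "klinear sA (*) (\<lambda>a. \<chi> (butlast (l @ a # r)) (last (l @ a # r)))"
    using assms by (cases r rule: rev_cases) (auto simp: list_multilinear_def butlast_append)
qed

lemma mult_lists_conv: "mult_lists \<psi> xs ys = (if length xs = length ys then \<psi> (map2 (*) xs ys) else 0)"
  by (induction \<psi> xs ys rule: mult_lists.induct) auto

lemma mult_lists_append: "mult_lists \<psi> (xs @ [x]) (ys @ [y]) = mult_lists (\<lambda>l. \<psi> (l @ [x * y])) xs ys"
  by (simp add: mult_lists_conv)

lemma mult_lists_zero [simp]: "mult_lists (\<lambda>_. 0) xs ys = 0"
  by (simp add: mult_lists_conv)

text \<open>Associativity of the componentwise product, seen on functionals. If the three lengths do
  not agree, both sides are 0.\<close>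

lemma mult_lists_mult_lists:
  fixes xs :: "'a :: semigroup_mult list"
  shows "mult_lists (\<lambda>l. mult_lists \<psi> l zs) xs ys = mult_lists (mult_lists \<psi> xs) ys zs"
proof (induction xs arbitrary: ys zs \<psi>)
  case Nil
  show ?case by (cases ys; cases zs; simp)
next
  case (Cons x xs)
  note IH = Cons.IH
  show ?case
  proof (cases ys)
    case [simp]: (Cons y ys')
    show ?thesis by (cases zs) (simp_all add: IH mult.assoc)
  qed (cases zs; simp)
qed

lemma klinear_mult_lists:
  fixes \<Psi> :: "'v :: ab_group_add \<Rightarrow> 'a :: times list \<Rightarrow> 'k :: field"
  shows "(\<And>l. klinear s (*) (\<lambda>x. \<Psi> x l)) \<Longrightarrow> klinear s (*) (\<lambda>x. mult_lists (\<Psi> x) xs ys)"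
  unfolding mult_lists_conv by (rule klinear_if) (simp_all add: klinear_zero)

lemma klinear_integ1:
  "(\<And>u v. klinear s (*) (\<lambda>x. \<psi> x u v)) \<Longrightarrow> klinear s (*) (\<lambda>x. integ1 t (\<psi> x))"
  unfolding integ1_def by (rule klinear_integ)

lemma integ_fun_zero [simp]: "integ t (\<lambda>_ _. 0) = 0"
  by (simp add: integ_def lin_ext_def)

lemma integ1_zero [simp]: "integ1 t (\<lambda>_ _. 0) = 0"
  by (simp add: integ1_def)

lemma integ1_integ: "integ1 t (\<lambda>x y. integ u (\<psi> x y)) = integ u (\<lambda>z w. integ1 t (\<lambda>x y. \<psi> x y z w))"
  unfolding integ1_def by (rule integ_swap)

lemma integ1_add: "integ1 t (\<lambda>x y. \<phi> x y + \<psi> x y) = integ1 t \<phi> + integ1 t \<psi>"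
  unfolding integ1_def by (rule integ_fun_add)

lemma integ1_scale: "integ1 t (\<lambda>x y. c * \<phi> x y) = c * integ1 t \<phi>"
  unfolding integ1_def by (rule integ_fun_scale)

lemma mult_lists_integ1: "mult_lists (\<lambda>l. integ1 t (\<psi> l)) xs ys = integ1 t (\<lambda>u v. mult_lists (\<lambda>l. \<psi> l u v) xs ys)"
  by (simp add: mult_lists_conv)

lemma sw_free_part:
  assumes "t \<in> carr (tensor sA sV n)" "\<And>u v. length v = n \<Longrightarrow> \<psi> (u, v) \<in> free_part m"
  shows "sw t \<psi> \<in> free_part m"
  unfolding sweedler_def
proof (rule lin_ext_free_part)
  fix g assume "g \<in> Poly_Mapping.keys (rep t)"
  then have "length (snd g) = n" using rep_carr(1)[OF assms(1)] by (simp add: free_part_def)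
  then show "\<psi> g \<in> free_part m" using assms(2)[of "snd g" "fst g"] by simp
qed

text \<open>\<open>cut1\<close> and \<open>cut2\<close> present bilinear and trilinear functions as
  functionals on lists of all lengths, so that axioms in the twofold and threefold tensor product
  can be tested against them.\<close>

definition cut1 :: "('v \<Rightarrow> 'a \<Rightarrow> 'k :: zero) \<Rightarrow> 'v \<Rightarrow> 'a list \<Rightarrow> 'k" where
  "cut1 \<psi> v l = (if length l = 1 then \<psi> v (hd l) else 0)"

definition cut2 :: "('v \<Rightarrow> 'a \<Rightarrow> 'a \<Rightarrow> 'k :: zero) \<Rightarrow> 'v \<Rightarrow> 'a list \<Rightarrow> 'k" where
  "cut2 \<psi> v l = (if length l = 2 then \<psi> v (hd l) (last l) else 0)"

lemma multilinear_cut1: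
  assumes "\<And>y. klinear sV (*) (\<lambda>x. \<psi> x y)" "\<And>x. klinear sA (*) (\<psi> x)"
  shows "multilinear sA sV (cut1 \<psi>)"
proof (intro multilinearI list_multilinearI)
  show "klinear sV (*) (\<lambda>v. cut1 \<psi> v l)" for l
    unfolding cut1_def using assms(1) by (intro klinear_if klinear_zero)
  show "klinear sA (*) (\<lambda>a. cut1 \<psi> v (l @ a # r))" for v l r
    unfolding cut1_def length_append list.size
    by (intro klinear_if klinear_zero) (use assms(2) in simp)
qed

lemma multilinear_cut2:
  assumes "\<And>y z. klinear sV (*) (\<lambda>x. \<psi> x y z)" "\<And>x z. klinear sA (*) (\<lambda>y. \<psi> x y z)"
    "\<And>x y. klinear sA (*) (\<psi> x y)"
  shows "multilinear sA sV (cut2 \<psi>)"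
proof (intro multilinearI list_multilinearI)
  show "klinear sV (*) (\<lambda>v. cut2 \<psi> v l)" for l
    unfolding cut2_def using assms(1) by (intro klinear_if klinear_zero)
  show "klinear sA (*) (\<lambda>a. cut2 \<psi> v (l @ a # r))" for v l r
    unfolding cut2_def length_append list.size
    by (intro klinear_if klinear_zero) (use assms(2,3) in \<open>cases l; cases r; simp\<close>)
qed

lemma integ1_cut1:
  "t \<in> carr (tensor sA sV 1) \<Longrightarrow> integ1 t \<psi> = integ (rep t) (cut1 \<psi>)"
  unfolding integ1_def by (rule integ_rep_cong) (auto simp: cut1_def)

lemma integ1_tclass:
  assumes "\<And>y. klinear sV (*) (\<lambda>x. \<psi> x y)" "\<And>x. klinear sA (*) (\<psi> x)" "x \<in> free_part 1"
  shows "integ1 (tclass sA sV 1 x) \<psi> = integ x (cut1 \<psi>)"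
  unfolding integ1_cut1[OF tclass_carr[OF assms(3)]]
  by (rule integ_tclass[OF assms(3) multilinear_cut1]) (fact assms)+

lemma klinear_integ1_coact:
  assumes "linear_map (type_space sV) (tensor sA sV 1) c"
    and "\<And>y. klinear sV (*) (\<lambda>x. \<psi> x y)" "\<And>x. klinear sA (*) (\<psi> x)"
    and "klinear s sV E"
  shows "klinear s (*) (\<lambda>x. integ1 (c (E x)) \<psi>)"
proof (rule klinear_comp[OF assms(4)])
  have c: "c x \<in> carr (tensor sA sV 1)" for x
    using assms(1) by (auto simp: linear_map_def type_space_def)
  show "klinear sV (*) (\<lambda>x. integ1 (c x) \<psi>)"
    unfolding integ1_cut1[OF c]
    by (rule klinear_integ_rep[OF assms(1) multilinear_cut1]) (fact assms)+
qed

text \<open>One proof serves coassociativity of A, with c and d both the comultiplication, and of a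
  comodule, with c its coaction: both axioms are the same equality of classes, tested against
  \<open>cut2\<close>.\<close>

lemma integ1_coassoc:
  assumes c: "\<And>x. c x \<in> carr (tensor sA sV 1)" and d: "\<And>x. d x \<in> carr (tensor sA sA 1)"
    and eq: "tclass sA sV 2 (sw (c m) (\<lambda>(x, y). sw (c x) (\<lambda>(u, v). gen (u, v @ y)))) =
      tclass sA sV 2 (sw (c m) (\<lambda>(x, y). sw (d (hd y)) (\<lambda>(u, v). gen (x, u # v))))"
    and \<psi>: "\<And>y z. klinear sV (*) (\<lambda>x. \<psi> x y z)" "\<And>x z. klinear sA (*) (\<lambda>y. \<psi> x y z)"
      "\<And>x y. klinear sA (*) (\<psi> x y)"
  shows "integ1 (c m) (\<lambda>x y. integ1 (c x) (\<lambda>u v. \<psi> u v y)) = integ1 (c m) (\<lambda>x y. integ1 (d y) (\<psi> x))"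
proof -
  have "integ1 (c m) (\<lambda>x y. integ1 (c x) (\<lambda>u v. \<psi> u v y)) =
      integ (sw (c m) (\<lambda>(x, y). sw (c x) (\<lambda>(u, v). gen (u, v @ y)))) (cut2 \<psi>)"
    unfolding integ1_def by (simp add: integ_sw)
      (intro integ_rep_cong[OF c], auto simp: cut2_def length_Suc_conv)
  also have "\<dots> = integ (sw (c m) (\<lambda>(x, y). sw (d (hd y)) (\<lambda>(u, v). gen (x, u # v)))) (cut2 \<psi>)"
    by (rule tclass_eqD[OF eq _ _ multilinear_cut2[OF \<psi>]])
       (auto intro!: sw_free_part[OF c] sw_free_part[OF d] gen_free_part)
  also have "\<dots> = integ1 (c m) (\<lambda>x y. integ1 (d y) (\<psi> x))"
    unfolding integ1_def by (simp add: integ_sw)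
      (intro integ_rep_cong[OF c] integ_rep_cong[OF d], auto simp: cut2_def length_Suc_conv)
  finally show ?thesis .
qed

section \<open>Comultiplication\<close>

locale bialgebra =
  fixes A :: "('k :: field, 'a :: ring_1) bialgebra_data"
  assumes is_bialgebra: "is_bialgebra A"
begin

abbreviation "sA \<equiv> ascale A"

abbreviation Delta :: "'a \<Rightarrow> ('a \<Rightarrow> 'a \<Rightarrow> 'k) \<Rightarrow> 'k" where
  "Delta a \<equiv> integ1 (comult A a)"

lemma linear_comult: "linear_map (type_space sA) (tensor sA sA 1) (comult A)"
  using is_bialgebra by (simp add: is_bialgebra_def is_coalgebra_def)

lemma comult_carr: "comult A a \<in> carr (tensor sA sA 1)"
  using linear_comult by (auto simp: linear_map_def type_space_def)

lemma klinear_Delta: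
  "\<lbrakk>klinear s sA E; \<And>y. klinear sA (*) (\<lambda>x. \<psi> x y); \<And>x. klinear sA (*) (\<psi> x)\<rbrakk>
    \<Longrightarrow> klinear s (*) (\<lambda>x. Delta (E x) \<psi>)"
  by (rule klinear_integ1_coact[OF linear_comult])

lemma Delta_coassoc:
  assumes "\<And>y z. klinear sA (*) (\<lambda>x. \<psi> x y z)" "\<And>x z. klinear sA (*) (\<lambda>y. \<psi> x y z)"
    "\<And>x y. klinear sA (*) (\<psi> x y)"
  shows "Delta a (\<lambda>x y. Delta x (\<lambda>u v. \<psi> u v y)) = Delta a (\<lambda>x y. Delta y (\<psi> x))"
  by (rule integ1_coassoc[OF comult_carr comult_carr])
     (use is_bialgebra assms in \<open>simp_all add: is_bialgebra_def is_coalgebra_def\<close>)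

lemma Delta_one:
  assumes "\<And>y. klinear sA (*) (\<lambda>x. \<psi> x y)" "\<And>x. klinear sA (*) (\<psi> x)"
  shows "Delta 1 \<psi> = \<psi> 1 1"
proof -
  have "Delta 1 \<psi> = integ1 (tclass sA sA 1 (gen (1, [1]))) \<psi>"
    using is_bialgebra by (simp add: is_bialgebra_def)
  also have "\<dots> = \<psi> 1 1"
    by (subst integ1_tclass[OF assms]) (auto intro: gen_free_part simp: cut1_def)
  finally show ?thesis .
qed

lemma Delta_mult:
  assumes "\<And>y. klinear sA (*) (\<lambda>x. \<psi> x y)" "\<And>x. klinear sA (*) (\<psi> x)"
  shows "Delta (a * b) \<psi> = Delta a (\<lambda>x y. Delta b (\<lambda>x' y'. \<psi> (x * x') (y * y')))"
proof -
  have "comult A (a * b) = tclass sA sA 1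
        (sw (comult A a) (\<lambda>(a1, a2). sw (comult A b) (\<lambda>(b1, b2). gen (a1 * b1, [hd a2 * hd b2]))))"
    using is_bialgebra by (simp add: is_bialgebra_def)
  also have "integ1 \<dots> \<psi> = Delta a (\<lambda>x y. Delta b (\<lambda>x' y'. \<psi> (x * x') (y * y')))"
    by (subst integ1_tclass[OF assms])
       (auto intro!: sw_free_part[OF comult_carr] gen_free_part simp: integ_sw cut1_def integ1_def)
  finally show ?thesis .
qed

lemma klinear_mult:
  "klinear s sA E \<Longrightarrow> klinear s sA (\<lambda>x. E x * b)"
  "klinear s sA E \<Longrightarrow> klinear s sA (\<lambda>x. b * E x)"
  using is_bialgebra
  by (simp_all add: klinear_def is_bialgebra_def is_algebra_def algebra_simps)

lemma klinear_prod_list: "llinear sA s G \<Longrightarrow> klinear s sA (\<lambda>x. prod_list (G x))"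
  unfolding llinear_def by (auto intro!: klinear_mult)

lemma list_multilinear_mult_lists:
  assumes "list_multilinear sA \<psi>"
  shows "list_multilinear sA (\<lambda>l. mult_lists \<psi> l ys)" "list_multilinear sA (mult_lists \<psi> xs)"
proof -
  show "list_multilinear sA (\<lambda>l. mult_lists \<psi> l ys)"
  proof (rule list_multilinearI)
    fix l r
    show "klinear sA (*) (\<lambda>a. mult_lists \<psi> (l @ a # r) ys)"
      using assms
    proof (induction l arbitrary: ys \<psi>)
      case Nil
      then show ?case
        by (cases ys) (auto simp: klinear_zero
            intro!: klinear_mult_lists klinear_list_multilinear[OF Nil] llinear_intros klinear_mult klinear_id)
    next
      case (Cons x l)
      have "list_multilinear sA (\<lambda>l. \<psi> (y # l))" for y
        by (intro list_multilinearI klinear_list_multilinear[OF Cons.prems] llinear_intros klinear_id)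
      then show ?case using Cons.IH by (cases ys) (auto simp: klinear_zero)
    qed
  qed
  show "list_multilinear sA (mult_lists \<psi> xs)"
  proof (rule list_multilinearI)
    fix l r
    show "klinear sA (*) (\<lambda>a. mult_lists \<psi> xs (l @ a # r))"
      using assms
    proof (induction l arbitrary: xs \<psi>)
      case Nil
      then show ?case
        by (cases xs) (auto simp: klinear_zero
            intro!: klinear_mult_lists klinear_list_multilinear[OF Nil] llinear_intros klinear_mult klinear_id)
    next
      case (Cons x l)
      have "list_multilinear sA (\<lambda>l. \<psi> (y # l))" for y
        by (intro list_multilinearI klinear_list_multilinear[OF Cons.prems] llinear_intros klinear_id)
      then show ?case using Cons.IH by (cases xs) (auto simp: klinear_zero)
    qed
  qed
qed

text \<open>
  \<open>D p a \<psi>\<close> is the sum of the \<open>\<psi> [a\<^sub>1, \<dots>, a\<^sub>p\<^sub>+\<^sub>1]\<close>, unfolded from the opposite end compared with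
  \<open>iter_comult\<close>; \<open>L as \<psi>\<close> is the sum of the \<open>\<psi> [(a\<^sup>1)\<^sub>1, \<dots>, (a\<^sup>n)\<^sub>1] [(a\<^sup>1)\<^sub>2, \<dots>, (a\<^sup>n)\<^sub>2]\<close>;
  \<open>comult_at j \<psi>\<close> is \<open>\<psi>\<close> after comultiplication of the entry \<open>j\<close> of a list.
\<close>

primrec D :: "nat \<Rightarrow> 'a \<Rightarrow> ('a list \<Rightarrow> 'k) \<Rightarrow> 'k" where
  "D 0 a \<psi> = \<psi> [a]"
| "D (Suc p) a \<psi> = Delta a (\<lambda>x y. D p y (\<lambda>l. \<psi> (x # l)))"

primrec L :: "'a list \<Rightarrow> ('a list \<Rightarrow> 'a list \<Rightarrow> 'k) \<Rightarrow> 'k" where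
  "L [] \<psi> = \<psi> [] []"
| "L (a # as) \<psi> = Delta a (\<lambda>x y. L as (\<lambda>s t. \<psi> (x # s) (y # t)))"

primrec comult_at :: "nat \<Rightarrow> ('a list \<Rightarrow> 'k) \<Rightarrow> 'a list \<Rightarrow> 'k" where
  "comult_at 0 \<psi> l = (case l of [] \<Rightarrow> 0 | a # r \<Rightarrow> Delta a (\<lambda>x y. \<psi> (x # y # r)))"
| "comult_at (Suc j) \<psi> l = (case l of [] \<Rightarrow> 0 | a # r \<Rightarrow> comult_at j (\<lambda>r. \<psi> (a # r)) r)"

section \<open>Interchange of the sums \<open>D\<close>, \<open>L\<close> and
  \<open>comult_at\<close>\<close>

lemma D_integ: "D p a (\<lambda>l. integ t (\<psi> l)) = integ t (\<lambda>u v. D p a (\<lambda>l. \<psi> l u v))"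
  by (induction p arbitrary: a \<psi>) (simp_all add: integ1_integ)

lemma D_integ1: "D p a (\<lambda>l. integ1 t (\<psi> l)) = integ1 t (\<lambda>u v. D p a (\<lambda>l. \<psi> l u v))"
  unfolding integ1_def by (rule D_integ)

lemma D_D: "D p a (\<lambda>l. D q b (\<psi> l)) = D q b (\<lambda>l'. D p a (\<lambda>l. \<psi> l l'))"
  by (induction q arbitrary: b \<psi>) (simp_all add: D_integ1)

lemma L_integ: "L as (\<lambda>s t. integ x (\<psi> s t)) = integ x (\<lambda>u v. L as (\<lambda>s t. \<psi> s t u v))"
  by (induction as arbitrary: \<psi>) (simp_all add: integ1_integ)

lemma L_integ1: "L as (\<lambda>s t. integ1 x (\<psi> s t)) = integ1 x (\<lambda>u v. L as (\<lambda>s t. \<psi> s t u v))"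
  unfolding integ1_def by (rule L_integ)

lemma L_D: "L as (\<lambda>s t. D p a (\<psi> s t)) = D p a (\<lambda>l. L as (\<lambda>s t. \<psi> s t l))"
  by (induction p arbitrary: a \<psi>) (simp_all add: L_integ1)

lemma comult_at_integ: "comult_at j (\<lambda>l. integ t (\<psi> l)) l = integ t (\<lambda>u v. comult_at j (\<lambda>l. \<psi> l u v) l)"
  by (induction j arbitrary: \<psi> l) (simp_all add: integ1_integ split: list.split)

lemma comult_at_integ1: "comult_at j (\<lambda>l. integ1 t (\<psi> l)) l = integ1 t (\<lambda>u v. comult_at j (\<lambda>l. \<psi> l u v) l)"
  unfolding integ1_def by (rule comult_at_integ)

lemma comult_at_zero [simp]: "comult_at j (\<lambda>_. 0) l = 0"
  by (induction j arbitrary: l) (simp_all split: list.split)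

lemma D_add: "D p a (\<lambda>l. \<phi> l + \<psi> l) = D p a \<phi> + D p a \<psi>"
  by (induction p arbitrary: a \<phi> \<psi>) (simp_all add: integ1_add)

lemma D_scale: "D p a (\<lambda>l. c * \<phi> l) = c * D p a \<phi>"
  by (induction p arbitrary: a \<phi>) (simp_all add: integ1_scale)

lemma L_add: "L as (\<lambda>s t. \<phi> s t + \<psi> s t) = L as \<phi> + L as \<psi>"
  by (induction as arbitrary: \<phi> \<psi>) (simp_all add: integ1_add)

lemma L_scale: "L as (\<lambda>s t. c * \<phi> s t) = c * L as \<phi>"
  by (induction as arbitrary: \<phi>) (simp_all add: integ1_scale)

lemma comult_at_swap: "comult_at i (\<lambda>l. comult_at j (\<psi> l) r) l = comult_at j (\<lambda>r. comult_at i (\<lambda>l. \<psi> l r) l) r"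
  by (induction i arbitrary: \<psi> l) (simp_all add: comult_at_integ1 split: list.split)

text \<open>Only lists of length p + 1 are ever fed to the integrand, which licenses rewriting with
  \<open>hd\<close>, \<open>last\<close> and \<open>butlast\<close> there.\<close>

lemma D_cong: "(\<And>l. length l = Suc p \<Longrightarrow> \<psi> l = \<psi>' l) \<Longrightarrow> D p a \<psi> = D p a \<psi>'"
proof (induction p arbitrary: a \<psi> \<psi>')
  case (Suc p)
  have "D p y (\<lambda>l. \<psi> (x # l)) = D p y (\<lambda>l. \<psi>' (x # l))" for x y
    by (rule Suc.IH) (simp add: Suc.prems)
  then show ?case by simp
qed simp

lemma L_cong:
  "(\<And>s t. length s = length as \<Longrightarrow> length t = length as \<Longrightarrow> \<psi> s t = \<psi>' s t) \<Longrightarrow> L as \<psi> = L as \<psi>'"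
proof (induction as arbitrary: \<psi> \<psi>')
  case (Cons a as)
  have "L as (\<lambda>s t. \<psi> (x # s) (y # t)) = L as (\<lambda>s t. \<psi>' (x # s) (y # t))" for x y
    by (rule Cons.IH) (simp add: Cons.prems)
  then show ?case by simp
qed simp

section \<open>Linearity of the iterated sums in their arguments\<close>

lemma klinear_D_fun: "(\<And>l. klinear s (*) (\<lambda>x. \<psi> x l)) \<Longrightarrow> klinear s (*) (\<lambda>x. D p a (\<psi> x))"
  by (induction p arbitrary: a \<psi>) (auto intro: klinear_integ1)

lemma klinear_L_fun: "(\<And>l r. klinear s (*) (\<lambda>x. \<psi> x l r)) \<Longrightarrow> klinear s (*) (\<lambda>x. L as (\<psi> x))"
  by (induction as arbitrary: \<psi>) (auto intro: klinear_integ1)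

lemma klinear_comult_at_fun: "(\<And>l. klinear s (*) (\<lambda>x. \<psi> x l)) \<Longrightarrow> klinear s (*) (\<lambda>x. comult_at j (\<psi> x) l)"
proof (induction j arbitrary: l \<psi>)
  case 0
  then show ?case by (cases l) (auto intro: klinear_integ1 klinear_zero)
next
  case (Suc j)
  then show ?case by (cases l) (auto intro: klinear_zero)
qed

lemma list_multilinear_Cons: "list_multilinear sA \<psi> \<Longrightarrow> list_multilinear sA (\<lambda>l. \<psi> (x # l))"
  by (rule list_multilinearI, erule klinear_list_multilinear) (intro llinear_intros klinear_id)

lemma klinear_D:
  assumes "klinear s sA E" "list_multilinear sA \<psi>"
  shows "klinear s (*) (\<lambda>x. D p (E x) \<psi>)"
proof (rule klinear_comp[OF assms(1)])
  show "klinear sA (*) (\<lambda>a. D p a \<psi>)"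
    using assms(2)
  proof (induction p arbitrary: \<psi>)
    case 0
    show ?case
      unfolding D.simps by (intro klinear_list_multilinear[OF 0] llinear_intros klinear_id)
  next
    case (Suc p)
    show ?case
      unfolding D.simps
      by (intro klinear_Delta klinear_D_fun klinear_list_multilinear[OF Suc.prems]
          llinear_intros klinear_id Suc.IH list_multilinear_Cons Suc.prems)
  qed
qed

lemma klinear_L:
  assumes "llinear sA s G" "\<And>t. list_multilinear sA (\<lambda>s. \<psi> s t)" "\<And>s. list_multilinear sA (\<psi> s)"
  shows "klinear s (*) (\<lambda>x. L (G x) \<psi>)"
proof -
  obtain l r E where E: "klinear s sA E" "G = (\<lambda>x. l @ E x # r)"
    using assms(1) unfolding llinear_def by blast
  have "klinear s (*) (\<lambda>x. L (l @ E x # r) \<psi>)"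
    using assms(2,3)
  proof (induction l arbitrary: \<psi>)
    case Nil
    show ?case
      by (simp, intro klinear_Delta E klinear_L_fun klinear_list_multilinear[OF Nil(1)]
          klinear_list_multilinear[OF Nil(2)] llinear_intros klinear_id)
  next
    case (Cons a l)
    show ?case
      by (simp, intro klinear_integ1 Cons.IH list_multilinear_Cons list_multilinear_Cons[OF Cons.prems(1)]
          list_multilinear_Cons[OF Cons.prems(2)])
  qed
  then show ?thesis by (simp add: E)
qed

lemma list_multilinear_comult_at:
  assumes "list_multilinear sA \<psi>"
  shows "list_multilinear sA (comult_at j \<psi>)"
proof (rule list_multilinearI)
  fix l r
  show "klinear sA (*) (\<lambda>a. comult_at j \<psi> (l @ a # r))"
    using assms
  proof (induction j arbitrary: l \<psi>)
    case 0
    show ?case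
      by (cases l) (auto intro!: klinear_Delta klinear_integ1 klinear_list_multilinear[OF 0] llinear_intros klinear_id)
  next
    case (Suc j)
    show ?case
    proof (cases l)
      case Nil
      then show ?thesis
        by (auto intro!: klinear_comult_at_fun klinear_list_multilinear[OF Suc.prems] llinear_intros klinear_id)
    next
      case (Cons b l')
      then show ?thesis by (simp add: Suc.IH list_multilinear_Cons Suc.prems)
    qed
  qed
qed

text \<open>These rules follow the syntax of an integrand and discharge the linearity conditions
  that accompany every use of an axiom.\<close>

lemmas klinear_intros = klinear_id klinear_mult klinear_prod_list llinear_intros klinear_integ1 klinear_Delta
  klinear_D_fun klinear_D klinear_L_fun klinear_L klinear_comult_at_fun klinear_mult_lists
  klinear_list_multilinear[OF list_multilinear_comult_at]
  klinear_list_multilinear[OF list_multilinear_mult_lists(1)] klinear_list_multilinear[OF list_multilinear_mult_lists(2)]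
  list_multilinearI multilinearI

text \<open>Coassociativity enters only for i = j, where one entry becomes three. For i < j two
  different entries are split and the sums commute; the shift to \<open>Suc j\<close> accounts for
  the entry inserted at i.\<close>

lemma comult_at_comult_at:
  assumes "list_multilinear sA \<psi>" "i \<le> j"
  shows "comult_at i (comult_at (Suc j) \<psi>) l = comult_at j (comult_at i \<psi>) l"
  using assms
proof (induction i arbitrary: j \<psi> l)
  case 0
  note k = klinear_list_multilinear[OF 0(1)]
  show ?case
  proof (cases l)
    case [simp]: (Cons a r)
    show ?thesis
    proof (cases j)
      case [simp]: 0
      have "Delta a (\<lambda>x y. Delta x (\<lambda>u v. \<psi> (u # v # y # r))) = Delta a (\<lambda>x y. Delta y (\<lambda>u v. \<psi> (x # u # v # r)))"
        by (rule Delta_coassoc) (intro k klinear_intros)+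
      then show ?thesis by simp
    next
      case [simp]: (Suc j')
      show ?thesis by (simp add: comult_at_integ1)
    qed
  qed (cases j; simp)
next
  case (Suc i)
  then obtain j' where [simp]: "j = Suc j'" "i \<le> j'" by (cases j) auto
  show ?case
    using Suc.IH[OF list_multilinear_Cons[OF Suc.prems(1)] \<open>i \<le> j'\<close>]
    by (simp split: list.split)
qed

text \<open>Entry j of the product list is a product x * y, so splitting it splits both x and y, by
  multiplicativity of the comultiplication; all other entries are carried along.\<close>

lemma mult_lists_comult_at:
  assumes "list_multilinear sA \<psi>"
  shows "mult_lists (comult_at j \<psi>) xs ys = comult_at j (\<lambda>xs. comult_at j (mult_lists \<psi> xs) ys) xs"
  using assms
proof (induction j arbitrary: \<psi> xs ys)
  case 0
  note k = klinear_list_multilinear[OF 0]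
  show ?case
  proof (cases xs; cases ys)
    fix x xs' y ys' assume [simp]: "xs = x # xs'" "ys = y # ys'"
    show ?thesis
      by (simp add: mult_lists_conv, intro impI Delta_mult) (intro k klinear_intros)+
  qed simp_all
next
  case (Suc j)
  have "mult_lists (comult_at j (\<lambda>r. \<psi> (z # r))) xs ys = comult_at j (\<lambda>xs. comult_at j (mult_lists (\<lambda>r. \<psi> (z # r)) xs) ys) xs" for z xs ys
    by (rule Suc.IH[OF list_multilinear_Cons[OF Suc.prems]])
  then show ?case by (cases xs; cases ys) simp_all
qed

lemma comult_at_snoc: "j < length l \<Longrightarrow> comult_at j \<psi> (l @ [y]) = comult_at j (\<lambda>l. \<psi> (l @ [y])) l"
  by (induction j arbitrary: l \<psi>) (auto split: list.split simp: neq_Nil_conv)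

lemma comult_at_last: "comult_at (length l) \<psi> (l @ [a]) = Delta a (\<lambda>x y. \<psi> (l @ [x, y]))"
  by (induction l arbitrary: \<psi>) simp_all

text \<open>Generalised coassociativity: whichever of the p + 1 components is split, the result is
  the sum over p + 2 components. Entry 0 is \<open>Delta_coassoc\<close>; a later entry is an entry
  of the tail.\<close>

lemma D_comult_at:
  assumes "list_multilinear sA \<psi>" "j \<le> p"
  shows "D (Suc p) a \<psi> = D p a (comult_at j \<psi>)"
  using assms
proof (induction p arbitrary: a j \<psi>)
  case (Suc q)
  note k = klinear_list_multilinear[OF Suc.prems(1)] list_multilinearI[of sA, OF klinear_list_multilinear[OF Suc.prems(1)]]
  show ?case
  proof (cases j)
    case [simp]: 0
    have "D (Suc (Suc q)) a \<psi> = Delta a (\<lambda>x y. Delta y (\<lambda>u w. D q w (\<lambda>l. \<psi> (x # u # l))))"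
      by simp
    also have "\<dots> = Delta a (\<lambda>x y. Delta x (\<lambda>u v. D q y (\<lambda>l. \<psi> (u # v # l))))"
      by (rule Delta_coassoc[symmetric]) (intro k klinear_intros)+
    also have "\<dots> = D (Suc q) a (comult_at j \<psi>)"
      by (simp add: D_integ1)
    finally show ?thesis .
  next
    case [simp]: (Suc j')
    have "D (Suc q) y (\<lambda>l. \<psi> (x # l)) = D q y (comult_at j' (\<lambda>l. \<psi> (x # l)))" for x y
      by (rule Suc.IH[OF list_multilinear_Cons[OF Suc.prems(1)]]) (use Suc.prems in simp)
    then show ?thesis by (simp del: D.simps add: D.simps(2)[of "Suc q"]) simp
  qed
qed simp

text \<open>The recursion of \<open>D\<close> detaches the first component; this detaches the last
  one, which is the special one for the last map b and for the last map c.\<close>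

lemma D_snoc:
  assumes "list_multilinear sA \<psi>"
  shows "D (Suc p) a \<psi> = Delta a (\<lambda>x y. D p x (\<lambda>l. \<psi> (l @ [y])))"
  using assms
proof (induction p arbitrary: a \<psi>)
  case (Suc q)
  note k = klinear_list_multilinear[OF Suc.prems]
  have "D (Suc (Suc q)) a \<psi> = Delta a (\<lambda>x y. D (Suc q) y (\<lambda>l. \<psi> (x # l)))"
    by simp
  also have "\<dots> = Delta a (\<lambda>x y. Delta y (\<lambda>u w. D q u (\<lambda>l. \<psi> (x # l @ [w]))))"
    by (simp only: Suc.IH[OF list_multilinear_Cons[OF Suc.prems]])
  also have "\<dots> = Delta a (\<lambda>x y. Delta x (\<lambda>u v. D q v (\<lambda>l. \<psi> (u # l @ [y]))))"
    by (rule Delta_coassoc[symmetric]) (intro k klinear_intros)+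
  finally show ?case by simp
qed simp

text \<open>Brings the first two components under one \<open>Delta\<close>, the shape in which the
  Yetter-Drinfel'd condition for N applies.\<close>

lemma D_split_head:
  assumes "\<And>y r. klinear sA (*) (\<lambda>x. \<psi> x y r)" "\<And>x r. klinear sA (*) (\<lambda>y. \<psi> x y r)"
    "\<And>x y. list_multilinear sA (\<psi> x y)"
  shows "D p a (\<lambda>l. Delta (hd l) (\<lambda>x y. \<psi> x y (tl l))) = D (Suc p) a (\<lambda>l. \<psi> (hd l) (hd (tl l)) (tl (tl l)))"
proof -
  let ?\<Psi> = "\<lambda>l. \<psi> (hd l) (hd (tl l)) (tl (tl l))"
  have "list_multilinear sA (\<lambda>l. \<psi> x (hd l) (tl l))" for x
    by (rule list_multilinear_hd_tl) (fact assms)+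
  then have "list_multilinear sA ?\<Psi>"
    by (intro list_multilinear_hd_tl[where \<chi> = "\<lambda>x l. \<psi> x (hd l) (tl l)"] assms)
  then have "D (Suc p) a ?\<Psi> = D p a (comult_at 0 ?\<Psi>)"
    by (rule D_comult_at) simp
  also have "\<dots> = D p a (\<lambda>l. Delta (hd l) (\<lambda>x y. \<psi> x y (tl l)))"
    by (rule D_cong) (auto simp: length_Suc_conv)
  finally show ?thesis ..
qed

text \<open>The counterpart for the last two components and the condition for M. The first equation
  fits the case that all p + 2 components are taken at once, the second the case that a is
  comultiplied before one of its halves is comultiplied further.\<close>

lemma D_split_last:
  assumes "\<And>r y. klinear sA (*) (\<lambda>x. \<psi> r x y)" "\<And>r x. klinear sA (*) (\<lambda>y. \<psi> r x y)"
    "\<And>x y. list_multilinear sA (\<lambda>r. \<psi> r x y)"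
  shows "D p a (\<lambda>l. Delta (last l) (\<lambda>x y. \<psi> (butlast l) x y)) =
      D (Suc p) a (\<lambda>l. \<psi> (butlast (butlast l)) (last (butlast l)) (last l))"
    and "D p a (\<lambda>l. Delta (last l) (\<lambda>x y. \<psi> (butlast l) x y)) =
      Delta a (\<lambda>x y. D p x (\<lambda>l. \<psi> (butlast l) (last l) y))"
proof -
  let ?\<Psi> = "\<lambda>l. \<psi> (butlast (butlast l)) (last (butlast l)) (last l)"
  have "list_multilinear sA (\<lambda>l. \<psi> (butlast l) (last l) y)" for y
    by (rule list_multilinear_butlast_last) (fact assms)+
  then have lm: "list_multilinear sA ?\<Psi>"
    by (intro list_multilinear_butlast_last[where \<chi> = "\<lambda>l y. \<psi> (butlast l) (last l) y"] assms)
  then have "D (Suc p) a ?\<Psi> = D p a (comult_at p ?\<Psi>)"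
    by (rule D_comult_at) simp
  also have "\<dots> = D p a (\<lambda>l. Delta (last l) (\<lambda>x y. \<psi> (butlast l) x y))"
  proof (rule D_cong)
    fix l :: "'a list" assume "length l = Suc p"
    then obtain r z where l: "l = r @ [z]" "length r = p" by (cases l rule: rev_cases) auto
    show "comult_at p ?\<Psi> l = Delta (last l) (\<lambda>x y. \<psi> (butlast l) x y)"
      using comult_at_last[of r ?\<Psi> z] l by (simp add: butlast_append)
  qed
  finally show *: "D p a (\<lambda>l. Delta (last l) (\<lambda>x y. \<psi> (butlast l) x y)) = D (Suc p) a ?\<Psi>" ..
  show "D p a (\<lambda>l. Delta (last l) (\<lambda>x y. \<psi> (butlast l) x y)) =
      Delta a (\<lambda>x y. D p x (\<lambda>l. \<psi> (butlast l) (last l) y))"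
    unfolding * D_snoc[OF lm] by simp
qed

lemma D_mult:
  assumes "list_multilinear sA \<psi>"
  shows "D p (a * b) \<psi> = D p a (\<lambda>l. D p b (mult_lists \<psi> l))"
  using assms
proof (induction p arbitrary: a b \<psi>)
  case (Suc p)
  note k = klinear_list_multilinear[OF Suc.prems]
  have "D (Suc p) (a * b) \<psi> = Delta a (\<lambda>x y. Delta b (\<lambda>x' y'. D p (y * y') (\<lambda>l. \<psi> (x * x' # l))))"
    unfolding D.simps by (rule Delta_mult) (intro k klinear_intros)+
  also have "\<dots> = Delta a (\<lambda>x y. Delta b (\<lambda>x' y'. D p y (\<lambda>l. D p y' (\<lambda>l'. mult_lists \<psi> (x # l) (x' # l')))))"
    by (simp add: Suc.IH[OF list_multilinear_Cons[OF Suc.prems]])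
  also have "\<dots> = Delta a (\<lambda>x y. D p y (\<lambda>l. Delta b (\<lambda>x' y'. D p y' (\<lambda>l'. mult_lists \<psi> (x # l) (x' # l')))))"
    by (simp only: D_integ1)
  finally show ?case by simp
qed simp

lemma L_append: "L (xs @ ys) \<psi> = L xs (\<lambda>s t. L ys (\<lambda>s' t'. \<psi> (s @ s') (t @ t')))"
  by (induction xs arbitrary: \<psi>) simp_all

text \<open>Coassociativity of the tensor coalgebra A^n: \<open>Delta_coassoc\<close> for the head,
  induction for the tail, and interchange of the two families of sums.\<close>

lemma L_coassoc:
  assumes "\<And>t u. list_multilinear sA (\<lambda>s. \<psi> s t u)" "\<And>s u. list_multilinear sA (\<lambda>t. \<psi> s t u)"
    "\<And>s t. list_multilinear sA (\<psi> s t)"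
  shows "L as (\<lambda>s t. L s (\<lambda>u v. \<psi> u v t)) = L as (\<lambda>s t. L t (\<psi> s))"
  using assms
proof (induction as arbitrary: \<psi>)
  case (Cons a as)
  note c = list_multilinear_Cons[OF Cons.prems(1)] list_multilinear_Cons[OF Cons.prems(2)]
    list_multilinear_Cons[OF Cons.prems(3)]
  note k = Cons.prems[THEN klinear_list_multilinear]
  have "L (a # as) (\<lambda>s t. L s (\<lambda>u v. \<psi> u v t)) =
      Delta a (\<lambda>x y. Delta x (\<lambda>u v. L as (\<lambda>s t. L s (\<lambda>s1 s2. \<psi> (u # s1) (v # s2) (y # t)))))"
    by (simp add: L_integ1)
  also have "\<dots> = Delta a (\<lambda>x y. Delta x (\<lambda>u v. L as (\<lambda>s t. L t (\<lambda>t1 t2. \<psi> (u # s) (v # t1) (y # t2)))))"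
    by (subst Cons.IH[where \<psi> = "\<lambda>s t u'. \<psi> (_ # s) (_ # t) (_ # u')"]) (rule c refl)+
  also have "\<dots> = Delta a (\<lambda>x y. Delta y (\<lambda>u v. L as (\<lambda>s t. L t (\<lambda>t1 t2. \<psi> (x # s) (u # t1) (v # t2)))))"
    by (rule Delta_coassoc) (intro k klinear_intros)+
  finally show ?case by (simp add: L_integ1)
qed simp

text \<open>Iterated multiplication is a map of coalgebras; the empty product is covered by the
  comultiplication of 1.\<close>

lemma Delta_prod_list:
  assumes "\<And>y. klinear sA (*) (\<lambda>x. \<psi> x y)" "\<And>x. klinear sA (*) (\<psi> x)"
  shows "Delta (prod_list as) \<psi> = L as (\<lambda>s t. \<psi> (prod_list s) (prod_list t))"
  using assms
proof (induction as arbitrary: \<psi>)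
  case Nil
  then show ?case by (simp add: Delta_one)
next
  case (Cons a as)
  have "Delta (prod_list as) (\<lambda>x' y'. \<psi> (x * x') (y * y')) =
      L as (\<lambda>s t. \<psi> (x * prod_list s) (y * prod_list t))" for x y
    by (rule Cons.IH) (intro klinear_comp[OF _ Cons.prems(1)] klinear_comp[OF _ Cons.prems(2)] klinear_intros)+
  then show ?case by (simp add: Delta_mult[OF Cons.prems])
qed

lemma iter_comult_carr: "iter_comult A p a \<in> carr (tensor sA sA p)"
proof (induction p)
  case 0
  show ?case by (simp add: tclass_carr[simplified] gen_free_part)
next
  case (Suc p)
  show ?case
    unfolding iter_comult.simps
    by (rule tclass_carr) (auto intro!: sw_free_part[OF Suc] sw_free_part[OF comult_carr] gen_free_part)
qed

text \<open>\<open>iter_comult\<close> keeps splitting its first component, which is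
  \<open>comult_at 0\<close> under \<open>D p\<close>; \<open>D_comult_at\<close> exchanges this for
  the recursion of \<open>D\<close>, which keeps splitting the last one.\<close>

lemma integ_iter_comult:
  assumes "list_multilinear sA \<psi>"
  shows "integ (rep (iter_comult A p a)) (\<lambda>x xs. \<psi> (x # xs)) = D p a \<psi>"
  using assms
proof (induction p arbitrary: \<psi>)
  case 0
  have "multilinear sA sA (\<lambda>x xs. \<psi> (x # xs))"
    by (intro klinear_list_multilinear[OF 0] klinear_intros)
  then show ?case by (simp add: integ_tclass gen_free_part)
next
  case (Suc p)
  have ml: "multilinear sA sA (\<lambda>x xs. \<psi> (x # xs))"
    by (intro klinear_list_multilinear[OF Suc.prems] klinear_intros)
  have "integ (rep (iter_comult A (Suc p) a)) (\<lambda>x xs. \<psi> (x # xs)) =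
     integ (rep (iter_comult A p a)) (\<lambda>x y. integ (rep (comult A x)) (\<lambda>u v. \<psi> (u # v @ y)))"
    unfolding iter_comult.simps
    by (subst integ_tclass[OF _ ml])
       (auto intro!: sw_free_part[OF iter_comult_carr] sw_free_part[OF comult_carr] gen_free_part simp: integ_sw)
  also have "\<dots> = integ (rep (iter_comult A p a)) (\<lambda>x y. comult_at 0 \<psi> (x # y))"
    by (simp add: integ1_def) (intro integ_rep_cong[OF iter_comult_carr] integ_rep_cong[OF comult_carr],
      auto simp: length_Suc_conv)
  also have "\<dots> = D p a (comult_at 0 \<psi>)"
    by (rule Suc.IH[OF list_multilinear_comult_at[OF Suc.prems]])
  also have "\<dots> = D (Suc p) a \<psi>"
    by (rule D_comult_at[OF Suc.prems, symmetric]) simp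
  finally show ?case .
qed

lemma integ_list_comult: "integ (list_comult A as) \<psi> = L as \<psi>"
  by (induction as arbitrary: \<psi>) (simp_all add: integ_sw integ_lin_ext integ1_def)

end

section \<open>Yetter-Drinfel'd modules\<close>

locale yd_module = bialgebra A
  for A :: "('k :: field, 'a :: ring_1) bialgebra_data" +
  fixes V :: "('k, 'a, 'v :: ab_group_add) yd_data"
  assumes is_yd: "is_yetter_drinfeld A V"
begin

abbreviation "sV \<equiv> mscale V"

abbreviation Rho :: "'v \<Rightarrow> ('v \<Rightarrow> 'a \<Rightarrow> 'k) \<Rightarrow> 'k" where
  "Rho m \<equiv> integ1 (coact V m)"

lemma klinear_act:
  "klinear s sA E \<Longrightarrow> klinear s sV (\<lambda>x. act V (E x) v)"
  "klinear s sV E' \<Longrightarrow> klinear s sV (\<lambda>x. act V a (E' x))"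
  using is_yd by (simp_all add: klinear_def is_yetter_drinfeld_def is_left_module_def)

lemma act_mult: "act V (a * b) v = act V a (act V b v)"
  using is_yd by (simp add: is_yetter_drinfeld_def is_left_module_def)

lemma linear_coact: "linear_map (type_space sV) (tensor sA sV 1) (coact V)"
  using is_yd by (simp add: is_yetter_drinfeld_def is_right_comodule_def)

lemma coact_carr: "coact V m \<in> carr (tensor sA sV 1)"
  using linear_coact by (auto simp: linear_map_def type_space_def)

lemma klinear_Rho:
  "\<lbrakk>klinear s sV E; \<And>y. klinear sV (*) (\<lambda>x. \<psi> x y); \<And>x. klinear sA (*) (\<psi> x)\<rbrakk>
    \<Longrightarrow> klinear s (*) (\<lambda>x. Rho (E x) \<psi>)"
  by (rule klinear_integ1_coact[OF linear_coact])

lemma Rho_coassoc: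
  assumes "\<And>y z. klinear sV (*) (\<lambda>x. \<psi> x y z)" "\<And>x z. klinear sA (*) (\<lambda>y. \<psi> x y z)"
    "\<And>x y. klinear sA (*) (\<psi> x y)"
  shows "Rho m (\<lambda>x y. Rho x (\<lambda>u v. \<psi> u v y)) = Rho m (\<lambda>x y. Delta y (\<psi> x))"
  by (rule integ1_coassoc[OF coact_carr comult_carr])
     (use is_yd assms in \<open>simp_all add: is_yetter_drinfeld_def is_right_comodule_def\<close>)

lemma yd_compatible:
  assumes "\<And>y. klinear sV (*) (\<lambda>x. \<psi> x y)" "\<And>x. klinear sA (*) (\<psi> x)"
  shows "Delta a (\<lambda>x y. Rho (act V y m) (\<lambda>u v. \<psi> u (v * x))) =
    Delta a (\<lambda>x y. Rho m (\<lambda>u v. \<psi> (act V x u) (y * v)))"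
proof -
  have eq: "tclass sA sV 1
          (sw (comult A a) (\<lambda>(a1, a2). sw (coact V (act V (hd a2) m)) (\<lambda>(x0, x1).
             gen (x0, [hd x1 * a1])))) =
        tclass sA sV 1
          (sw (comult A a) (\<lambda>(a1, a2). sw (coact V m) (\<lambda>(m0, m1).
             gen (act V a1 m0, [hd a2 * hd m1]))))"
    using is_yd by (simp add: is_yetter_drinfeld_def)
  have "integ (sw (comult A a) (\<lambda>(a1, a2). sw (coact V (act V (hd a2) m)) (\<lambda>(x0, x1).
             gen (x0, [hd x1 * a1])))) (cut1 \<psi>) =
     integ (sw (comult A a) (\<lambda>(a1, a2). sw (coact V m) (\<lambda>(m0, m1).
             gen (act V a1 m0, [hd a2 * hd m1])))) (cut1 \<psi>)"
    by (rule tclass_eqD[OF eq _ _ multilinear_cut1[OF assms]])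
       (auto intro!: sw_free_part[OF comult_carr] sw_free_part[OF coact_carr] gen_free_part)
  then show ?thesis by (simp add: integ_sw cut1_def integ1_def)
qed

end

section \<open>The maps of the double complex on functionals\<close>

locale yd_pair = bialgebra A + M: yd_module A M + N: yd_module A N
  for A :: "('k :: field, 'a :: ring_1) bialgebra_data"
    and M :: "('k, 'a, 'm :: ab_group_add) yd_data"
    and N :: "('k, 'a, 'n :: ab_group_add) yd_data"
begin

abbreviation "sM \<equiv> mscale M"
abbreviation "sN \<equiv> mscale N"

abbreviation F where "F \<equiv> hom_pairing sA sM"

lemma carr_Y: "carr (Y A M N n p) = carr (Hom_space (tensor sA sM n) (tensor sA sN p))"
  by (simp add: Y_def)

lemma Y_value:
  assumes "f \<in> carr (Y A M N n p)" "length as = n"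
  shows "f (tclass sA sM n (gen (m, as))) \<in> carr (tensor sA sN p)"
  using assms tclass_carr[OF gen_free_part[OF assms(2), of m], of sA sM]
  unfolding carr_Y carr_Hom_space linear_map_def by blast

lemma multilinear_F:
  "f \<in> carr (Y A M N n p) \<Longrightarrow> multilinear sA sN \<phi> \<Longrightarrow> multilinear sA sM (F n f \<phi>)"
  unfolding carr_Y by (rule multilinear_hom_pairing)

lemma Y_eqI:
  assumes "f \<in> carr (Y A M N n p)" "g \<in> carr (Y A M N n p)"
    and "\<And>\<phi> m as. multilinear sA sN \<phi> \<Longrightarrow> length as = n \<Longrightarrow> F n f \<phi> m as = F n g \<phi> m as"
  shows "f = g"
  using assms unfolding carr_Y by (rule Hom_space_eqI)

lemma klinear_F:
  assumes "f \<in> carr (Y A M N n p)"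
  shows "\<lbrakk>klinear s sM E; multilinear sA sN \<phi>\<rbrakk> \<Longrightarrow> klinear s (*) (\<lambda>x. F n f \<phi> (E x) l)"
    and "\<lbrakk>llinear sA s G; multilinear sA sN \<phi>\<rbrakk> \<Longrightarrow> klinear s (*) (\<lambda>x. F n f \<phi> m (G x))"
  by (simp_all add: klinear_multilinear[OF multilinear_F[OF assms]])

lemma klinear_F_fun:
  "(\<And>v l. klinear s (*) (\<lambda>x. \<phi> x v l)) \<Longrightarrow> klinear s (*) (\<lambda>x. F n f (\<phi> x) m as)"
  unfolding hom_pairing_def by (rule klinear_integ)

lemma F_cong:
  assumes "f \<in> carr (Y A M N n p)" "\<And>v l. length l = p \<Longrightarrow> \<phi> v l = \<phi>' v l"
  shows "F n f \<phi> m as = F n f \<phi>' m as"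
proof (cases "length as = n")
  case True
  then show ?thesis
    using integ_rep_cong[OF Y_value[OF assms(1) True, of m], of \<phi> \<phi>'] assms(2)
    by (simp add: hom_pairing_def)
qed (simp add: hom_pairing_def)

lemma F_integ:
  "F n f (\<lambda>v l. integ t (\<phi> v l)) m as = integ t (\<lambda>x y. F n f (\<lambda>v l. \<phi> v l x y) m as)"
  unfolding hom_pairing_def by (rule integ_swap)

lemma F_integ1:
  "F n f (\<lambda>v l. integ1 t (\<phi> v l)) m as = integ1 t (\<lambda>x y. F n f (\<lambda>v l. \<phi> v l x y) m as)"
  unfolding integ1_def by (rule F_integ)

lemma F_L: "F n f (\<lambda>v l. L bs (\<phi> v l)) m as = L bs (\<lambda>s t. F n f (\<lambda>v l. \<phi> v l s t) m as)"
  unfolding hom_pairing_def by (rule L_integ[symmetric])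

lemma F_comult_at: "comult_at j (\<lambda>r. F n f (\<phi> r) m as) l = F n f (\<lambda>v l'. comult_at j (\<lambda>r. \<phi> r v l') l) m as"
  unfolding hom_pairing_def by (rule comult_at_integ)

lemma list_multilinear_multilinear:
  "multilinear sA sN \<phi> \<Longrightarrow> list_multilinear sA (\<phi> v)"
  by (simp add: multilinear_def)

lemmas klinear_yd_intros = klinear_intros N.klinear_act M.klinear_act N.klinear_Rho M.klinear_Rho klinear_F_fun

text \<open>The outer operations of \<open>b_0\<close>, of the last b, of \<open>c_0\<close> and of
  the last c, transposed to functionals. For \<open>lact\<close> and \<open>ract\<close> the list
  consists of the Sweedler components of one element: the head acts on N in \<open>lact\<close>,
  while \<open>ract\<close> drops the last one, which acts on M instead. For \<open>lcoact\<close>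
  and \<open>rcoact\<close> the list has one component from each of the entries of A^n.\<close>

abbreviation lact :: "'a list \<Rightarrow> ('n \<Rightarrow> 'a list \<Rightarrow> 'k) \<Rightarrow> 'n \<Rightarrow> 'a list \<Rightarrow> 'k" where
  "lact l \<phi> \<equiv> \<lambda>v vs. mult_lists (\<phi> (act N (hd l) v)) (tl l) vs"

abbreviation ract :: "'a list \<Rightarrow> ('n \<Rightarrow> 'a list \<Rightarrow> 'k) \<Rightarrow> 'n \<Rightarrow> 'a list \<Rightarrow> 'k" where
  "ract l \<phi> \<equiv> \<lambda>v vs. mult_lists (\<phi> v) vs (butlast l)"

abbreviation lcoact :: "'a list \<Rightarrow> ('n \<Rightarrow> 'a list \<Rightarrow> 'k) \<Rightarrow> 'n \<Rightarrow> 'a list \<Rightarrow> 'k" where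
  "lcoact s \<phi> \<equiv> \<lambda>v vs. N.Rho v (\<lambda>x y. \<phi> x ((y * prod_list s) # vs))"

abbreviation rcoact :: "'a list \<Rightarrow> 'a \<Rightarrow> ('n \<Rightarrow> 'a list \<Rightarrow> 'k) \<Rightarrow> 'n \<Rightarrow> 'a list \<Rightarrow> 'k" where
  "rcoact t y \<phi> \<equiv> \<lambda>v vs. \<phi> v (vs @ [prod_list t * y])"

context
  fixes \<phi> assumes \<phi>: "multilinear sA sN \<phi>"
begin

lemmas k\<phi> = klinear_multilinear[OF \<phi>] list_multilinear_multilinear[OF \<phi>]
  list_multilinear_mult_lists[OF list_multilinear_multilinear[OF \<phi>]]

lemma multilinear_lact: "multilinear sA sN (lact l \<phi>)"
  by (rule multilinearI) (intro k\<phi> klinear_yd_intros)+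

lemma multilinear_ract: "multilinear sA sN (ract l \<phi>)"
  by (rule multilinearI) (intro k\<phi> klinear_yd_intros)+

lemma multilinear_lcoact: "multilinear sA sN (\<lambda>v vs. N.Rho v (\<lambda>x y. \<phi> x ((y * z) # vs)))"
  by (rule multilinearI) (intro k\<phi> klinear_yd_intros)+

lemma multilinear_rcoact: "multilinear sA sN (\<lambda>v vs. \<phi> v (vs @ [z]))"
  by (rule multilinearI) (intro k\<phi> klinear_yd_intros)+

lemma multilinear_comult_at: "multilinear sA sN (\<lambda>v. comult_at j (\<phi> v))"
  by (rule multilinearI) (intro k\<phi> klinear_yd_intros list_multilinear_comult_at)+

end

section \<open>The maps b on functionals\<close>

context
  fixes n p f assumes f: "f \<in> carr (Y A M N n p)"
begin

lemma list_multilinear_F_lact: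
  assumes "multilinear sA sN \<phi>"
  shows "list_multilinear sA (\<lambda>l. F n f (lact l \<phi>) m as)"
  by (rule list_multilinear_hd_tl[where \<chi> = "\<lambda>x xs. F n f (\<lambda>v. mult_lists (\<phi> (act N x v)) xs) m as"])
     (intro k\<phi>[OF assms] klinear_yd_intros)+

lemma list_multilinear_F_ract:
  assumes "multilinear sA sN \<phi>"
  shows "list_multilinear sA (\<lambda>l. F n f (ract l \<phi>) (act M (last l) m) as)"
  by (rule list_multilinear_butlast_last[where \<chi> = "\<lambda>xs x. F n f (\<lambda>v vs. mult_lists (\<phi> v) vs xs) (act M x m) as"])
     (intro k\<phi>[OF assms] klinear_yd_intros klinear_F[OF f])+

lemma b_first:
  shows "b_map A M N n p 0 f \<in> carr (Y A M N (n + 1) p)" (is ?c)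
    and "\<And>\<phi> m a as. multilinear sA sN \<phi> \<Longrightarrow> length as = n \<Longrightarrow>
      F (n + 1) (b_map A M N n p 0 f) \<phi> m (a # as) = D p a (\<lambda>l. F n f (lact l \<phi>) m as)"
proof -
  \<comment> \<open>Multilinearity is required on lists of every length: the default 0 takes care of
    the empty list, the cut-off in \<open>F\<close> of the other wrong lengths.\<close>
  let ?H = "\<lambda>\<phi> m as. case as of [] \<Rightarrow> 0 | a # as \<Rightarrow> D p a (\<lambda>l. F n f (lact l \<phi>) m as)"
  note lml = list_multilinear_F_lact
  have H: "multilinear sA sM (?H \<phi>)" if "multilinear sA sN \<phi>" for \<phi>
  proof (intro multilinearI list_multilinearI)
    show "klinear sM (*) (\<lambda>v. ?H \<phi> v l)" for l
      by (cases l) (auto intro!: klinear_zero klinear_yd_intros klinear_F[OF f] multilinear_lact that)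
    show "klinear sA (*) (\<lambda>a. ?H \<phi> v (l @ a # r))" for v l r
      by (cases l) (auto intro!: klinear_D klinear_D_fun klinear_id klinear_F[OF f]
        multilinear_lact[OF that] llinear_intros lml[OF that])
  qed
  have G: "b_gen A M N n p 0 f (v, l) \<in> free_part p" if "length l = n + 1" for v l
    using that
    by (auto simp: b_gen_def intro!: sw_free_part[OF iter_comult_carr] sw_free_part[OF Y_value[OF f]]
      gen_free_part)
  have GH: "integ (b_gen A M N n p 0 f (v, l)) \<phi> = ?H \<phi> v l"
    if \<phi>: "multilinear sA sN \<phi>" and l: "length l = n + 1" for \<phi> v l
  proof -
    obtain a as where [simp]: "l = a # as" "length as = n" using l by (cases l) auto
    have "integ (b_gen A M N n p 0 f (v, l)) \<phi> = integ (rep (iter_comult A p a)) (\<lambda>x xs.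
       integ (rep (f (tclass sA sM n (gen (v, as))))) (\<lambda>v vs. \<phi> (act N x v) (map2 (*) xs vs)))"
      by (simp add: b_gen_def integ_sw)
    also have "\<dots> = integ (rep (iter_comult A p a)) (\<lambda>x xs. F n f (lact (x # xs) \<phi>) v as)"
      by (simp add: hom_pairing_def)
         (intro integ_rep_cong[OF iter_comult_carr] integ_rep_cong[OF Y_value[OF f]], simp_all add: mult_lists_conv)
    also have "\<dots> = D p a (\<lambda>l. F n f (lact l \<phi>) v as)"
      by (rule integ_iter_comult[OF lml[OF \<phi>]])
    finally show ?thesis by simp
  qed
  have c: "b_map A M N n p 0 f \<in> carr (Hom_space (tensor sA sM (n + 1)) (tensor sA sN (p)))"
    unfolding b_map_def by (rule induced_map(1)[where H = ?H]) (fact G H GH)+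
  have eq: "F (n + 1) (b_map A M N n p 0 f) \<phi> m l = ?H \<phi> m l" if "multilinear sA sN \<phi>" "length l = n + 1" for \<phi> m l
    unfolding b_map_def by (rule induced_map(2)[where H = ?H and sW = sN and p = "p"]) (fact G H GH that)+
  show ?c unfolding carr_Y by (rule c)
  show "F (n + 1) (b_map A M N n p 0 f) \<phi> m (a # as) = D p a (\<lambda>l. F n f (lact l \<phi>) m as)"
    if "multilinear sA sN \<phi>" "length as = n" for \<phi> m a as
    using eq[OF that(1), of "a # as" m] that(2) by simp
qed

lemma b_last:
  shows "b_map A M N n p (n + 1) f \<in> carr (Y A M N (n + 1) p)" (is ?c)
    and "\<And>\<phi> m a as. multilinear sA sN \<phi> \<Longrightarrow> length as = n \<Longrightarrow>
      F (n + 1) (b_map A M N n p (n + 1) f) \<phi> m (as @ [a]) =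
      D p a (\<lambda>l. F n f (ract l \<phi>) (act M (last l) m) as)"
proof -
  let ?H' = "\<lambda>\<phi> m a as. D p a (\<lambda>l. F n f (ract l \<phi>) (act M (last l) m) as)"
  let ?H = "\<lambda>\<phi> m as. if as = [] then 0 else ?H' \<phi> m (last as) (butlast as)"
  note lml = list_multilinear_F_ract
  have H: "multilinear sA sM (?H \<phi>)" if "multilinear sA sN \<phi>" for \<phi>
  proof (intro multilinearI list_multilinearI)
    show "klinear sM (*) (\<lambda>v. ?H \<phi> v l)" for l
      by (rule klinear_if) (intro klinear_zero klinear_yd_intros klinear_F[OF f] multilinear_ract that)+
    show "klinear sA (*) (\<lambda>a. ?H \<phi> v (l @ a # r))" for v l r
    proof (cases r rule: rev_cases)
      case Nil
      then show ?thesis by (auto intro!: klinear_D klinear_id lml[OF that])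
    next
      case (snoc r' b)
      then have "(\<lambda>a. ?H \<phi> v (l @ a # r)) = (\<lambda>a. ?H' \<phi> v b (l @ a # r'))"
        by (simp add: butlast_append)
      then show ?thesis
        by (simp only:) (intro klinear_D_fun klinear_F[OF f] multilinear_ract that llinear_intros klinear_id)
    qed
  qed
  have G: "b_gen A M N n p (n + 1) f (v, l) \<in> free_part p" if "length l = n + 1" for v l
    using that
    by (auto simp: b_gen_def intro!: sw_free_part[OF iter_comult_carr] sw_free_part[OF Y_value[OF f]]
      gen_free_part)
  have GH: "integ (b_gen A M N n p (n + 1) f (v, l)) \<phi> = ?H \<phi> v l"
    if \<phi>: "multilinear sA sN \<phi>" and l: "length l = n + 1" for \<phi> v l
  proof -
    obtain a as where [simp]: "l = as @ [a]" "length as = n" using l by (cases l rule: rev_cases) auto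
    have "integ (b_gen A M N n p (n + 1) f (v, l)) \<phi> = integ (rep (iter_comult A p a)) (\<lambda>x xs.
       integ (rep (f (tclass sA sM n (gen (act M (last (x # xs)) v, as)))))
         (\<lambda>v vs. \<phi> v (map2 (*) vs (butlast (x # xs)))))"
      by (simp add: b_gen_def integ_sw)
    also have "\<dots> = integ (rep (iter_comult A p a))
        (\<lambda>x xs. F n f (ract (x # xs) \<phi>) (act M (last (x # xs)) v) as)"
      by (simp add: hom_pairing_def)
         (intro integ_rep_cong[OF iter_comult_carr] integ_rep_cong[OF Y_value[OF f]], simp_all add: mult_lists_conv length_0_conv[symmetric] del: length_0_conv)
    also have "\<dots> = ?H' \<phi> v a as"
      by (rule integ_iter_comult[OF lml[OF \<phi>]])
    finally show ?thesis by simp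
  qed
  have c: "b_map A M N n p (n + 1) f \<in> carr (Hom_space (tensor sA sM (n + 1)) (tensor sA sN (p)))"
    unfolding b_map_def by (rule induced_map(1)[where H = ?H]) (fact G H GH)+
  have eq: "F (n + 1) (b_map A M N n p (n + 1) f) \<phi> m l = ?H \<phi> m l" if "multilinear sA sN \<phi>" "length l = n + 1" for \<phi> m l
    unfolding b_map_def by (rule induced_map(2)[where H = ?H and sW = sN and p = "p"]) (fact G H GH that)+
  show ?c unfolding carr_Y by (rule c)
  show "F (n + 1) (b_map A M N n p (n + 1) f) \<phi> m (as @ [a]) = ?H' \<phi> m a as"
    if "multilinear sA sN \<phi>" "length as = n" for \<phi> m a as
    using eq[OF that(1), of "as @ [a]" m] that(2) by simp
qed

end

text \<open>The transpose of the inner map b with index j + 1. Recursion on the position, with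
  default 0 on lists that are too short, keeps it multilinear on all lists.\<close>

primrec mult_at :: "nat \<Rightarrow> ('a list \<Rightarrow> 'k) \<Rightarrow> 'a list \<Rightarrow> 'k" where
  "mult_at 0 \<psi> l = (case l of [] \<Rightarrow> 0 | a # l' \<Rightarrow> (case l' of [] \<Rightarrow> 0 | b # r \<Rightarrow> \<psi> (a * b # r)))"
| "mult_at (Suc j) \<psi> l = (case l of [] \<Rightarrow> 0 | a # r \<Rightarrow> mult_at j (\<lambda>r. \<psi> (a # r)) r)"

lemma mult_at_append: "mult_at (length l) \<psi> (l @ a # b # r) = \<psi> (l @ a * b # r)"
  by (induction l arbitrary: \<psi>) simp_all

lemma klinear_mult_at_fun: "(\<And>l. klinear s (*) (\<lambda>x. \<psi> x l)) \<Longrightarrow> klinear s (*) (\<lambda>x. mult_at j (\<psi> x) l)"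
proof (induction j arbitrary: l \<psi>)
  case 0
  then show ?case by (cases l; cases "tl l") (auto intro: klinear_zero)
next
  case (Suc j)
  then show ?case by (cases l) (auto intro: klinear_zero)
qed

lemma list_multilinear_mult_at:
  assumes "list_multilinear sA \<psi>"
  shows "list_multilinear sA (mult_at j \<psi>)"
proof (rule list_multilinearI)
  fix l r
  show "klinear sA (*) (\<lambda>a. mult_at j \<psi> (l @ a # r))"
    using assms
  proof (induction j arbitrary: l \<psi>)
    case 0
    note k = klinear_list_multilinear[OF 0]
    show ?case
    proof (cases l)
      case Nil
      then show ?thesis by (cases r) (auto intro!: klinear_zero k klinear_yd_intros)
    next
      case (Cons b l')
      then show ?thesis by (cases l') (auto intro!: klinear_zero k klinear_yd_intros)
    qed
  next
    case (Suc j)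
    show ?case
    proof (cases l)
      case Nil
      then show ?thesis
        by (auto intro!: klinear_mult_at_fun klinear_list_multilinear[OF Suc.prems] llinear_intros klinear_id)
    next
      case (Cons b l')
      then show ?thesis by (simp add: Suc.IH list_multilinear_Cons Suc.prems)
    qed
  qed
qed

text \<open>The last fact counts the list after the pair has been merged into one entry; x is only a
  placeholder for that entry.\<close>

lemma split_at_pair:
  assumes "length l = n + 1" "j < n"
  obtains l1 a b l2 where "l = l1 @ a # b # l2" "length l1 = j" "length (l1 @ x # l2) = n"
proof -
  have "l = take j l @ l ! j # l ! Suc j # drop (Suc (Suc j)) l"
    using assms by (metis Cons_nth_drop_Suc Suc_eq_plus1 Suc_less_eq append_take_drop_id less_SucI)
  then show ?thesis using that assms by force
qed

lemma b_middle:
  assumes f: "f \<in> carr (Y A M N n p)" and j: "j < n"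
  shows "b_map A M N n p (Suc j) f \<in> carr (Y A M N (n + 1) p)" (is ?c)
    and "\<And>\<phi> m a b l1 l2. multilinear sA sN \<phi> \<Longrightarrow> length l1 = j \<Longrightarrow> length l1 + length l2 + 1 = n \<Longrightarrow>
      F (n + 1) (b_map A M N n p (Suc j) f) \<phi> m (l1 @ a # b # l2) = F n f \<phi> m (l1 @ a * b # l2)"
proof -
  let ?H = "\<lambda>\<phi> m. mult_at j (F n f \<phi> m)"
  have H: "multilinear sA sM (?H \<phi>)" if "multilinear sA sN \<phi>" for \<phi>
    using multilinear_F[OF f that]
    by (auto simp: multilinear_def intro!: klinear_mult_at_fun list_multilinear_mult_at)
  have gen: "b_gen A M N n p (Suc j) f (v, l1 @ a # b # l2) =
      rep (f (tclass sA sM n (gen (v, l1 @ a * b # l2))))" if "length l1 = j" for v l1 l2 a b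
    using j that by (auto simp: b_gen_def nth_append)
  have G: "b_gen A M N n p (Suc j) f (v, l) \<in> free_part p" if l: "length l = n + 1" for v l
  proof -
    obtain l1 a b l2 where "l = l1 @ a # b # l2" "length l1 = j" "length (l1 @ undefined # l2) = n"
      by (rule split_at_pair[OF l j])
    then show ?thesis
      using rep_carr(1)[OF Y_value[OF f, of "l1 @ a * b # l2" v]] by (simp add: gen)
  qed
  have GH: "integ (b_gen A M N n p (Suc j) f (v, l)) \<phi> = ?H \<phi> v l"
    if \<phi>: "multilinear sA sN \<phi>" and l: "length l = n + 1" for \<phi> v l
  proof -
    obtain l1 a b l2 where l: "l = l1 @ a # b # l2" "length l1 = j" "length (l1 @ undefined # l2) = n"
      by (rule split_at_pair[OF l j])
    then show ?thesis
      using mult_at_append[of l1 "F n f \<phi> v" a b l2] by (simp add: gen hom_pairing_def)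
  qed
  have c: "b_map A M N n p (Suc j) f \<in> carr (Hom_space (tensor sA sM (n + 1)) (tensor sA sN (p)))"
    unfolding b_map_def by (rule induced_map(1)[where H = ?H]) (fact G H GH)+
  have eq: "F (n + 1) (b_map A M N n p (Suc j) f) \<phi> m l = ?H \<phi> m l" if "multilinear sA sN \<phi>" "length l = n + 1" for \<phi> m l
    unfolding b_map_def by (rule induced_map(2)[where H = ?H and sW = sN and p = "p"]) (fact G H GH that)+
  show ?c unfolding carr_Y by (rule c)
  show "F (n + 1) (b_map A M N n p (Suc j) f) \<phi> m (l1 @ a # b # l2) = F n f \<phi> m (l1 @ a * b # l2)"
    if "multilinear sA sN \<phi>" "length l1 = j" "length l1 + length l2 + 1 = n" for \<phi> m l1 a b l2
    using eq[OF that(1), of "l1 @ a # b # l2" m] mult_at_append[of l1 "F n f \<phi> m" a b l2] that(2,3)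
    by simp
qed

section \<open>The maps c on functionals\<close>

lemma comult_at_conv:
  "j < length l \<Longrightarrow> comult_at j \<psi> l =
    integ (rep (comult A (l ! j))) (\<lambda>x y. \<psi> (take j l @ x # y @ drop (Suc j) l))"
proof (induction j arbitrary: l \<psi>)
  case 0
  then obtain a r where "l = a # r" by (cases l) auto
  then show ?case
    by (simp add: integ1_def) (rule integ_rep_cong[OF comult_carr], auto simp: length_Suc_conv)
next
  case (Suc j)
  then show ?case by (cases l) auto
qed

text \<open>The coefficient of a pair of lists is the integral of its indicator function, hence a
  sum \<open>L\<close>. As \<open>L\<close> only sees lists of the right length, a wrong pair makes
  the indicator vanish there, and its coefficient is 0.\<close>

lemma list_comult_length:
  "(s, t) \<in> Poly_Mapping.keys (list_comult A as) \<Longrightarrow> length s = length as \<and> length t = length as"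
proof -
  have *: "Poly_Mapping.lookup (list_comult A as) (s, t) =
    integ (list_comult A as) (\<lambda>s' t'. if s' = s \<and> t' = t then 1 else 0)"
  proof -
    have "(fst g = s \<and> snd g = t) \<longleftrightarrow> g = (s, t)" for g :: "'a list \<times> 'a list"
      by (auto simp: prod_eq_iff)
    then show ?thesis
      by (simp add: integ_def lin_ext_def if_distrib sum.delta in_keys_iff cong: if_cong)
  qed
  assume k: "(s, t) \<in> Poly_Mapping.keys (list_comult A as)"
  show ?thesis
  proof (rule ccontr)
    assume "\<not> ?thesis"
    then have "integ (list_comult A as) (\<lambda>s' t'. if s' = s \<and> t' = t then 1 else 0) = 0"
      unfolding integ_list_comult
      by (subst L_cong[where \<psi>' = "\<lambda>_ _. 0"]) (auto simp: integ_list_comult[symmetric])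
    then show False using k * by (simp add: in_keys_iff)
  qed
qed

lemma list_comult_free_part:
  assumes "\<And>s t. length s = length as \<Longrightarrow> length t = length as \<Longrightarrow> \<psi> (s, t) \<in> free_part n"
  shows "lin_ext fscale (list_comult A as) \<psi> \<in> free_part n"
  by (rule lin_ext_free_part) (use assms list_comult_length in auto)

context
  fixes n p f assumes f: "f \<in> carr (Y A M N n p)"
begin

lemma c_first:
  shows "c_map A M N n p 0 f \<in> carr (Y A M N n (p + 1))" (is ?c)
    and "\<And>\<phi> m as. multilinear sA sN \<phi> \<Longrightarrow> length as = n \<Longrightarrow>
      F n (c_map A M N n p 0 f) \<phi> m as = L as (\<lambda>s t. F n f (lcoact s \<phi>) m t)"
proof -
  let ?H = "\<lambda>\<phi> m as. L as (\<lambda>s t. F n f (lcoact s \<phi>) m t)"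
  have H: "multilinear sA sM (?H \<phi>)" if "multilinear sA sN \<phi>" for \<phi>
    by (rule multilinearI) (intro k\<phi>[OF that] klinear_yd_intros klinear_F[OF f] multilinear_lcoact that)+
  have G: "c_gen A M N n p 0 f (v, l) \<in> free_part (p + 1)" if "length l = n" for v l
    by (simp add: c_gen_def that list_comult_free_part sw_free_part[OF N.coact_carr]
      sw_free_part[OF Y_value[OF f]] gen_free_part)
  have GH: "integ (c_gen A M N n p 0 f (v, l)) \<phi> = ?H \<phi> v l"
    if \<phi>: "multilinear sA sN \<phi>" and l: "length l = n" for \<phi> v l
  proof -
    have "integ (c_gen A M N n p 0 f (v, l)) \<phi> = L l (\<lambda>s t.
       integ (rep (f (tclass sA sM n (gen (v, t))))) (lcoact s \<phi>))"
      by (simp add: c_gen_def integ_sw integ_lin_ext integ_list_comult integ1_def)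
    also have "\<dots> = ?H \<phi> v l"
      by (rule L_cong) (simp add: hom_pairing_def l)
    finally show ?thesis .
  qed
  have c: "c_map A M N n p 0 f \<in> carr (Hom_space (tensor sA sM (n)) (tensor sA sN (p + 1)))"
    unfolding c_map_def by (rule induced_map(1)[where H = ?H]) (fact G H GH)+
  have eq: "F n (c_map A M N n p 0 f) \<phi> m l = ?H \<phi> m l" if "multilinear sA sN \<phi>" "length l = n" for \<phi> m l
    unfolding c_map_def by (rule induced_map(2)[where H = ?H and sW = sN and p = "p + 1"]) (fact G H GH that)+
  show ?c unfolding carr_Y by (rule c)
  show "F n (c_map A M N n p 0 f) \<phi> m as = ?H \<phi> m as"
    if "multilinear sA sN \<phi>" "length as = n" for \<phi> m as
    using eq[OF that, of m] .
qed

lemma c_last: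
  shows "c_map A M N n p (p + 1) f \<in> carr (Y A M N n (p + 1))" (is ?c)
    and "\<And>\<phi> m as. multilinear sA sN \<phi> \<Longrightarrow> length as = n \<Longrightarrow>
      F n (c_map A M N n p (p + 1) f) \<phi> m as =
      L as (\<lambda>s t. M.Rho m (\<lambda>x y. F n f (rcoact t y \<phi>) x s))"
proof -
  let ?H = "\<lambda>\<phi> m as. L as (\<lambda>s t. M.Rho m (\<lambda>x y. F n f (rcoact t y \<phi>) x s))"
  have H: "multilinear sA sM (?H \<phi>)" if "multilinear sA sN \<phi>" for \<phi>
    by (rule multilinearI) (intro k\<phi>[OF that] klinear_yd_intros klinear_F[OF f] multilinear_rcoact that)+
  have G: "c_gen A M N n p (p + 1) f (v, l) \<in> free_part (p + 1)" if "length l = n" for v l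
    by (simp add: c_gen_def that list_comult_free_part sw_free_part[OF M.coact_carr]
      sw_free_part[OF Y_value[OF f]] gen_free_part)
  have GH: "integ (c_gen A M N n p (p + 1) f (v, l)) \<phi> = ?H \<phi> v l"
    if \<phi>: "multilinear sA sN \<phi>" and l: "length l = n" for \<phi> v l
  proof -
    have "integ (c_gen A M N n p (p + 1) f (v, l)) \<phi> = L l (\<lambda>s t. M.Rho v (\<lambda>x y.
       integ (rep (f (tclass sA sM n (gen (x, s))))) (rcoact t y \<phi>)))"
      by (simp add: c_gen_def integ_sw integ_lin_ext integ_list_comult integ1_def)
    also have "\<dots> = ?H \<phi> v l"
      by (rule L_cong) (simp add: hom_pairing_def l)
    finally show ?thesis .
  qed
  have c: "c_map A M N n p (p + 1) f \<in> carr (Hom_space (tensor sA sM (n)) (tensor sA sN (p + 1)))"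
    unfolding c_map_def by (rule induced_map(1)[where H = ?H]) (fact G H GH)+
  have eq: "F n (c_map A M N n p (p + 1) f) \<phi> m l = ?H \<phi> m l" if "multilinear sA sN \<phi>" "length l = n" for \<phi> m l
    unfolding c_map_def by (rule induced_map(2)[where H = ?H and sW = sN and p = "p + 1"]) (fact G H GH that)+
  show ?c unfolding carr_Y by (rule c)
  show "F n (c_map A M N n p (p + 1) f) \<phi> m as = ?H \<phi> m as"
    if "multilinear sA sN \<phi>" "length as = n" for \<phi> m as
    using eq[OF that, of m] .
qed

lemma c_middle:
  assumes j: "j < p"
  shows "c_map A M N n p (Suc j) f \<in> carr (Y A M N n (p + 1))" (is ?c)
    and "\<And>\<phi> m as. multilinear sA sN \<phi> \<Longrightarrow> length as = n \<Longrightarrow>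
      F n (c_map A M N n p (Suc j) f) \<phi> m as = F n f (\<lambda>v. comult_at j (\<phi> v)) m as"
proof -
  let ?H = "\<lambda>\<phi>. F n f (\<lambda>v. comult_at j (\<phi> v))"
  have H: "multilinear sA sM (?H \<phi>)" if "multilinear sA sN \<phi>" for \<phi>
    by (intro multilinear_F[OF f] multilinear_comult_at that)
  have G: "c_gen A M N n p (Suc j) f (v, l) \<in> free_part (p + 1)" if "length l = n" for v l
    using j by (simp add: c_gen_def that sw_free_part[OF comult_carr]
      sw_free_part[OF Y_value[OF f]] gen_free_part)
  have GH: "integ (c_gen A M N n p (Suc j) f (v, l)) \<phi> = ?H \<phi> v l"
    if \<phi>: "multilinear sA sN \<phi>" and l: "length l = n" for \<phi> v l
    using j by (simp add: c_gen_def integ_sw hom_pairing_def l)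
      (rule integ_rep_cong[OF Y_value[OF f l]], simp add: comult_at_conv)
  have c: "c_map A M N n p (Suc j) f \<in> carr (Hom_space (tensor sA sM (n)) (tensor sA sN (p + 1)))"
    unfolding c_map_def by (rule induced_map(1)[where H = ?H]) (fact G H GH)+
  have eq: "F n (c_map A M N n p (Suc j) f) \<phi> m l = ?H \<phi> m l" if "multilinear sA sN \<phi>" "length l = n" for \<phi> m l
    unfolding c_map_def by (rule induced_map(2)[where H = ?H and sW = sN and p = "p + 1"]) (fact G H GH that)+
  show ?c unfolding carr_Y by (rule c)
  show "F n (c_map A M N n p (Suc j) f) \<phi> m as = ?H \<phi> m as"
    if "multilinear sA sN \<phi>" "length as = n" for \<phi> m as
    using eq[OF that, of m] .
qed

end

end

context yd_pair
begin

section \<open>The cosimplicial identities\<close>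

lemma b_first_eq: "\<lbrakk>f \<in> carr (Y A M N n p); multilinear sA sN \<phi>; length as = n\<rbrakk> \<Longrightarrow>
    F (Suc n) (b_map A M N n p 0 f) \<phi> m (a # as) = D p a (\<lambda>l. F n f (lact l \<phi>) m as)"
  using b_first(2)[of f n p] by simp

lemma b_last_eq: "\<lbrakk>f \<in> carr (Y A M N n p); multilinear sA sN \<phi>; length as = n\<rbrakk> \<Longrightarrow>
    F (Suc n) (b_map A M N n p (Suc n) f) \<phi> m (as @ [a]) =
    D p a (\<lambda>l. F n f (ract l \<phi>) (act M (last l) m) as)"
  using b_last(2)[of f n p] by simp

lemma b_middle_eq: "\<lbrakk>f \<in> carr (Y A M N n p); multilinear sA sN \<phi>; length l1 = j; Suc (j + length l2) = n\<rbrakk> \<Longrightarrow>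
    F (Suc n) (b_map A M N n p (Suc j) f) \<phi> m (l1 @ a # b # l2) = F n f \<phi> m (l1 @ a * b # l2)"
  using b_middle(2)[of f n p j] by simp

lemma b_carr: "\<lbrakk>f \<in> carr (Y A M N n p); i \<le> Suc n\<rbrakk> \<Longrightarrow> b_map A M N n p i f \<in> carr (Y A M N (Suc n) p)"
  using b_first(1)[of f n p] b_last(1)[of f n p] b_middle(1)[of f n p "i - 1"]
  by (cases i) (auto simp: le_less)

lemma c_first_eq: "\<lbrakk>f \<in> carr (Y A M N n p); multilinear sA sN \<phi>; length as = n\<rbrakk> \<Longrightarrow>
    F n (c_map A M N n p 0 f) \<phi> m as = L as (\<lambda>s t. F n f (lcoact s \<phi>) m t)"
  using c_first(2)[of f n p] by simp

lemma c_last_eq: "\<lbrakk>f \<in> carr (Y A M N n p); multilinear sA sN \<phi>; length as = n\<rbrakk> \<Longrightarrow>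
    F n (c_map A M N n p (Suc p) f) \<phi> m as =
    L as (\<lambda>s t. M.Rho m (\<lambda>x y. F n f (rcoact t y \<phi>) x s))"
  using c_last(2)[of f n p] by simp

lemma c_middle_eq: "\<lbrakk>f \<in> carr (Y A M N n p); multilinear sA sN \<phi>; length as = n; j < p\<rbrakk> \<Longrightarrow>
    F n (c_map A M N n p (Suc j) f) \<phi> m as = F n f (\<lambda>v. comult_at j (\<phi> v)) m as"
  using c_middle(2)[of f n p j] by simp

lemma c_carr: "\<lbrakk>f \<in> carr (Y A M N n p); i \<le> Suc p\<rbrakk> \<Longrightarrow> c_map A M N n p i f \<in> carr (Y A M N n (Suc p))"
  using c_first(1)[of f n p] c_last(1)[of f n p] c_middle(1)[of f n p "i - 1"]
  by (cases i) (auto simp: le_less)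

context
  fixes n p f \<phi>
  assumes f: "f \<in> carr (Y A M N n p)" and \<phi>: "multilinear sA sN \<phi>"
begin

lemmas ml = \<phi> multilinear_lact[OF \<phi>] multilinear_ract[OF \<phi>] multilinear_lcoact[OF \<phi>]
  multilinear_rcoact[OF \<phi>] multilinear_comult_at[OF \<phi>]

lemmas all_intros = k\<phi>[OF \<phi>] klinear_yd_intros klinear_F[OF f]

subsection \<open>The maps b\<close>

text \<open>\<open>b_1\<close> merges a and b before \<open>b_0\<close> comultiplies the product. By
  \<open>D_mult\<close> this gives components of a and of b separately, and associativity turns the
  joint action into two successive ones.\<close>

lemma bb_first:
  assumes "length as = n"
  shows "F (Suc (Suc n)) (b_map A M N (Suc n) p (Suc 0) (b_map A M N n p 0 f)) \<phi> m (a # b # as) =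
    F (Suc (Suc n)) (b_map A M N (Suc n) p 0 (b_map A M N n p 0 f)) \<phi> m (a # b # as)"
proof -
  have f0: "b_map A M N n p 0 f \<in> carr (Y A M N (Suc n) p)" by (rule b_carr[OF f]) simp
  have "F (Suc (Suc n)) (b_map A M N (Suc n) p (Suc 0) (b_map A M N n p 0 f)) \<phi> m (a # b # as) =
      D p (a * b) (\<lambda>l. F n f (lact l \<phi>) m as)"
    using b_middle_eq[OF f0 \<phi>, of "[]" 0 "as" m a b] assms by (simp add: b_first_eq[OF f \<phi>])
  also have "\<dots> = D p a (\<lambda>l. D p b (mult_lists (\<lambda>l. F n f (lact l \<phi>) m as) l))"
    by (rule D_mult[OF list_multilinear_F_lact[OF f \<phi>]])
  also have "\<dots> = D p a (\<lambda>l. D p b (\<lambda>l'. F n f (lact l' (lact l \<phi>)) m as))"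
  proof (intro D_cong)
    fix l l' :: "'a list" assume "length l = Suc p" "length l' = Suc p"
    then obtain x xs y ys where l: "l = x # xs" "l' = y # ys" "length xs = length ys"
      by (auto simp: length_Suc_conv)
    have "mult_lists \<psi> (map2 (*) xs ys) = mult_lists (mult_lists \<psi> xs) ys" for \<psi> :: "'a list \<Rightarrow> 'k"
      using mult_lists_mult_lists[of \<psi> _ xs ys] l(3) by (intro ext) (simp add: mult_lists_conv)
    then show "mult_lists (\<lambda>l. F n f (lact l \<phi>) m as) l l' = F n f (lact l' (lact l \<phi>)) m as"
      using l by (simp add: mult_lists_conv[of _ xs ys] mult_lists_conv[of _ "_ # xs" "_ # ys"] N.act_mult)
  qed
  also have "\<dots> = F (Suc (Suc n)) (b_map A M N (Suc n) p 0 (b_map A M N n p 0 f)) \<phi> m (a # b # as)"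
    using assms by (simp add: b_first_eq[OF f0 \<phi>] b_first_eq[OF f] ml)
  finally show ?thesis .
qed

text \<open>The mirror image of \<open>bb_first\<close>. Here b acts on m before a does, so the sums
  over the components of a and b come out in the opposite order and are interchanged by
  \<open>D_D\<close>.\<close>

lemma bb_last:
  assumes "length as = n"
  shows "F (Suc (Suc n)) (b_map A M N (Suc n) p (Suc (Suc n)) (b_map A M N n p (Suc n) f)) \<phi> m (as @ [a, b]) =
    F (Suc (Suc n)) (b_map A M N (Suc n) p (Suc n) (b_map A M N n p (Suc n) f)) \<phi> m (as @ [a, b])"
proof -
  have f0: "b_map A M N n p (Suc n) f \<in> carr (Y A M N (Suc n) p)" by (rule b_carr[OF f]) simp
  have "F (Suc (Suc n)) (b_map A M N (Suc n) p (Suc n) (b_map A M N n p (Suc n) f)) \<phi> m (as @ [a, b]) =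
      D p (a * b) (\<lambda>l. F n f (ract l \<phi>) (act M (last l) m) as)"
    using b_middle_eq[OF f0 \<phi>, of as n "[]" m a b] assms by (simp add: b_last_eq[OF f \<phi>])
  also have "\<dots> = D p a (\<lambda>l. D p b (mult_lists (\<lambda>l. F n f (ract l \<phi>) (act M (last l) m) as) l))"
    by (rule D_mult[OF list_multilinear_F_ract[OF f \<phi>]])
  also have "\<dots> = D p a (\<lambda>l. D p b (\<lambda>l'. F n f (ract l (ract l' \<phi>)) (act M (last l) (act M (last l') m)) as))"
  proof (intro D_cong)
    fix l l' :: "'a list" assume "length l = Suc p" "length l' = Suc p"
    then obtain x xs y ys where l: "l = xs @ [x]" "l' = ys @ [y]" "length xs = length ys"
      by (cases l rule: rev_cases; cases l' rule: rev_cases) auto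
    have "mult_lists \<psi> vs (map2 (*) xs ys) = mult_lists (\<lambda>l. mult_lists \<psi> l ys) vs xs" for \<psi> :: "'a list \<Rightarrow> 'k" and vs
      using mult_lists_mult_lists[of \<psi> ys vs xs] l(3) by (simp add: mult_lists_conv[of _ xs ys])
    then show "mult_lists (\<lambda>l. F n f (ract l \<phi>) (act M (last l) m) as) l l' =
        F n f (ract l (ract l' \<phi>)) (act M (last l) (act M (last l') m)) as"
      using l by (simp add: mult_lists_conv[of _ "xs @ _" "ys @ _"] M.act_mult)
  qed
  also have "\<dots> = F (Suc (Suc n)) (b_map A M N (Suc n) p (Suc (Suc n)) (b_map A M N n p (Suc n) f)) \<phi> m (as @ [a, b])"
    using assms b_last_eq[OF f0 \<phi>, of "as @ [a]" m b] by (simp add: b_last_eq[OF f] ml D_D[of p a])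
  finally show ?thesis ..
qed

text \<open>Left and right multiplication on the factors A commute, by associativity; the actions on
  N and on M do not meet.\<close>

lemma bb_first_last:
  assumes "length as = n"
  shows "F (Suc (Suc n)) (b_map A M N (Suc n) p (Suc (Suc n)) (b_map A M N n p 0 f)) \<phi> m (a # as @ [b]) =
    F (Suc (Suc n)) (b_map A M N (Suc n) p 0 (b_map A M N n p (Suc n) f)) \<phi> m (a # as @ [b])"
proof -
  have f0: "b_map A M N n p 0 f \<in> carr (Y A M N (Suc n) p)" by (rule b_carr[OF f]) simp
  have f1: "b_map A M N n p (Suc n) f \<in> carr (Y A M N (Suc n) p)" by (rule b_carr[OF f]) simp
  have "F (Suc (Suc n)) (b_map A M N (Suc n) p (Suc (Suc n)) (b_map A M N n p 0 f)) \<phi> m (a # as @ [b]) =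
      D p b (\<lambda>l'. D p a (\<lambda>l. F n f (lact l (ract l' \<phi>)) (act M (last l') m) as))"
    using assms b_last_eq[OF f0 \<phi>, of "a # as" m b] by (simp add: b_first_eq[OF f] ml)
  also have "\<dots> = D p a (\<lambda>l. D p b (\<lambda>l'. F n f (ract l' (lact l \<phi>)) (act M (last l') m) as))"
    by (subst D_D) (simp add: mult_lists_mult_lists[abs_def])
  also have "\<dots> = F (Suc (Suc n)) (b_map A M N (Suc n) p 0 (b_map A M N n p (Suc n) f)) \<phi> m (a # as @ [b])"
    using assms b_first_eq[OF f1 \<phi>, of "as @ [b]" m a] by (simp add: b_last_eq[OF f] ml)
  finally show ?thesis .
qed

lemma bb_first_middle:
  assumes "length l1 = j" "Suc (j + length l2) = n"
  shows "F (Suc (Suc n)) (b_map A M N (Suc n) p (Suc (Suc j)) (b_map A M N n p 0 f)) \<phi> m (a # l1 @ b # c # l2) =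
    F (Suc (Suc n)) (b_map A M N (Suc n) p 0 (b_map A M N n p (Suc j) f)) \<phi> m (a # l1 @ b # c # l2)"
proof -
  have f0: "b_map A M N n p 0 f \<in> carr (Y A M N (Suc n) p)" by (rule b_carr[OF f]) simp
  have f1: "b_map A M N n p (Suc j) f \<in> carr (Y A M N (Suc n) p)" by (rule b_carr[OF f]) (use assms in simp)
  show ?thesis
    using assms b_middle_eq[OF f0 \<phi>, of "a # l1" "Suc j" l2 m b c]
    by (simp add: b_first_eq[OF f] b_first_eq[OF f1] b_middle_eq[OF f] ml)
qed

lemma bb_middle_last:
  assumes "length l1 = j" "Suc (j + length l2) = n"
  shows "F (Suc (Suc n)) (b_map A M N (Suc n) p (Suc (Suc n)) (b_map A M N n p (Suc j) f)) \<phi> m (l1 @ b # c # l2 @ [a]) =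
    F (Suc (Suc n)) (b_map A M N (Suc n) p (Suc j) (b_map A M N n p (Suc n) f)) \<phi> m (l1 @ b # c # l2 @ [a])"
proof -
  have f0: "b_map A M N n p (Suc n) f \<in> carr (Y A M N (Suc n) p)" by (rule b_carr[OF f]) simp
  have f1: "b_map A M N n p (Suc j) f \<in> carr (Y A M N (Suc n) p)" by (rule b_carr[OF f]) (use assms in simp)
  show ?thesis
    using assms b_middle_eq[OF f0 \<phi>, of l1 j "l2 @ [a]" m b c] b_last_eq[OF f1 \<phi>, of "l1 @ b # c # l2" m a]
      b_last_eq[OF f \<phi>, of "l1 @ b * c # l2" m a]
    by (simp add: b_middle_eq[OF f] ml)
qed

text \<open>For j = i + 1 the two merges overlap in three neighbouring entries and associativity of
  A decides; otherwise they concern disjoint pairs.\<close>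

lemma bb_middle:
  assumes "length as = Suc (Suc n)" "i < j" "j \<le> n"
  shows "F (Suc (Suc n)) (b_map A M N (Suc n) p (Suc j) (b_map A M N n p (Suc i) f)) \<phi> m as =
    F (Suc (Suc n)) (b_map A M N (Suc n) p (Suc i) (b_map A M N n p j f)) \<phi> m as"
proof -
  have f0: "b_map A M N n p (Suc i) f \<in> carr (Y A M N (Suc n) p)" by (rule b_carr[OF f]) (use assms in simp)
  have f1: "b_map A M N n p j f \<in> carr (Y A M N (Suc n) p)" by (rule b_carr[OF f]) (use assms in simp)
  define l1 where "l1 = take i as"
  obtain a b r where as: "as = l1 @ a # b # r" and l1: "length l1 = i"
    by (rule split_at_pair[of as "Suc n" i]) (use assms in \<open>auto simp: l1_def\<close>)
  show ?thesis
  proof (cases "j = Suc i")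
    case True
    then obtain c l2 where r: "r = c # l2" using assms as l1 by (cases r) auto
    show ?thesis
      using assms l1 True b_middle_eq[OF f0 \<phi>, of "l1 @ [a]" j l2 m b c] b_middle_eq[OF f1 \<phi>, of l1 i "c # l2" m a b]
      by (simp add: as r b_middle_eq[OF f] \<phi> mult.assoc)
  next
    case False
    \<comment> \<open>j' is the position of the second pair inside r, which starts at index i +
      2.\<close>
    then obtain j' where j': "j = Suc (Suc (i + j'))" using assms by (metis Suc_leI le_Suc_ex add_Suc less_le_not_le nat_less_le)
    obtain l2 c d l3 where r: "r = l2 @ c # d # l3" and l2: "length l2 = j'"
      by (rule split_at_pair[of r "length r - 1" j']) (use assms as l1 j' in auto)
    show ?thesis
      using assms l1 l2 j' b_middle_eq[OF f0 \<phi>, of "l1 @ a # b # l2" j l3 m c d]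
        b_middle_eq[OF f1 \<phi>, of l1 i "l2 @ c # d # l3" m a b]
        b_middle_eq[OF f \<phi>, of "l1 @ a * b # l2" "Suc (i + j')" l3 m c d]
      by (simp add: as r b_middle_eq[OF f] \<phi>)
  qed
qed

subsection \<open>The maps c\<close>

text \<open>\<open>c_1\<close> comultiplies the entry in which \<open>c_0\<close> multiplied a
  coaction component by the product of s. Multiplicativity separates the two; the comultiplied
  coaction component is a second coaction by the comodule axiom of N, and \<open>L_coassoc\<close>
  moves the second comultiplication from s to t.\<close>

lemma cc_first:
  assumes "length as = n"
  shows "F n (c_map A M N n (Suc p) (Suc 0) (c_map A M N n p 0 f)) \<phi> m as =
    F n (c_map A M N n (Suc p) 0 (c_map A M N n p 0 f)) \<phi> m as"
proof -
  have f0: "c_map A M N n p 0 f \<in> carr (Y A M N n (Suc p))" by (rule c_carr[OF f]) simp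
  let ?\<Phi> = "\<lambda>s1 s2 v vs. N.Rho v (\<lambda>v0 w. N.Rho v0 (\<lambda>u z. \<phi> u (z * prod_list s1 # w * prod_list s2 # vs)))"
  have "lcoact s (\<lambda>v. comult_at 0 (\<phi> v)) v vs = L s (\<lambda>s1 s2. ?\<Phi> s1 s2 v vs)" for s v vs
  proof -
    have "Delta (z * prod_list s) (\<lambda>x y. \<phi> u (x # y # vs)) =
        Delta z (\<lambda>x y. L s (\<lambda>s1 s2. \<phi> u (x * prod_list s1 # y * prod_list s2 # vs)))" for z u
      by (subst Delta_mult, (intro all_intros)+, subst Delta_prod_list) (intro all_intros refl)+
    then have "lcoact s (\<lambda>v. comult_at 0 (\<phi> v)) v vs = N.Rho v (\<lambda>v0 v1. Delta v1 (\<lambda>x y.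
        L s (\<lambda>s1 s2. \<phi> v0 (x * prod_list s1 # y * prod_list s2 # vs))))"
      by simp
    also have "\<dots> = N.Rho v (\<lambda>v0 w. N.Rho v0 (\<lambda>u z.
        L s (\<lambda>s1 s2. \<phi> u (z * prod_list s1 # w * prod_list s2 # vs))))"
      by (rule N.Rho_coassoc[symmetric]) (intro all_intros)+
    finally show ?thesis by (simp add: L_integ1)
  qed
  then have "F n (c_map A M N n (Suc p) (Suc 0) (c_map A M N n p 0 f)) \<phi> m as =
      L as (\<lambda>s t. L s (\<lambda>s1 s2. F n f (?\<Phi> s1 s2) m t))"
    using assms by (simp add: c_middle_eq[OF f0] c_first_eq[OF f] ml F_L del: comult_at.simps)
  also have "\<dots> = L as (\<lambda>s t. L t (\<lambda>t1 t2. F n f (?\<Phi> s t1) m t2))"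
    by (rule L_coassoc) (intro all_intros)+
  also have "\<dots> = F n (c_map A M N n (Suc p) 0 (c_map A M N n p 0 f)) \<phi> m as"
    using assms by (simp add: c_first_eq[OF f0] c_first_eq[OF f] ml cong: L_cong)
  finally show ?thesis .
qed

lemma cc_first_middle:
  assumes "length as = n" "j < p"
  shows "F n (c_map A M N n (Suc p) (Suc (Suc j)) (c_map A M N n p 0 f)) \<phi> m as =
    F n (c_map A M N n (Suc p) 0 (c_map A M N n p (Suc j) f)) \<phi> m as"
proof -
  have f0: "c_map A M N n p 0 f \<in> carr (Y A M N n (Suc p))" by (rule c_carr[OF f]) simp
  have f1: "c_map A M N n p (Suc j) f \<in> carr (Y A M N n (Suc p))" by (rule c_carr[OF f]) (use assms in simp)
  have "comult_at j (lcoact s \<phi> v) = (\<lambda>vs. N.Rho v (\<lambda>x y. comult_at j (\<lambda>r. \<phi> x ((y * prod_list s) # r)) vs))" for s v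
    by (intro ext) (simp add: comult_at_integ1)
  then show ?thesis
    using assms by (simp add: c_middle_eq[OF f0] c_middle_eq[OF f] c_first_eq[OF f] c_first_eq[OF f1] ml cong: L_cong)
qed

text \<open>Of three components of each entry, the first goes to the front, the last to the back and
  the middle one into f; the two sides differ only in how the three components are formed.\<close>

lemma cc_first_last:
  assumes "length as = n"
  shows "F n (c_map A M N n (Suc p) (Suc (Suc p)) (c_map A M N n p 0 f)) \<phi> m as =
    F n (c_map A M N n (Suc p) 0 (c_map A M N n p (Suc p) f)) \<phi> m as"
proof -
  have f0: "c_map A M N n p 0 f \<in> carr (Y A M N n (Suc p))" by (rule c_carr[OF f]) simp
  have f1: "c_map A M N n p (Suc p) f \<in> carr (Y A M N n (Suc p))" by (rule c_carr[OF f]) simp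
  have "F n (c_map A M N n (Suc p) (Suc (Suc p)) (c_map A M N n p 0 f)) \<phi> m as =
      L as (\<lambda>s t. L s (\<lambda>s1 s2. M.Rho m (\<lambda>x y. F n f (lcoact s1 (rcoact t y \<phi>)) x s2)))"
    using assms by (simp add: c_last_eq[OF f0] c_first_eq[OF f] ml L_integ1 cong: L_cong)
  also have "\<dots> = L as (\<lambda>s t. L t (\<lambda>t1 t2. M.Rho m (\<lambda>x y. F n f (lcoact s (rcoact t2 y \<phi>)) x t1)))"
    by (rule L_coassoc) (intro all_intros multilinear_lcoact ml)+
  also have "\<dots> = F n (c_map A M N n (Suc p) 0 (c_map A M N n p (Suc p) f)) \<phi> m as"
    using assms by (simp add: c_first_eq[OF f1] c_last_eq[OF f] ml cong: L_cong)
  finally show ?thesis .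
qed

lemma cc_middle:
  assumes "length as = n" "i < j" "j \<le> p"
  shows "F n (c_map A M N n (Suc p) (Suc j) (c_map A M N n p (Suc i) f)) \<phi> m as =
    F n (c_map A M N n (Suc p) (Suc i) (c_map A M N n p j f)) \<phi> m as"
proof -
  obtain j' where j: "j = Suc j'" using assms by (cases j) auto
  have f0: "c_map A M N n p (Suc i) f \<in> carr (Y A M N n (Suc p))" by (rule c_carr[OF f]) (use assms in simp)
  have f1: "c_map A M N n p j f \<in> carr (Y A M N n (Suc p))" by (rule c_carr[OF f]) (use assms in simp)
  have "comult_at i (comult_at (Suc j') (\<phi> v)) = comult_at j' (comult_at i (\<phi> v))" for v
    using comult_at_comult_at[OF list_multilinear_multilinear[OF \<phi>], of i j'] assms j by auto
  then show ?thesis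
    using assms j f1 by (simp add: c_middle_eq[OF f0] c_middle_eq[OF f] c_middle_eq ml del: comult_at.simps)
qed

lemma cc_middle_last:
  assumes "length as = n" "i < p"
  shows "F n (c_map A M N n (Suc p) (Suc (Suc p)) (c_map A M N n p (Suc i) f)) \<phi> m as =
    F n (c_map A M N n (Suc p) (Suc i) (c_map A M N n p (Suc p) f)) \<phi> m as"
proof -
  have f0: "c_map A M N n p (Suc i) f \<in> carr (Y A M N n (Suc p))" by (rule c_carr[OF f]) (use assms in simp)
  have f1: "c_map A M N n p (Suc p) f \<in> carr (Y A M N n (Suc p))" by (rule c_carr[OF f]) simp
  \<comment> \<open>\<open>comult_at_snoc\<close> needs the entry i to lie in vs;
    \<open>F_cong\<close> supplies the length p of vs.\<close>
  have "F n f (\<lambda>v. comult_at i (\<lambda>vs. \<phi> v (vs @ [z]))) x s = F n f (\<lambda>v vs. comult_at i (\<phi> v) (vs @ [z])) x s" for x s z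
    by (rule F_cong[OF f]) (use assms in \<open>simp add: comult_at_snoc\<close>)
  then show ?thesis
    using assms by (simp add: c_last_eq[OF f0] c_middle_eq[OF f] c_middle_eq[OF f1] c_last_eq[OF f] ml cong: L_cong del: comult_at.simps)
qed

text \<open>The argument of \<open>cc_first\<close> at the other end, with the comodule M: the entry
  to be comultiplied is now a product followed by a coaction component of m.\<close>

lemma cc_last:
  assumes "length as = n"
  shows "F n (c_map A M N n (Suc p) (Suc (Suc p)) (c_map A M N n p (Suc p) f)) \<phi> m as =
    F n (c_map A M N n (Suc p) (Suc p) (c_map A M N n p (Suc p) f)) \<phi> m as"
proof -
  have f1: "c_map A M N n p (Suc p) f \<in> carr (Y A M N n (Suc p))" by (rule c_carr[OF f]) simp
  let ?\<Phi> = "\<lambda>t1 t2 w y v vs. \<phi> v (vs @ [prod_list t1 * w, prod_list t2 * y])"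
  have ml2: "multilinear sA sN (?\<Phi> t1 t2 w y)" for t1 t2 w y
    by (rule multilinearI) (intro all_intros)+
  \<comment> \<open>Only for vs of length p does position p hit the appended entry.\<close>
  have split: "comult_at p (\<phi> v) (vs @ [prod_list t * y]) = L t (\<lambda>t1 t2. Delta y (\<lambda>w y. ?\<Phi> t1 t2 w y v vs))"
    if "length vs = p" for v vs t y
  proof -
    have "comult_at p (\<phi> v) (vs @ [prod_list t * y]) = Delta (prod_list t * y) (\<lambda>a b. \<phi> v (vs @ [a, b]))"
      using comult_at_last[of vs "\<phi> v"] that by simp
    also have "\<dots> = L t (\<lambda>t1 t2. Delta y (\<lambda>w y. ?\<Phi> t1 t2 w y v vs))"
      by (subst Delta_mult, (intro all_intros)+, subst Delta_prod_list) (intro all_intros refl)+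
    finally show ?thesis .
  qed
  have *: "F n f (\<lambda>v vs. comult_at p (\<phi> v) (vs @ [prod_list t * y])) x s =
      L t (\<lambda>t1 t2. Delta y (\<lambda>w y. F n f (?\<Phi> t1 t2 w y) x s))" for t y x s
    unfolding F_integ1[symmetric] F_L[symmetric] by (rule F_cong[OF f]) (rule split)
  have "F n (c_map A M N n (Suc p) (Suc p) (c_map A M N n p (Suc p) f)) \<phi> m as =
      L as (\<lambda>s t. L t (\<lambda>t1 t2. M.Rho m (\<lambda>x y. Delta y (\<lambda>w y. F n f (?\<Phi> t1 t2 w y) x s))))"
    using assms by (simp add: c_middle_eq[OF f1] c_last_eq[OF f] ml * L_integ1 del: comult_at.simps)
  also have "\<dots> = L as (\<lambda>s t. L t (\<lambda>t1 t2. M.Rho m (\<lambda>x y. M.Rho x (\<lambda>u w. F n f (?\<Phi> t1 t2 w y) u s))))"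
    by (subst M.Rho_coassoc) (intro all_intros ml2 refl)+
  also have "\<dots> = L as (\<lambda>s t. L s (\<lambda>s1 s2. M.Rho m (\<lambda>x y. M.Rho x (\<lambda>u w. F n f (?\<Phi> s2 t w y) u s1))))"
    by (rule L_coassoc[symmetric]) (intro all_intros ml2)+
  also have "\<dots> = F n (c_map A M N n (Suc p) (Suc (Suc p)) (c_map A M N n p (Suc p) f)) \<phi> m as"
    using assms by (simp add: c_last_eq[OF f1] c_last_eq[OF f] ml L_integ1 cong: L_cong)
  finally show ?thesis ..
qed

subsection \<open>The maps b commute with the maps c\<close>

text \<open>If \<open>c_0\<close> follows \<open>b_0\<close>, the second component of a acts on v
  before the coaction and the first multiplies the coaction component from the right. In the other
  order the first component acts on v_0 and the second multiplies v_1 from the left. These are the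
  two sides of the Yetter-Drinfel'd condition for N; the remaining p components multiply the factors
  of vs in both cases.\<close>

lemma cb_first_first:
  assumes "length as = n"
  shows "F (Suc n) (c_map A M N (Suc n) p 0 (b_map A M N n p 0 f)) \<phi> m (a # as) =
    F (Suc n) (b_map A M N n (Suc p) 0 (c_map A M N n p 0 f)) \<phi> m (a # as)"
proof -
  have fb: "b_map A M N n p 0 f \<in> carr (Y A M N (Suc n) p)" by (rule b_carr[OF f]) simp
  have fc: "c_map A M N n p 0 f \<in> carr (Y A M N n (Suc p))" by (rule c_carr[OF f]) simp
  let ?P = "\<lambda>s x z v vs r. mult_lists (\<lambda>w. \<phi> v ((z * x * prod_list s) # w)) r vs"
  let ?R = "\<lambda>s x z v vs r. mult_lists (\<lambda>w. \<phi> (act N x v) ((z * prod_list s) # w)) r vs"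
  let ?l = "\<lambda>x y r. L as (\<lambda>s t. F n f (\<lambda>v vs. N.Rho (act N y v) (\<lambda>u z. ?P s x z u vs r)) m t)"
  let ?r = "\<lambda>x y r. L as (\<lambda>s t. F n f (\<lambda>v vs. N.Rho v (\<lambda>u z. ?R s x (y * z) u vs r)) m t)"
  have yd: "Delta b (\<lambda>x y. ?l x y r) = Delta b (\<lambda>x y. ?r x y r)" for b r
    unfolding L_integ1[symmetric] F_integ1[symmetric]
    by (subst N.yd_compatible[where \<psi> = "\<lambda>v z. mult_lists (\<lambda>w. \<phi> v ((z * prod_list _) # w)) _ _"])
      (intro all_intros refl)+
  have "F (Suc n) (c_map A M N (Suc n) p 0 (b_map A M N n p 0 f)) \<phi> m (a # as) =
      Delta a (\<lambda>x y. D p y (\<lambda>l. ?l x (hd l) (tl l)))"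
    using assms
    by (simp add: c_first_eq[OF fb \<phi>] b_first_eq[OF f] ml L_D mult_lists_integ1[abs_def] mult.assoc cong: L_cong)
  also have "\<dots> = D (Suc p) a (\<lambda>l. ?l (hd l) (hd (tl l)) (tl (tl l)))"
    by simp
  also have "\<dots> = D p a (\<lambda>l. Delta (hd l) (\<lambda>x y. ?l x y (tl l)))"
    by (rule D_split_head[symmetric]) (intro all_intros)+
  also have "\<dots> = D p a (\<lambda>l. Delta (hd l) (\<lambda>x y. ?r x y (tl l)))"
    by (simp only: yd)
  also have "\<dots> = D (Suc p) a (\<lambda>l. ?r (hd l) (hd (tl l)) (tl (tl l)))"
    by (rule D_split_head) (intro all_intros)+
  also have "\<dots> = D (Suc p) a (\<lambda>l. L as (\<lambda>s t. F n f (lcoact s (lact l \<phi>)) m t))"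
    by (rule D_cong) (auto simp: length_Suc_conv mult.assoc)
  also have "\<dots> = F (Suc n) (b_map A M N n (Suc p) 0 (c_map A M N n p 0 f)) \<phi> m (a # as)"
    using assms by (simp add: b_first_eq[OF fc \<phi>] c_first_eq[OF f] ml del: D.simps)
  finally show ?thesis .
qed

text \<open>If a factor is split after being multiplied, its multiplier must split too, which yields
  the additional component on the other side. The entry is \<open>Suc j\<close> and not j because
  entry 0 acts on N.\<close>

lemma cb_first_middle:
  assumes "length as = n" "j < p"
  shows "F (Suc n) (c_map A M N (Suc n) p (Suc j) (b_map A M N n p 0 f)) \<phi> m (a # as) =
    F (Suc n) (b_map A M N n (Suc p) 0 (c_map A M N n p (Suc j) f)) \<phi> m (a # as)"
proof -
  have fb: "b_map A M N n p 0 f \<in> carr (Y A M N (Suc n) p)" by (rule b_carr[OF f]) simp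
  have fc: "c_map A M N n p (Suc j) f \<in> carr (Y A M N n (Suc p))"
    by (rule c_carr[OF f]) (use assms in simp)
  let ?\<Psi> = "\<lambda>l. F n f (\<lambda>v. comult_at j (lact l \<phi> v)) m as"
  have lm: "list_multilinear sA ?\<Psi>"
    by (rule list_multilinear_hd_tl[where \<chi> = "\<lambda>x xs. F n f (\<lambda>v. comult_at j (mult_lists (\<phi> (act N x v)) xs)) m as"])
       (intro all_intros)+
  have "F (Suc n) (b_map A M N n (Suc p) 0 (c_map A M N n p (Suc j) f)) \<phi> m (a # as) = D (Suc p) a ?\<Psi>"
    using assms by (simp add: b_first_eq[OF fc \<phi>] c_middle_eq[OF f] ml del: D.simps comult_at.simps)
  also have "\<dots> = D p a (comult_at (Suc j) ?\<Psi>)"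
    by (rule D_comult_at[OF lm]) (use assms in simp)
  also have "\<dots> = D p a (\<lambda>l. F n f (lact l (\<lambda>v. comult_at j (\<phi> v))) m as)"
  proof (rule D_cong)
    fix l :: "'a list" assume "length l = Suc p"
    then obtain x xs where l: "l = x # xs" by (cases l) auto
    show "comult_at (Suc j) ?\<Psi> l = F n f (lact l (\<lambda>v. comult_at j (\<phi> v))) m as"
      by (simp add: l F_comult_at mult_lists_comult_at[OF list_multilinear_multilinear[OF \<phi>], abs_def])
  qed
  also have "\<dots> = F (Suc n) (c_map A M N (Suc n) p (Suc j) (b_map A M N n p 0 f)) \<phi> m (a # as)"
    using assms by (simp add: c_middle_eq[OF fb \<phi>] b_first_eq[OF f] ml del: D.simps comult_at.simps)
  finally show ?thesis ..
qed

text \<open>The last of the p + 2 components meets the appended factor, where it joins the product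
  of t from the left; \<open>D_snoc\<close> detaches it.\<close>

lemma cb_first_last:
  assumes "length as = n"
  shows "F (Suc n) (c_map A M N (Suc n) p (Suc p) (b_map A M N n p 0 f)) \<phi> m (a # as) =
    F (Suc n) (b_map A M N n (Suc p) 0 (c_map A M N n p (Suc p) f)) \<phi> m (a # as)"
proof -
  have fb: "b_map A M N n p 0 f \<in> carr (Y A M N (Suc n) p)" by (rule b_carr[OF f]) simp
  have fc: "c_map A M N n p (Suc p) f \<in> carr (Y A M N n (Suc p))" by (rule c_carr[OF f]) simp
  let ?\<Psi> = "\<lambda>l. L as (\<lambda>s t. M.Rho m (\<lambda>x y. F n f (rcoact t y (lact l \<phi>)) x s))"
  have lm: "list_multilinear sA ?\<Psi>"
    by (rule list_multilinear_hd_tl[where \<chi> = "\<lambda>x xs. L as (\<lambda>s t. M.Rho m (\<lambda>x' y.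
          F n f (\<lambda>v vs. mult_lists (\<phi> (act N x v)) xs (vs @ [prod_list t * y])) x' s))"])
       (intro all_intros)+
  have "F (Suc n) (b_map A M N n (Suc p) 0 (c_map A M N n p (Suc p) f)) \<phi> m (a # as) = D (Suc p) a ?\<Psi>"
    using assms by (simp add: b_first_eq[OF fc \<phi>] c_last_eq[OF f] ml del: D.simps)
  also have "\<dots> = Delta a (\<lambda>x y. D p x (\<lambda>l. ?\<Psi> (l @ [y])))"
    by (rule D_snoc[OF lm])
  also have "\<dots> = Delta a (\<lambda>a1 a2. D p a1 (\<lambda>l. L as (\<lambda>s t. M.Rho m (\<lambda>x y.
      F n f (lact l (rcoact (a2 # t) y \<phi>)) x s))))"
  proof -
    have "D p a1 (\<lambda>l. ?\<Psi> (l @ [a2])) = D p a1 (\<lambda>l. L as (\<lambda>s t. M.Rho m (\<lambda>x y.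
        F n f (lact l (rcoact (a2 # t) y \<phi>)) x s)))" for a1 a2
      by (rule D_cong) (auto simp: length_Suc_conv mult_lists_append mult.assoc)
    then show ?thesis by simp
  qed
  also have "\<dots> = F (Suc n) (c_map A M N (Suc n) p (Suc p) (b_map A M N n p 0 f)) \<phi> m (a # as)"
    using assms by (simp add: c_last_eq[OF fb \<phi>] b_first_eq[OF f] ml D_integ1[symmetric] L_D cong: L_cong)
  finally show ?thesis ..
qed

text \<open>One side comultiplies the merged entry a * b, the other comultiplies a and b and
  multiplies the components: multiplicativity of the comultiplication.\<close>

lemma cb_middle_first:
  assumes "length l1 = i" "Suc (i + length l2) = n"
  shows "F (Suc n) (c_map A M N (Suc n) p 0 (b_map A M N n p (Suc i) f)) \<phi> m (l1 @ a # b # l2) =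
    F (Suc n) (b_map A M N n (Suc p) (Suc i) (c_map A M N n p 0 f)) \<phi> m (l1 @ a # b # l2)"
proof -
  have fb: "b_map A M N n p (Suc i) f \<in> carr (Y A M N (Suc n) p)"
    by (rule b_carr[OF f]) (use assms in simp)
  have fc: "c_map A M N n p 0 f \<in> carr (Y A M N n (Suc p))" by (rule c_carr[OF f]) simp
  have "F (Suc n) (c_map A M N (Suc n) p 0 (b_map A M N n p (Suc i) f)) \<phi> m (l1 @ a # b # l2) =
      L l1 (\<lambda>s t. Delta a (\<lambda>x y. Delta b (\<lambda>x' y'. L l2 (\<lambda>s' t'.
        F n f (lcoact (s @ x * x' # s') \<phi>) m (t @ y * y' # t')))))"
    using assms by (simp add: c_first_eq[OF fb \<phi>] L_append b_middle_eq[OF f] ml mult.assoc cong: L_cong)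
  also have "\<dots> = L l1 (\<lambda>s t. Delta (a * b) (\<lambda>x y. L l2 (\<lambda>s' t'.
        F n f (lcoact (s @ x # s') \<phi>) m (t @ y # t'))))"
    by (subst Delta_mult) (intro all_intros ml refl)+
  also have "\<dots> = F (Suc n) (b_map A M N n (Suc p) (Suc i) (c_map A M N n p 0 f)) \<phi> m (l1 @ a # b # l2)"
    using assms by (simp add: b_middle_eq[OF fc \<phi>] c_first_eq[OF f] ml L_append)
  finally show ?thesis .
qed

lemma cb_middle_middle:
  assumes "length l1 = i" "Suc (i + length l2) = n" "j < p"
  shows "F (Suc n) (c_map A M N (Suc n) p (Suc j) (b_map A M N n p (Suc i) f)) \<phi> m (l1 @ a # b # l2) =
    F (Suc n) (b_map A M N n (Suc p) (Suc i) (c_map A M N n p (Suc j) f)) \<phi> m (l1 @ a # b # l2)"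
proof -
  have fb: "b_map A M N n p (Suc i) f \<in> carr (Y A M N (Suc n) p)"
    by (rule b_carr[OF f]) (use assms in simp)
  have fc: "c_map A M N n p (Suc j) f \<in> carr (Y A M N n (Suc p))"
    by (rule c_carr[OF f]) (use assms in simp)
  show ?thesis
    using assms by (simp add: c_middle_eq[OF fb \<phi>] b_middle_eq[OF fc \<phi>] b_middle_eq[OF f] c_middle_eq[OF f] ml del: comult_at.simps)
qed

lemma cb_middle_last:
  assumes "length l1 = i" "Suc (i + length l2) = n"
  shows "F (Suc n) (c_map A M N (Suc n) p (Suc p) (b_map A M N n p (Suc i) f)) \<phi> m (l1 @ a # b # l2) =
    F (Suc n) (b_map A M N n (Suc p) (Suc i) (c_map A M N n p (Suc p) f)) \<phi> m (l1 @ a # b # l2)"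
proof -
  have fb: "b_map A M N n p (Suc i) f \<in> carr (Y A M N (Suc n) p)"
    by (rule b_carr[OF f]) (use assms in simp)
  have fc: "c_map A M N n p (Suc p) f \<in> carr (Y A M N n (Suc p))" by (rule c_carr[OF f]) simp
  have "F (Suc n) (c_map A M N (Suc n) p (Suc p) (b_map A M N n p (Suc i) f)) \<phi> m (l1 @ a # b # l2) =
      L l1 (\<lambda>s t. Delta a (\<lambda>x y. Delta b (\<lambda>x' y'. L l2 (\<lambda>s' t'. M.Rho m (\<lambda>u z.
        F n f (rcoact (t @ y * y' # t') z \<phi>) u (s @ x * x' # s'))))))"
    using assms by (simp add: c_last_eq[OF fb \<phi>] L_append b_middle_eq[OF f] ml mult.assoc cong: L_cong)
  also have "\<dots> = L l1 (\<lambda>s t. Delta (a * b) (\<lambda>x y. L l2 (\<lambda>s' t'. M.Rho m (\<lambda>u z.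
        F n f (rcoact (t @ y # t') z \<phi>) u (s @ x # s')))))"
    by (subst Delta_mult) (intro all_intros ml refl)+
  also have "\<dots> = F (Suc n) (b_map A M N n (Suc p) (Suc i) (c_map A M N n p (Suc p) f)) \<phi> m (l1 @ a # b # l2)"
    using assms by (simp add: b_middle_eq[OF fc \<phi>] c_last_eq[OF f] ml L_append)
  finally show ?thesis .
qed

text \<open>The first component of a stands at the end of the product formed by \<open>c_0\<close>,
  next to the right multiplication by the last b; since \<open>D\<close> detaches its first
  component by definition, interchange of sums and associativity suffice.\<close>

lemma cb_last_first:
  assumes "length as = n"
  shows "F (Suc n) (c_map A M N (Suc n) p 0 (b_map A M N n p (Suc n) f)) \<phi> m (as @ [a]) =
    F (Suc n) (b_map A M N n (Suc p) (Suc n) (c_map A M N n p 0 f)) \<phi> m (as @ [a])"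
proof -
  have fb: "b_map A M N n p (Suc n) f \<in> carr (Y A M N (Suc n) p)" by (rule b_carr[OF f]) simp
  have fc: "c_map A M N n p 0 f \<in> carr (Y A M N n (Suc p))" by (rule c_carr[OF f]) simp
  have "F (Suc n) (c_map A M N (Suc n) p 0 (b_map A M N n p (Suc n) f)) \<phi> m (as @ [a]) =
      L as (\<lambda>s t. Delta a (\<lambda>x y. D p y (\<lambda>l. F n f (ract l (lcoact (s @ [x]) \<phi>)) (act M (last l) m) t)))"
    using assms by (simp add: c_first_eq[OF fb \<phi>] L_append b_last_eq[OF f] ml cong: L_cong)
  also have "\<dots> = Delta a (\<lambda>x y. D p y (\<lambda>l. L as (\<lambda>s t.
      F n f (ract l (lcoact (s @ [x]) \<phi>)) (act M (last l) m) t)))"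
    by (simp only: L_integ1 L_D)
  also have "\<dots> = D (Suc p) a (\<lambda>l. L as (\<lambda>s t. F n f (lcoact s (ract l \<phi>)) (act M (last l) m) t))"
  proof -
    have "D p y (\<lambda>l. L as (\<lambda>s t. F n f (ract l (lcoact (s @ [x]) \<phi>)) (act M (last l) m) t)) =
        D p y (\<lambda>l. L as (\<lambda>s t. F n f (lcoact s (ract (x # l) \<phi>)) (act M (last (x # l)) m) t))" for x y
      by (rule D_cong) (auto simp: mult_lists_integ1[abs_def] mult.assoc)
    then show ?thesis by simp
  qed
  also have "\<dots> = F (Suc n) (b_map A M N n (Suc p) (Suc n) (c_map A M N n p 0 f)) \<phi> m (as @ [a])"
    using assms by (simp add: b_last_eq[OF fc \<phi>] c_first_eq[OF f] ml del: D.simps)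
  finally show ?thesis .
qed

text \<open>As in \<open>cb_first_middle\<close>, but with entry j, since the component acting on M
  stands at the end of the list.\<close>

lemma cb_last_middle:
  assumes "length as = n" "j < p"
  shows "F (Suc n) (c_map A M N (Suc n) p (Suc j) (b_map A M N n p (Suc n) f)) \<phi> m (as @ [a]) =
    F (Suc n) (b_map A M N n (Suc p) (Suc n) (c_map A M N n p (Suc j) f)) \<phi> m (as @ [a])"
proof -
  have fb: "b_map A M N n p (Suc n) f \<in> carr (Y A M N (Suc n) p)" by (rule b_carr[OF f]) simp
  have fc: "c_map A M N n p (Suc j) f \<in> carr (Y A M N n (Suc p))"
    by (rule c_carr[OF f]) (use assms in simp)
  let ?\<Psi> = "\<lambda>l. F n f (\<lambda>v. comult_at j (ract l \<phi> v)) (act M (last l) m) as"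
  have lm: "list_multilinear sA ?\<Psi>"
  proof (rule list_multilinear_butlast_last[where \<chi> = "\<lambda>xs x. F n f (\<lambda>v. comult_at j (\<lambda>vs. mult_lists (\<phi> v) vs xs)) (act M x m) as"])
    have "multilinear sA sN (\<lambda>v. comult_at j (\<lambda>vs. mult_lists (\<phi> v) vs xs))" for xs
      by (rule multilinear_comult_at) (rule multilinearI, (intro all_intros)+)
    then show "klinear sA (*) (\<lambda>x. F n f (\<lambda>v. comult_at j (\<lambda>vs. mult_lists (\<phi> v) vs xs)) (act M x m) as)" for xs
      by (intro klinear_F[OF f] M.klinear_act klinear_id)
  qed (intro all_intros)
  have "F (Suc n) (b_map A M N n (Suc p) (Suc n) (c_map A M N n p (Suc j) f)) \<phi> m (as @ [a]) = D (Suc p) a ?\<Psi>"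
    using assms by (simp add: b_last_eq[OF fc \<phi>] c_middle_eq[OF f] ml del: D.simps comult_at.simps)
  also have "\<dots> = D p a (comult_at j ?\<Psi>)"
    by (rule D_comult_at[OF lm]) (use assms in simp)
  also have "\<dots> = D p a (\<lambda>l. F n f (ract l (\<lambda>v. comult_at j (\<phi> v))) (act M (last l) m) as)"
  proof (rule D_cong)
    fix l :: "'a list" assume "length l = Suc p"
    then obtain xs x where l: "l = xs @ [x]" "length xs = p" by (cases l rule: rev_cases) auto
    have "comult_at j ?\<Psi> l = F n f (\<lambda>v vs. comult_at j (\<lambda>xs. comult_at j (\<lambda>vs. mult_lists (\<phi> v) vs xs) vs) xs) (act M x m) as"
      using assms l by (simp add: comult_at_snoc F_comult_at)
    also have "\<dots> = F n f (\<lambda>v vs. mult_lists (comult_at j (\<phi> v)) vs xs) (act M x m) as"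
      \<comment> \<open>In \<open>mult_lists_comult_at\<close> the left list is split in the outer
        sum; here it is vs, which is split in the inner one.\<close>
      unfolding mult_lists_comult_at[OF list_multilinear_multilinear[OF \<phi>]] by (subst comult_at_swap) (rule refl)
    finally show "comult_at j ?\<Psi> l = F n f (ract l (\<lambda>v. comult_at j (\<phi> v))) (act M (last l) m) as"
      by (simp add: l)
  qed
  also have "\<dots> = F (Suc n) (c_map A M N (Suc n) p (Suc j) (b_map A M N n p (Suc n) f)) \<phi> m (as @ [a])"
    using assms by (simp add: c_middle_eq[OF fb \<phi>] b_last_eq[OF f] ml del: D.simps comult_at.simps)
  finally show ?thesis ..
qed

text \<open>The condition for M, on the last two components of a. In c after b, the earlier one acts
  on m_0 and the later one multiplies m_1 from the left; in b after c, the later one acts on m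
  before the coaction and the earlier one multiplies from the right.\<close>

lemma cb_last_last:
  assumes "length as = n"
  shows "F (Suc n) (c_map A M N (Suc n) p (Suc p) (b_map A M N n p (Suc n) f)) \<phi> m (as @ [a]) =
    F (Suc n) (b_map A M N n (Suc p) (Suc n) (c_map A M N n p (Suc p) f)) \<phi> m (as @ [a])"
proof -
  have fb: "b_map A M N n p (Suc n) f \<in> carr (Y A M N (Suc n) p)" by (rule b_carr[OF f]) simp
  have fc: "c_map A M N n p (Suc p) f \<in> carr (Y A M N n (Suc p))" by (rule c_carr[OF f]) simp
  let ?\<Phi> = "\<lambda>t z r v vs. mult_lists (\<lambda>w. \<phi> v (w @ [prod_list t * z])) vs r"
  have ml2: "multilinear sA sN (?\<Phi> t z r)" for t z r
    by (rule multilinearI) (intro all_intros)+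
  let ?l = "\<lambda>r x y. L as (\<lambda>s t. M.Rho m (\<lambda>u z. F n f (?\<Phi> t (y * z) r) (act M x u) s))"
  let ?r = "\<lambda>r x y. L as (\<lambda>s t. M.Rho (act M y m) (\<lambda>u z. F n f (?\<Phi> t (z * x) r) u s))"
  have yd: "Delta b (\<lambda>x y. ?r r x y) = Delta b (\<lambda>x y. ?l r x y)" for b r
    unfolding L_integ1[symmetric]
    by (subst M.yd_compatible[where \<psi> = "\<lambda>u z. F n f (?\<Phi> _ z _) u _"]) (intro all_intros ml2 refl)+
  have "F (Suc n) (c_map A M N (Suc n) p (Suc p) (b_map A M N n p (Suc n) f)) \<phi> m (as @ [a]) =
      L as (\<lambda>s t. Delta a (\<lambda>x y. D p x (\<lambda>l. M.Rho m (\<lambda>u z.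
        F n f (?\<Phi> t (y * z) (butlast l)) (act M (last l) u) s))))"
    using assms
    by (simp add: c_last_eq[OF fb \<phi>] L_append b_last_eq[OF f] ml D_integ1[symmetric] mult.assoc cong: L_cong)
  also have "\<dots> = Delta a (\<lambda>x y. D p x (\<lambda>l. ?l (butlast l) (last l) y))"
    by (simp only: L_integ1[of as "comult A a"] L_D)
  also have "\<dots> = D p a (\<lambda>l. Delta (last l) (\<lambda>x y. ?l (butlast l) x y))"
    by (rule D_split_last(2)[symmetric]) (intro all_intros ml2)+
  also have "\<dots> = D p a (\<lambda>l. Delta (last l) (\<lambda>x y. ?r (butlast l) x y))"
    by (simp only: yd)
  also have "\<dots> = D (Suc p) a (\<lambda>l. ?r (butlast (butlast l)) (last (butlast l)) (last l))"
    by (rule D_split_last(1)) (intro all_intros ml2)+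
  also have "\<dots> = D (Suc p) a (\<lambda>l. L as (\<lambda>s t. M.Rho (act M (last l) m) (\<lambda>u z. F n f (rcoact t z (ract l \<phi>)) u s)))"
  proof (rule D_cong)
    fix l :: "'a list" assume "length l = Suc (Suc p)"
    then obtain r x y where "l = r @ [x, y]"
      by (metis append_butlast_last_id append_Cons append_Nil append_assoc length_butlast diff_Suc_1
          list.size(3) nat.distinct(1))
    then show "?r (butlast (butlast l)) (last (butlast l)) (last l) =
        L as (\<lambda>s t. M.Rho (act M (last l) m) (\<lambda>u z. F n f (rcoact t z (ract l \<phi>)) u s))"
      by (simp add: butlast_append mult_lists_append mult.assoc)
  qed
  also have "\<dots> = F (Suc n) (b_map A M N n (Suc p) (Suc n) (c_map A M N n p (Suc p) f)) \<phi> m (as @ [a])"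
    using assms by (simp add: b_last_eq[OF fc \<phi>] c_last_eq[OF f] ml del: D.simps)
  finally show ?thesis .
qed

end

section \<open>Assembly of the identities from the cases of the indices\<close>

lemma index_cases:
  assumes "i \<le> Suc n"
  obtains "i = 0" | j where "i = Suc j" "j < n" | "i = Suc n"
  using assms by (cases i) (auto simp: le_less)

lemma list_snoc:
  assumes "length l = Suc n"
  obtains as a where "l = as @ [a]" "length as = n"
  using assms by (cases l rule: rev_cases) auto

lemma b_b:
  assumes f: "f \<in> carr (Y A M N n p)" and ij: "i < j" "j \<le> Suc (Suc n)"
  shows "b_map A M N (Suc n) p j (b_map A M N n p i f) = b_map A M N (Suc n) p i (b_map A M N n p (j - 1) f)"
proof (rule Y_eqI)
  show "b_map A M N (Suc n) p j (b_map A M N n p i f) \<in> carr (Y A M N (Suc (Suc n)) p)"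
    by (intro b_carr f) (use ij in auto)
  show "b_map A M N (Suc n) p i (b_map A M N n p (j - 1) f) \<in> carr (Y A M N (Suc (Suc n)) p)"
    by (intro b_carr f) (use ij in auto)
  fix \<phi> m and as :: "'a list" assume \<phi>: "multilinear sA sN \<phi>" and as: "length as = Suc (Suc n)"
  show "F (Suc (Suc n)) (b_map A M N (Suc n) p j (b_map A M N n p i f)) \<phi> m as =
      F (Suc (Suc n)) (b_map A M N (Suc n) p i (b_map A M N n p (j - 1) f)) \<phi> m as"
  proof (cases "i = 0")
    case i: True
    obtain a l where l: "as = a # l" "length l = Suc n" using as by (cases as) auto
    from ij(2) show ?thesis
    proof (cases j rule: index_cases)
      case 1
      with ij show ?thesis by simp
    next
      case (2 j')
      show ?thesis
      proof (cases j')
        case 0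
        obtain b l' where "l = b # l'" "length l' = n" using l by (cases l) auto
        then show ?thesis using bb_first[OF f \<phi>] l 0 2 i by simp
      next
        case (Suc j'')
        obtain l1 b c l2 where "l = l1 @ b # c # l2" "length l1 = j''" "length (l1 @ a # l2) = n"
          by (rule split_at_pair[of l n j'' a]) (use l 2 Suc in auto)
        then show ?thesis using bb_first_middle[OF f \<phi>, of l1 j'' l2 m a b c] l Suc 2 i by simp
      qed
    next
      case 3
      obtain l' b where "l = l' @ [b]" "length l' = n" using l by (auto elim: list_snoc)
      then show ?thesis using bb_first_last[OF f \<phi>] l 3 i by simp
    qed
  next
    case False
    then obtain i' where i: "i = Suc i'" by (cases i) auto
    show ?thesis
    proof (cases "j = Suc (Suc n)")
      case j: True
      obtain l c where l: "as = l @ [c]" "length l = Suc n" using as by (auto elim: list_snoc)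
      show ?thesis
      proof (cases "i' = n")
        case True
        obtain l' b where "l = l' @ [b]" "length l' = n" using l by (auto elim: list_snoc)
        then show ?thesis using bb_last[OF f \<phi>, of l' m b c] l i j True by simp
      next
        case False
        obtain l1 a b l2 where "l = l1 @ a # b # l2" "length l1 = i'" "length (l1 @ c # l2) = n"
          by (rule split_at_pair[of l n i' c]) (use l i j ij False in auto)
        then show ?thesis using bb_middle_last[OF f \<phi>, of l1 i' l2 m a b c] l i j by simp
      qed
    next
      case False
      then show ?thesis using bb_middle[OF f \<phi> as, of i' "j - 1" m] ij i by (cases j) auto
    qed
  qed
qed

lemma c_c:
  assumes f: "f \<in> carr (Y A M N n p)" and ij: "i < j" "j \<le> Suc (Suc p)"
  shows "c_map A M N n (Suc p) j (c_map A M N n p i f) = c_map A M N n (Suc p) i (c_map A M N n p (j - 1) f)"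
proof (rule Y_eqI)
  show "c_map A M N n (Suc p) j (c_map A M N n p i f) \<in> carr (Y A M N n (Suc (Suc p)))"
    by (intro c_carr f) (use ij in auto)
  show "c_map A M N n (Suc p) i (c_map A M N n p (j - 1) f) \<in> carr (Y A M N n (Suc (Suc p)))"
    by (intro c_carr f) (use ij in auto)
  fix \<phi> m and as :: "'a list" assume \<phi>: "multilinear sA sN \<phi>" and as: "length as = n"
  show "F n (c_map A M N n (Suc p) j (c_map A M N n p i f)) \<phi> m as =
      F n (c_map A M N n (Suc p) i (c_map A M N n p (j - 1) f)) \<phi> m as"
  proof (cases "i = 0")
    case i: True
    from ij(2) show ?thesis
    proof (cases j rule: index_cases)
      case 1
      with ij show ?thesis by simp
    next
      case (2 j')
      then show ?thesis
        using cc_first[OF f \<phi> as] cc_first_middle[OF f \<phi> as, of "j' - 1"] i by (cases j') auto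
    next
      case 3
      then show ?thesis using cc_first_last[OF f \<phi> as] i by simp
    qed
  next
    case False
    then obtain i' where i: "i = Suc i'" by (cases i) auto
    show ?thesis
    proof (cases "j = Suc (Suc p)")
      case True
      show ?thesis
        unfolding True i using cc_last[OF f \<phi> as] cc_middle_last[OF f \<phi> as, of i']
        by (cases "i' = p") (use i ij True in simp_all)
    next
      case False
      then show ?thesis using cc_middle[OF f \<phi> as, of i' "j - 1" m] ij i by (cases j) auto
    qed
  qed
qed

lemma c_b:
  assumes f: "f \<in> carr (Y A M N n p)" and ij: "i \<le> Suc n" "j \<le> Suc p"
  shows "c_map A M N (Suc n) p j (b_map A M N n p i f) = b_map A M N n (Suc p) i (c_map A M N n p j f)"
proof (rule Y_eqI)
  show "c_map A M N (Suc n) p j (b_map A M N n p i f) \<in> carr (Y A M N (Suc n) (Suc p))"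
    by (intro b_carr c_carr f) (use ij in auto)
  show "b_map A M N n (Suc p) i (c_map A M N n p j f) \<in> carr (Y A M N (Suc n) (Suc p))"
    by (intro b_carr c_carr f) (use ij in auto)
  fix \<phi> m and as :: "'a list" assume \<phi>: "multilinear sA sN \<phi>" and as: "length as = Suc n"
  note j = ij(2)
  from ij(1) show "F (Suc n) (c_map A M N (Suc n) p j (b_map A M N n p i f)) \<phi> m as =
      F (Suc n) (b_map A M N n (Suc p) i (c_map A M N n p j f)) \<phi> m as"
  proof (cases i rule: index_cases)
    case 1
    obtain a l where l: "as = a # l" "length l = n" using as by (cases as) auto
    from j show ?thesis
      by (cases j rule: index_cases)
        (use l 1 cb_first_first[OF f \<phi> l(2)] cb_first_middle[OF f \<phi> l(2)] cb_first_last[OF f \<phi> l(2)] in simp_all)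
  next
    case (2 i')
    obtain l1 a b l2 where l: "as = l1 @ a # b # l2" "length l1 = i'" "length (l1 @ undefined # l2) = n"
      by (rule split_at_pair[of as n i']) (use as 2 in auto)
    then have l': "Suc (i' + length l2) = n" by simp
    from j show ?thesis
      by (cases j rule: index_cases)
        (use l 2 cb_middle_first[OF f \<phi> l(2) l'] cb_middle_middle[OF f \<phi> l(2) l']
           cb_middle_last[OF f \<phi> l(2) l'] in simp_all)
  next
    case 3
    obtain a l where l: "as = l @ [a]" "length l = n" using as by (auto elim: list_snoc)
    from j show ?thesis
      by (cases j rule: index_cases)
        (use l 3 cb_last_first[OF f \<phi> l(2)] cb_last_middle[OF f \<phi> l(2)] cb_last_last[OF f \<phi> l(2)] in simp_all)
  qed
qed

section \<open>The double complex\<close>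

lemma Y_ops:
  shows "vzero (Y A M N n p) \<in> carr (Y A M N n p)"
    and "f \<in> carr (Y A M N n p) \<Longrightarrow> g \<in> carr (Y A M N n p) \<Longrightarrow> vadd (Y A M N n p) f g \<in> carr (Y A M N n p)"
    and "f \<in> carr (Y A M N n p) \<Longrightarrow> vscale (Y A M N n p) c f \<in> carr (Y A M N n p)"
    and "multilinear sA sN \<phi> \<Longrightarrow> F n (vzero (Y A M N n p)) \<phi> m as = 0"
    and "f \<in> carr (Y A M N n p) \<Longrightarrow> g \<in> carr (Y A M N n p) \<Longrightarrow> multilinear sA sN \<phi> \<Longrightarrow>
      F n (vadd (Y A M N n p) f g) \<phi> m as = F n f \<phi> m as + F n g \<phi> m as"
    and "f \<in> carr (Y A M N n p) \<Longrightarrow> multilinear sA sN \<phi> \<Longrightarrow>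
      F n (vscale (Y A M N n p) c f) \<phi> m as = c * F n f \<phi> m as"
  unfolding Y_def by (fact Hom_space_ops)+

text \<open>The maps depend on f through chosen representatives of its values, so linearity in f is
  not visible in their definition; it is read off the transposes.\<close>

lemma linear_map_YI:
  assumes h: "\<And>f. f \<in> carr (Y A M N n p) \<Longrightarrow> h f \<in> carr (Y A M N n' p')"
    and add: "\<And>f g \<phi> m as. \<lbrakk>f \<in> carr (Y A M N n p); g \<in> carr (Y A M N n p); multilinear sA sN \<phi>; length as = n'\<rbrakk> \<Longrightarrow>
      F n' (h (vadd (Y A M N n p) f g)) \<phi> m as = F n' (h f) \<phi> m as + F n' (h g) \<phi> m as"
    and scale: "\<And>c f \<phi> m as. \<lbrakk>f \<in> carr (Y A M N n p); multilinear sA sN \<phi>; length as = n'\<rbrakk> \<Longrightarrow>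
      F n' (h (vscale (Y A M N n p) c f)) \<phi> m as = c * F n' (h f) \<phi> m as"
  shows "linear_map (Y A M N n p) (Y A M N n' p') h"
  unfolding linear_map_def
proof (intro conjI ballI allI)
  show "h \<in> carr (Y A M N n p) \<rightarrow> carr (Y A M N n' p')" using h by blast
  show "h (vadd (Y A M N n p) f g) = vadd (Y A M N n' p') (h f) (h g)"
    if "f \<in> carr (Y A M N n p)" "g \<in> carr (Y A M N n p)" for f g
    by (rule Y_eqI[of _ n' p']) (simp_all add: h that Y_ops add)
  show "h (vscale (Y A M N n p) c f) = vscale (Y A M N n' p') c (h f)"
    if "f \<in> carr (Y A M N n p)" for f c
    by (rule Y_eqI[of _ n' p']) (simp_all add: h that Y_ops scale)
qed

lemma linear_b_map:
  assumes "i \<le> Suc n"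
  shows "linear_map (Y A M N n p) (Y A M N (Suc n) p) (b_map A M N n p i)"
proof (rule linear_map_YI)
  show "b_map A M N n p i f \<in> carr (Y A M N (Suc n) p)" if "f \<in> carr (Y A M N n p)" for f
    by (rule b_carr[OF that assms])
  fix f g \<phi> m c and as :: "'a list"
  assume f: "f \<in> carr (Y A M N n p)" and \<phi>: "multilinear sA sN \<phi>" and as: "length as = Suc n"
  note ml = multilinear_lact[OF \<phi>] multilinear_ract[OF \<phi>] \<phi>
  have s: "vscale (Y A M N n p) c f \<in> carr (Y A M N n p)" by (rule Y_ops(3)[OF f])
  from assms show "F (Suc n) (b_map A M N n p i (vscale (Y A M N n p) c f)) \<phi> m as =
      c * F (Suc n) (b_map A M N n p i f) \<phi> m as"
  proof (cases i rule: index_cases)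
    case 1
    obtain a l where l: "as = a # l" "length l = n" using as by (cases as) auto
    show ?thesis by (simp add: 1 l b_first_eq[OF s \<phi>] b_first_eq[OF f \<phi>] Y_ops(6)[OF f] ml D_scale)
  next
    case (2 j)
    obtain l1 a b l2 where l: "as = l1 @ a # b # l2" "length l1 = j" "length (l1 @ undefined # l2) = n"
      by (rule split_at_pair[of as n j]) (use as 2 in auto)
    then show ?thesis by (simp add: 2 b_middle_eq[OF s \<phi>] b_middle_eq[OF f \<phi>] Y_ops(6)[OF f] ml)
  next
    case 3
    obtain a l where l: "as = l @ [a]" "length l = n" using as by (auto elim: list_snoc)
    show ?thesis by (simp add: 3 l b_last_eq[OF s \<phi>] b_last_eq[OF f \<phi>] Y_ops(6)[OF f] ml D_scale)
  qed
  assume g: "g \<in> carr (Y A M N n p)"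
  have s: "vadd (Y A M N n p) f g \<in> carr (Y A M N n p)" by (rule Y_ops(2)[OF f g])
  from assms show "F (Suc n) (b_map A M N n p i (vadd (Y A M N n p) f g)) \<phi> m as =
      F (Suc n) (b_map A M N n p i f) \<phi> m as + F (Suc n) (b_map A M N n p i g) \<phi> m as"
  proof (cases i rule: index_cases)
    case 1
    obtain a l where l: "as = a # l" "length l = n" using as by (cases as) auto
    show ?thesis by (simp add: 1 l b_first_eq[OF s \<phi>] b_first_eq[OF f \<phi>] b_first_eq[OF g \<phi>] Y_ops(5)[OF f g] ml D_add)
  next
    case (2 j)
    obtain l1 a b l2 where l: "as = l1 @ a # b # l2" "length l1 = j" "length (l1 @ undefined # l2) = n"
      by (rule split_at_pair[of as n j]) (use as 2 in auto)
    then show ?thesis by (simp add: 2 b_middle_eq[OF s \<phi>] b_middle_eq[OF f \<phi>] b_middle_eq[OF g \<phi>] Y_ops(5)[OF f g] ml)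
  next
    case 3
    obtain a l where l: "as = l @ [a]" "length l = n" using as by (auto elim: list_snoc)
    show ?thesis by (simp add: 3 l b_last_eq[OF s \<phi>] b_last_eq[OF f \<phi>] b_last_eq[OF g \<phi>] Y_ops(5)[OF f g] ml D_add)
  qed
qed

lemma linear_c_map:
  assumes "i \<le> Suc p"
  shows "linear_map (Y A M N n p) (Y A M N n (Suc p)) (c_map A M N n p i)"
proof (rule linear_map_YI)
  show "c_map A M N n p i f \<in> carr (Y A M N n (Suc p))" if "f \<in> carr (Y A M N n p)" for f
    by (rule c_carr[OF that assms])
  fix f g \<phi> m c and as :: "'a list"
  assume f: "f \<in> carr (Y A M N n p)" and \<phi>: "multilinear sA sN \<phi>" and as: "length as = n"
  note ml = multilinear_lcoact[OF \<phi>] multilinear_rcoact[OF \<phi>] multilinear_comult_at[OF \<phi>]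
  have s: "vscale (Y A M N n p) c f \<in> carr (Y A M N n p)" by (rule Y_ops(3)[OF f])
  note eq = c_first_eq[OF _ \<phi> as] c_middle_eq[OF _ \<phi> as] c_last_eq[OF _ \<phi> as]
  from assms show "F n (c_map A M N n p i (vscale (Y A M N n p) c f)) \<phi> m as =
      c * F n (c_map A M N n p i f) \<phi> m as"
    by (cases i rule: index_cases)
      (simp_all add: eq s f Y_ops(6)[OF f] ml L_scale integ1_scale)
  assume g: "g \<in> carr (Y A M N n p)"
  have s: "vadd (Y A M N n p) f g \<in> carr (Y A M N n p)" by (rule Y_ops(2)[OF f g])
  from assms show "F n (c_map A M N n p i (vadd (Y A M N n p) f g)) \<phi> m as =
      F n (c_map A M N n p i f) \<phi> m as + F n (c_map A M N n p i g) \<phi> m as"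
    by (cases i rule: index_cases)
      (simp_all add: eq s f g Y_ops(5)[OF f g] ml L_add integ1_add)
qed

section \<open>Alternating sums and the differentials\<close>

lemma alt_sum_Y:
  assumes "\<And>i. i < r \<Longrightarrow> G i \<in> carr (Y A M N n p)"
  shows "alt_sum (Y A M N n p) G r \<in> carr (Y A M N n p)"
    and "multilinear sA sN \<phi> \<Longrightarrow> F n (alt_sum (Y A M N n p) G r) \<phi> m as = (\<Sum>i<r. (- 1) ^ i * F n (G i) \<phi> m as)"
proof -
  have *: "alt_sum (Y A M N n p) G r \<in> carr (Y A M N n p) \<and> (multilinear sA sN \<phi> \<longrightarrow>
      F n (alt_sum (Y A M N n p) G r) \<phi> m as = (\<Sum>i<r. (- 1) ^ i * F n (G i) \<phi> m as))"
    using assms by (induction r) (simp_all add: Y_ops)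
  show "alt_sum (Y A M N n p) G r \<in> carr (Y A M N n p)"
    and "multilinear sA sN \<phi> \<Longrightarrow> F n (alt_sum (Y A M N n p) G r) \<phi> m as = (\<Sum>i<r. (- 1) ^ i * F n (G i) \<phi> m as)"
    using * by auto
qed

text \<open>Expands an outer b or c applied to a whole differential, which is where linearity of the
  single maps is used.\<close>

lemma linear_alt_sum:
  assumes h: "linear_map (Y A M N n p) (Y A M N n' p') h"
    and G: "\<And>i. i < r \<Longrightarrow> G i \<in> carr (Y A M N n p)" and \<phi>: "multilinear sA sN \<phi>"
  shows "F n' (h (alt_sum (Y A M N n p) G r)) \<phi> m as = (\<Sum>i<r. (- 1) ^ i * F n' (h (G i)) \<phi> m as)"
  using G
proof (induction r)
  case 0
  have hV: "h f \<in> carr (Y A M N n' p')" if "f \<in> carr (Y A M N n p)" for f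
    using h that by (auto simp: linear_map_def)
  let ?z = "vzero (Y A M N n p)"
  \<comment> \<open>That h preserves zero has to be derived: zero is 0 times itself.\<close>
  have "vscale (Y A M N n p) 0 ?z = ?z"
    by (rule Y_eqI[of _ n p]) (simp_all add: Y_ops)
  then have "h ?z = vscale (Y A M N n' p') 0 (h ?z)"
    using h Y_ops(1)[of n p] unfolding linear_map_def by metis
  then show ?case using Y_ops(6)[OF hV[OF Y_ops(1)] \<phi>, of 0 m as] by simp
next
  case (Suc r)
  have hV: "h f \<in> carr (Y A M N n' p')" if "f \<in> carr (Y A M N n p)" for f
    using h that by (auto simp: linear_map_def)
  have c: "alt_sum (Y A M N n p) G r \<in> carr (Y A M N n p)" "G r \<in> carr (Y A M N n p)"
    using Suc.prems by (auto intro: alt_sum_Y)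
  have "h (alt_sum (Y A M N n p) G (Suc r)) =
      vadd (Y A M N n' p') (h (alt_sum (Y A M N n p) G r)) (vscale (Y A M N n' p') ((- 1) ^ r) (h (G r)))"
    using h c Y_ops(3)[OF c(2)] by (simp add: linear_map_def)
  then show ?case
    using Suc c by (simp add: Y_ops hV \<phi>)
qed

lemma d_m_Y:
  assumes "f \<in> carr (Y A M N n p)"
  shows "d_m A M N n p f \<in> carr (Y A M N (Suc n) p)"
    and "multilinear sA sN \<phi> \<Longrightarrow> F (Suc n) (d_m A M N n p f) \<phi> m as =
      (\<Sum>i<Suc (Suc n). (- 1) ^ i * F (Suc n) (b_map A M N n p i f) \<phi> m as)"
  using alt_sum_Y[of "n + 2" "\<lambda>i. b_map A M N n p i f" "Suc n" p] b_carr[OF assms]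
  by (simp_all add: d_m_def less_Suc_eq_le del: sum.lessThan_Suc alt_sum.simps)

lemma d_c_Y:
  assumes "f \<in> carr (Y A M N n p)"
  shows "d_c A M N n p f \<in> carr (Y A M N n (Suc p))"
    and "multilinear sA sN \<phi> \<Longrightarrow> F n (d_c A M N n p f) \<phi> m as =
      (\<Sum>i<Suc (Suc p). (- 1) ^ i * F n (c_map A M N n p i f) \<phi> m as)"
  using alt_sum_Y[of "p + 2" "\<lambda>i. c_map A M N n p i f" n "Suc p"] c_carr[OF assms]
  by (simp_all add: d_c_def less_Suc_eq_le del: sum.lessThan_Suc alt_sum.simps)

lemma linear_d_m: "linear_map (Y A M N n p) (Y A M N (Suc n) p) (d_m A M N n p)"
proof (rule linear_map_YI)
  note lin = linear_b_map[unfolded linear_map_def]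
  fix f g \<phi> m c and as :: "'a list"
  assume f: "f \<in> carr (Y A M N n p)"
  show "d_m A M N n p f \<in> carr (Y A M N (Suc n) p)" by (rule d_m_Y[OF f])
  assume \<phi>: "multilinear sA sN \<phi>"
  have "b_map A M N n p i (vscale (Y A M N n p) c f) = vscale (Y A M N (Suc n) p) c (b_map A M N n p i f)"
    if "i \<le> Suc n" for i using lin[OF that] f by blast
  then show "F (Suc n) (d_m A M N n p (vscale (Y A M N n p) c f)) \<phi> m as = c * F (Suc n) (d_m A M N n p f) \<phi> m as"
    by (simp add: d_m_Y(2)[OF _ \<phi>] f Y_ops b_carr[OF f] \<phi> sum_distrib_left mult.left_commute
        less_Suc_eq_le del: sum.lessThan_Suc)
  assume g: "g \<in> carr (Y A M N n p)"
  have "b_map A M N n p i (vadd (Y A M N n p) f g) =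
      vadd (Y A M N (Suc n) p) (b_map A M N n p i f) (b_map A M N n p i g)"
    if "i \<le> Suc n" for i using lin[OF that] f g by blast
  then show "F (Suc n) (d_m A M N n p (vadd (Y A M N n p) f g)) \<phi> m as =
      F (Suc n) (d_m A M N n p f) \<phi> m as + F (Suc n) (d_m A M N n p g) \<phi> m as"
    by (simp add: d_m_Y(2)[OF _ \<phi>] f g Y_ops b_carr[OF f] b_carr[OF g] \<phi> distrib_left flip: sum.distrib
        add: less_Suc_eq_le del: sum.lessThan_Suc)
qed

lemma linear_d_c: "linear_map (Y A M N n p) (Y A M N n (Suc p)) (d_c A M N n p)"
proof (rule linear_map_YI)
  note lin = linear_c_map[unfolded linear_map_def]
  fix f g \<phi> m c and as :: "'a list"
  assume f: "f \<in> carr (Y A M N n p)"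
  show "d_c A M N n p f \<in> carr (Y A M N n (Suc p))" by (rule d_c_Y[OF f])
  assume \<phi>: "multilinear sA sN \<phi>"
  have "c_map A M N n p i (vscale (Y A M N n p) c f) = vscale (Y A M N n (Suc p)) c (c_map A M N n p i f)"
    if "i \<le> Suc p" for i using lin[OF that] f by blast
  then show "F n (d_c A M N n p (vscale (Y A M N n p) c f)) \<phi> m as = c * F n (d_c A M N n p f) \<phi> m as"
    by (simp add: d_c_Y(2)[OF _ \<phi>] f Y_ops c_carr[OF f] \<phi> sum_distrib_left mult.left_commute
        less_Suc_eq_le del: sum.lessThan_Suc)
  assume g: "g \<in> carr (Y A M N n p)"
  have "c_map A M N n p i (vadd (Y A M N n p) f g) =
      vadd (Y A M N n (Suc p)) (c_map A M N n p i f) (c_map A M N n p i g)"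
    if "i \<le> Suc p" for i using lin[OF that] f g by blast
  then show "F n (d_c A M N n p (vadd (Y A M N n p) f g)) \<phi> m as =
      F n (d_c A M N n p f) \<phi> m as + F n (d_c A M N n p g) \<phi> m as"
    by (simp add: d_c_Y(2)[OF _ \<phi>] f g Y_ops c_carr[OF f] c_carr[OF g] \<phi> distrib_left flip: sum.distrib
        add: less_Suc_eq_le del: sum.lessThan_Suc)
qed

end

text \<open>T j i stands for the outer map j after the inner map i. The pairs with i < j correspond
  to those with j \<le> i by sending (j, i) to (i, j - 1); this keeps the value of T and lowers the
  exponent of the sign by one, so the terms cancel in pairs.\<close>

lemma cosimplicial_sum_zero:
  fixes T :: "nat \<Rightarrow> nat \<Rightarrow> 'k :: comm_ring_1"
  assumes "\<And>i j. i < j \<Longrightarrow> j \<le> r \<Longrightarrow> T j i = T i (j - 1)"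
  shows "(\<Sum>j<Suc r. (- 1) ^ j * (\<Sum>i<r. (- 1) ^ i * T j i)) = 0"
proof -
  let ?g = "\<lambda>(j, i). (- 1) ^ (j + i) * T j i"
  let ?U = "{(j, i). j < Suc r \<and> i < r \<and> i < j}" and ?W = "{(j, i). j < Suc r \<and> i < r \<and> j \<le> i}"
  have fin: "finite ?U" "finite ?W"
    by (rule finite_subset[of _ "{..<Suc r} \<times> {..<r}"]; auto)+
  have "(\<Sum>j<Suc r. (- 1) ^ j * (\<Sum>i<r. (- 1) ^ i * T j i)) = sum ?g ({..<Suc r} \<times> {..<r})"
    by (simp add: sum.cartesian_product[symmetric] sum_distrib_left power_add mult.assoc del: sum.lessThan_Suc)
  also have "{..<Suc r} \<times> {..<r} = ?U \<union> ?W" by auto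
  also have "sum ?g (?U \<union> ?W) = sum ?g ?U + sum ?g ?W"
    by (rule sum.union_disjoint) (use fin in auto)
  also have "sum ?g ?U = sum (\<lambda>x. - ?g x) ?W"
    by (rule sum.reindex_bij_witness[of _ "\<lambda>(j, i). (Suc i, j)" "\<lambda>(j, i). (i, j - 1)"])
       (auto simp: assms Suc_le_eq le_simps, simp_all add: add.commute uminus_power_if)
  finally show ?thesis by (simp add: sum_negf)
qed

context yd_pair
begin

lemma d_m_d_m:
  assumes f: "f \<in> carr (Y A M N n p)"
  shows "d_m A M N (Suc n) p (d_m A M N n p f) = vzero (Y A M N (Suc (Suc n)) p)"
proof (rule Y_eqI)
  note df = d_m_Y(1)[OF f]
  show "d_m A M N (Suc n) p (d_m A M N n p f) \<in> carr (Y A M N (Suc (Suc n)) p)" by (rule d_m_Y(1)[OF df])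
  show "vzero (Y A M N (Suc (Suc n)) p) \<in> carr (Y A M N (Suc (Suc n)) p)" by (rule Y_ops)
  fix \<phi> m and as :: "'a list" assume \<phi>: "multilinear sA sN \<phi>"
  let ?T = "\<lambda>j i. F (Suc (Suc n)) (b_map A M N (Suc n) p j (b_map A M N n p i f)) \<phi> m as"
  have "F (Suc (Suc n)) (b_map A M N (Suc n) p j (d_m A M N n p f)) \<phi> m as =
      (\<Sum>i<Suc (Suc n). (- 1) ^ i * ?T j i)" if "j < Suc (Suc (Suc n))" for j
    using linear_alt_sum[OF linear_b_map[of j "Suc n" p], of "n + 2" "\<lambda>i. b_map A M N n p i f" \<phi> m as]
      that b_carr[OF f] \<phi> by (simp add: d_m_def less_Suc_eq_le del: sum.lessThan_Suc alt_sum.simps)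
  then have "F (Suc (Suc n)) (d_m A M N (Suc n) p (d_m A M N n p f)) \<phi> m as =
      (\<Sum>j<Suc (Suc (Suc n)). (- 1) ^ j * (\<Sum>i<Suc (Suc n). (- 1) ^ i * ?T j i))"
    by (simp add: d_m_Y(2)[OF df \<phi>] del: sum.lessThan_Suc)
  also have "\<dots> = 0"
    by (rule cosimplicial_sum_zero) (simp add: b_b[OF f])
  finally show "F (Suc (Suc n)) (d_m A M N (Suc n) p (d_m A M N n p f)) \<phi> m as =
      F (Suc (Suc n)) (vzero (Y A M N (Suc (Suc n)) p)) \<phi> m as"
    by (simp add: Y_ops \<phi>)
qed

lemma d_c_d_c:
  assumes f: "f \<in> carr (Y A M N n p)"
  shows "d_c A M N n (Suc p) (d_c A M N n p f) = vzero (Y A M N n (Suc (Suc p)))"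
proof (rule Y_eqI)
  note df = d_c_Y(1)[OF f]
  show "d_c A M N n (Suc p) (d_c A M N n p f) \<in> carr (Y A M N n (Suc (Suc p)))" by (rule d_c_Y(1)[OF df])
  show "vzero (Y A M N n (Suc (Suc p))) \<in> carr (Y A M N n (Suc (Suc p)))" by (rule Y_ops)
  fix \<phi> m and as :: "'a list" assume \<phi>: "multilinear sA sN \<phi>"
  let ?T = "\<lambda>j i. F n (c_map A M N n (Suc p) j (c_map A M N n p i f)) \<phi> m as"
  have "F n (c_map A M N n (Suc p) j (d_c A M N n p f)) \<phi> m as =
      (\<Sum>i<Suc (Suc p). (- 1) ^ i * ?T j i)" if "j < Suc (Suc (Suc p))" for j
    using linear_alt_sum[OF linear_c_map[of j "Suc p" n], of "p + 2" "\<lambda>i. c_map A M N n p i f" \<phi> m as]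
      that c_carr[OF f] \<phi> by (simp add: d_c_def less_Suc_eq_le del: sum.lessThan_Suc alt_sum.simps)
  then have "F n (d_c A M N n (Suc p) (d_c A M N n p f)) \<phi> m as =
      (\<Sum>j<Suc (Suc (Suc p)). (- 1) ^ j * (\<Sum>i<Suc (Suc p). (- 1) ^ i * ?T j i))"
    by (simp add: d_c_Y(2)[OF df \<phi>] del: sum.lessThan_Suc)
  also have "\<dots> = 0"
    by (rule cosimplicial_sum_zero) (simp add: c_c[OF f])
  finally show "F n (d_c A M N n (Suc p) (d_c A M N n p f)) \<phi> m as =
      F n (vzero (Y A M N n (Suc (Suc p)))) \<phi> m as"
    by (simp add: Y_ops \<phi>)
qed

lemma d_c_d_m:
  assumes f: "f \<in> carr (Y A M N n p)"
  shows "d_c A M N (Suc n) p (d_m A M N n p f) = d_m A M N n (Suc p) (d_c A M N n p f)"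
proof (rule Y_eqI)
  note dm = d_m_Y(1)[OF f] and dc = d_c_Y(1)[OF f]
  show "d_c A M N (Suc n) p (d_m A M N n p f) \<in> carr (Y A M N (Suc n) (Suc p))" by (rule d_c_Y(1)[OF dm])
  show "d_m A M N n (Suc p) (d_c A M N n p f) \<in> carr (Y A M N (Suc n) (Suc p))" by (rule d_m_Y(1)[OF dc])
  fix \<phi> m and as :: "'a list" assume \<phi>: "multilinear sA sN \<phi>"
  let ?T = "\<lambda>j i. F (Suc n) (c_map A M N (Suc n) p j (b_map A M N n p i f)) \<phi> m as"
  have c: "F (Suc n) (c_map A M N (Suc n) p j (d_m A M N n p f)) \<phi> m as =
      (\<Sum>i<Suc (Suc n). (- 1) ^ i * ?T j i)" if "j < Suc (Suc p)" for j
    using linear_alt_sum[OF linear_c_map[of j p "Suc n"], of "n + 2" "\<lambda>i. b_map A M N n p i f" \<phi> m as]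
      that b_carr[OF f] \<phi> by (simp add: d_m_def less_Suc_eq_le del: sum.lessThan_Suc alt_sum.simps)
  have b: "F (Suc n) (b_map A M N n (Suc p) i (d_c A M N n p f)) \<phi> m as =
      (\<Sum>j<Suc (Suc p). (- 1) ^ j * ?T j i)" if "i < Suc (Suc n)" for i
  proof -
    have "F (Suc n) (b_map A M N n (Suc p) i (d_c A M N n p f)) \<phi> m as =
      (\<Sum>j<Suc (Suc p). (- 1) ^ j * F (Suc n) (b_map A M N n (Suc p) i (c_map A M N n p j f)) \<phi> m as)"
      using linear_alt_sum[OF linear_b_map[of i n "Suc p"], of "p + 2" "\<lambda>i. c_map A M N n p i f" \<phi> m as]
        that c_carr[OF f] \<phi> by (simp add: d_c_def less_Suc_eq_le del: sum.lessThan_Suc alt_sum.simps)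
    also have "\<dots> = (\<Sum>j<Suc (Suc p). (- 1) ^ j * ?T j i)"
      by (rule sum.cong) (use that in \<open>simp_all add: c_b[OF f] less_Suc_eq_le\<close>)
    finally show ?thesis .
  qed
  have "F (Suc n) (d_c A M N (Suc n) p (d_m A M N n p f)) \<phi> m as =
      (\<Sum>j<Suc (Suc p). \<Sum>i<Suc (Suc n). (- 1) ^ j * ((- 1) ^ i * ?T j i))"
    by (simp add: d_c_Y(2)[OF dm \<phi>] c sum_distrib_left del: sum.lessThan_Suc)
  also have "\<dots> = (\<Sum>i<Suc (Suc n). \<Sum>j<Suc (Suc p). (- 1) ^ i * ((- 1) ^ j * ?T j i))"
    by (subst sum.swap) (simp only: mult.left_commute)
  also have "\<dots> = F (Suc n) (d_m A M N n (Suc p) (d_c A M N n p f)) \<phi> m as"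
    by (simp add: d_m_Y(2)[OF dc \<phi>] b sum_distrib_left del: sum.lessThan_Suc)
  finally show "F (Suc n) (d_c A M N (Suc n) p (d_m A M N n p f)) \<phi> m as =
      F (Suc n) (d_m A M N n (Suc p) (d_c A M N n p f)) \<phi> m as" .
qed

end

theorem mainTheorem1:
  fixes A :: "('k :: field, 'a :: ring_1) bialgebra_data"
    and M :: "('k, 'a, 'm :: ab_group_add) yd_data"
    and N :: "('k, 'a, 'n :: ab_group_add) yd_data"
  assumes "is_bialgebra A"
    and "is_yetter_drinfeld A M"
    and "is_yetter_drinfeld A N"
  shows "\<forall>n p.
    linear_map (Y A M N n p) (Y A M N (n + 1) p) (d_m A M N n p) \<and>
    linear_map (Y A M N n p) (Y A M N n (p + 1)) (d_c A M N n p) \<and>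
    (\<forall>f \<in> carr (Y A M N n p).
       d_m A M N (n + 1) p (d_m A M N n p f) = vzero (Y A M N (n + 2) p) \<and>
       d_c A M N n (p + 1) (d_c A M N n p f) = vzero (Y A M N n (p + 2)) \<and>
       d_c A M N (n + 1) p (d_m A M N n p f) = d_m A M N n (p + 1) (d_c A M N n p f))"
proof -
  interpret yd_pair A M N
    by unfold_locales (fact assms)+
  show ?thesis
    using linear_d_m linear_d_c d_m_d_m d_c_d_c d_c_d_m by simp
qed

end
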